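(* Let $a(t)=(a^{ij}(t))$ be a symmetric $d\times d$-matrix-valued Borel measurable function on $(0,T)$ such that $a^{ij}(t)\lambda^i\lambda^j\ge|\lambda|^2$ for all $t\in(0,T)$, $\lambda\in\mathbb{R}^d$, and $\int_0^T\operatorname{tr}a(t)\,dt<\infty$. Then for any $f\in B_c((0,T),C_0^\infty(\mathbb{R}^d))$ there exists a unique function $u$, continuous in $[0,T]\times\mathbb{R}^d$, which is a solution of $$\partial_t u(t,x)=a^{ij}(t)D_{ij}u(t,x)+f(t,x)$$ in $(0,T)\times\mathbb{R}^d$ with zero initial data and such that $u(t,\cdot)\in C^{2+\alpha}(\mathbb{R}^d)$ for any $t\in[0,T]$ and, for any $i,j=1,\dots,d$ and any unit vector $l\in\mathbb{R}^d$, $$\sup_{(t,x)\in[0,T]\times\mathbb{R}^d}|u(t,x)|\le T\sup_{(t,x)\in(0,T)\times\mathbb{R}^d}|f(t,x)|,$$ $$\sup_{t\in[0,T]}[D_{ij}u(t,\cdot)]_{C^\alpha(\mathbb{R}^d)}\le N'(\alpha)N_0(\alpha)\sup_{t\in(0,T)}[f(t,\cdot)]_{C^\alpha(\mathbb{R}^d)},$$ $$\sup_{(t,x)\in[0,T]\times\mathbb{R}^d}[D_l^2u(t,x+l\,\cdot)]_{C^\alpha(\mathbb{R})}\le N_0(\alpha)\sup_{(t,x)\in(0,T)\times\mathbb{R}^d}[f(t,x+l\,\cdot)]_{C^\alpha(\mathbb{R})},$$ $$\|D_l^2u\|^p_{L_p((0,T)\times\mathbb{R}^d)}\le N_p\|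f\|^p_{L_p((0,T)\times\mathbb{R}^d)}.$$
   Context: Fix $T\in(0,\infty)$, $\alpha\in(0,1)$, $p\in(1,\infty)$, $d\ge1$. Summation over repeated indices is understood. $D_i=\partial/\partial x^i$, $D_{ij}=D_iD_j$, and for a unit vector $l$, $D_l^2=l^il^jD_{ij}$. Hölder spaces: $[f]_{C^\alpha(\mathbb{R}^d)}=\sup_{x\ne y}|f(x)-f(y)|/|x-y|^\alpha$; $C^{2+\alpha}(\mathbb{R}^d)$ is the space of twice continuously differentiable real $f$ with $\|f\|_{C^{2+\alpha}(\mathbb{R}^d)}=\sup_x(|f|+|Df|+|D^2f|)+[D^2f]_{C^\alpha(\mathbb{R}^d)}<\infty$. For a function $\phi(t,x)$, $[\phi(t,x+l\,\cdot)]_{C^\alpha(\mathbb{R})}$ is the $C^\alpha(\mathbb{R})$-seminorm of $\mu\mapsto\phi(t,x+\mu l)$; in particular $[D_l^2u(t,x+l\,\cdot)]_{C^\alpha(\mathbb{R})}$ is that of $\mu\mapsto(D_l^2u)(t,x+\mu l)$. $B_c((0,T),C_0^\infty(\mathbb{R}^d))$ is the set of bounded Borel functions $f(t,x)$ on $(0,T)\times\mathbb{R}^d$ such that $f(t,\cdot)\in C_0^\infty(\mathbb{R}^d)$ for every $t$, for every $n=0,1,\dots$ the $C^n(\mathbb{R}^d)$-norms of $f(t,\cdot)$ are bounded over $t\in(0,T)$, and the supports of all $f(t,\cdot)$ lie in one common ball. Equations are understood in integral form: $u$ solves the equation with zero initial data if $u(t,x)=\int_0^t[a^{ij}(s)D_{ij}u(s,x)+f(s,x)]\,ds$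 for all $t\in[0,T]$, $x\in\mathbb{R}^d$. Constants $N_0(\alpha),N_p$ (from the one-dimensional heat equation): it is known that for each $f\in B_c((0,T),C_0^\infty(\mathbb{R}))$ the problem $u(t,x)=\int_0^t(D^2u(s,x)+f(s,x))\,ds$, $t\in[0,T]$, $x\in\mathbb{R}$, has a unique solution that is continuous in $[0,T]\times\mathbb{R}$ with $u(t,\cdot)\in C^{2+\alpha}(\mathbb{R})$ for all $t$ and $\sup_{t}\|u(t,\cdot)\|_{C^{2+\alpha}(\mathbb{R})}\le N_0(T,\alpha)\sup_t\|f(t,\cdot)\|_{C^\alpha(\mathbb{R})}$ for a constant $N_0(T,\alpha)$ depending only on $T,\alpha$. $N_0(\alpha)$ and $N_p$ are finite constants such that for all such $f$ this solution satisfies $\sup_{t\in[0,T]}[D^2u(t,\cdot)]_{C^\alpha(\mathbb{R})}\le N_0(\alpha)\sup_{t\in(0,T)}[f(t,\cdot)]_{C^\alpha(\mathbb{R})}$ and $\|D^2u\|^p_{L_p((0,T)\times\mathbb{R})}\le N_p\|f\|^p_{L_p((0,T)\times\mathbb{R})}$. Constant $N'(\alpha)$: a constant, depending only on $\alpha$, such that whenever $v\in C^{2+\alpha}(\mathbb{R}^d)$ satisfies $\sup_{x\in\mathbb{R}^d}[D_l^2v(x+l\,\cdot)]_{C^\alpha(\mathbb{R})}\le1$ for every unit vector $l\in\mathbb{R}^d$, one has $[D_{ij}v]_{C^\alpha(\mathbb{R}^d)}\le N'(\alpha)$ for all $i,j=1,\dots,d$. *)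

theory Defs
  imports "HOL-Analysis.Analysis"
begin

text \<open>All norms and seminorms take values in \<open>ennreal\<close>, so that suprema need no boundedness
  side conditions. Functions on \<open>(0,T) \<times> \<real>\<^sup>d\<close> or \<open>[0,T] \<times> \<real>\<^sup>d\<close> are curried total functions;
  their values at other times are never used.\<close>

text \<open>\<open>partials [b\<^sub>1, \<dots>, b\<^sub>k] f = D\<^bsub>b1\<^esub> \<dots> D\<^bsub>bk\<^esub> f\<close>.\<close>

primrec partials ::
    "'a list \<Rightarrow> ('a::euclidean_space \<Rightarrow> real) \<Rightarrow> 'a \<Rightarrow> real" where
  "partials [] f = f"
| "partials (b # bs) f = (\<lambda>x. frechet_derivative (partials bs f) (at x) b)"

definition C_k :: "nat \<Rightarrow> ('a::euclidean_space \<Rightarrow> real) \<Rightarrow> bool" where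
  "C_k n f \<longleftrightarrow> (\<forall>bs. set bs \<subseteq> Basis \<longrightarrow>
     (length bs < n \<longrightarrow> (\<forall>x. partials bs f differentiable (at x))) \<and>
     (length bs \<le> n \<longrightarrow> continuous_on UNIV (partials bs f)))"

text \<open>Index set of the \<open>k\<close>-th derivative tensor \<open>D\<^sup>k f\<close>; its Euclidean norm is the
  \<open>L2_set\<close> over this set.\<close>

definition tensor_index :: "nat \<Rightarrow> ('a::euclidean_space) list set" where
  "tensor_index k = {bs. set bs \<subseteq> Basis \<and> length bs = k}"

definition C_k_norm :: "nat \<Rightarrow> ('a::euclidean_space \<Rightarrow> real) \<Rightarrow> ennreal" where
  "C_k_norm n f =
     (SUP x. ennreal (\<Sum>k\<le>n. L2_set (\<lambda>bs. partials bs f x) (tensor_index k)))"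

definition holder_seminorm :: "real \<Rightarrow> ('a::euclidean_space \<Rightarrow> real) \<Rightarrow> ennreal" where
  "holder_seminorm \<alpha> f =
     (SUP (x, y)\<in>{(x, y). x \<noteq> y}. ennreal (\<bar>f x - f y\<bar> / norm (x - y) powr \<alpha>))"

text \<open>The seminorm \<open>[D\<^sup>2f]\<close> of the Hessian, measured in the Euclidean matrix norm.\<close>

definition holder_seminorm_D2 :: "real \<Rightarrow> ('a::euclidean_space \<Rightarrow> real) \<Rightarrow> ennreal" where
  "holder_seminorm_D2 \<alpha> f =
     (SUP (x, y)\<in>{(x, y). x \<noteq> y}.
        ennreal (L2_set (\<lambda>bs. partials bs f x - partials bs f y) (tensor_index 2)
                 / norm (x - y) powr \<alpha>))"

definition C_2_holder_norm :: "real \<Rightarrow> ('a::euclidean_space \<Rightarrow> real) \<Rightarrow> ennreal" where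
  "C_2_holder_norm \<alpha> f = C_k_norm 2 f + holder_seminorm_D2 \<alpha> f"

definition C_2_holder :: "real \<Rightarrow> ('a::euclidean_space \<Rightarrow> real) set" where
  "C_2_holder \<alpha> = {f. C_k 2 f \<and> C_2_holder_norm \<alpha> f < \<infinity>}"

definition C0_infinity :: "('a::euclidean_space \<Rightarrow> real) set" where
  "C0_infinity = {f. (\<forall>n. C_k n f) \<and> compact (closure (support_on UNIV f))}"

definition B_c :: "real \<Rightarrow> (real \<Rightarrow> 'a::euclidean_space \<Rightarrow> real) set" where
  "B_c T = {f.
     (\<lambda>(t, x). f t x) \<in> borel_measurable (restrict_space borel ({0<..<T} \<times> UNIV)) \<and>
     bounded ((\<lambda>(t, x). f t x) ` ({0<..<T} \<times> UNIV)) \<and>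
     (\<forall>t\<in>{0<..<T}. f t \<in> C0_infinity) \<and>
     (\<forall>n. (SUP t\<in>{0<..<T}. C_k_norm n (f t)) < \<infinity>) \<and>
     (\<exists>R. \<forall>t\<in>{0<..<T}. closure (support_on UNIV (f t)) \<subseteq> cball 0 R)}"

text \<open>\<open>u(t,x) = \<integral>\<^sub>0\<^sup>t F(s,x) ds\<close> for all \<open>t \<in> [0,T]\<close> and all \<open>x\<close>. Integrability is required
  explicitly, since the integral of a non-integrable function is \<open>0\<close> by convention.\<close>

definition is_time_integral ::
    "real \<Rightarrow> (real \<Rightarrow> 'a \<Rightarrow> real) \<Rightarrow> (real \<Rightarrow> 'a \<Rightarrow> real) \<Rightarrow> bool" where
  "is_time_integral T F u \<longleftrightarrow> (\<forall>t\<in>{0..T}. \<forall>x.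
     set_integrable lborel {0<..<t} (\<lambda>s. F s x) \<and>
     u t x = (LINT s:{0<..<t}|lborel. F s x))"

text \<open>\<open>\<parallel>g\<parallel>\<^sup>p\<close> in \<open>L\<^sub>p((0,T) \<times> \<real>\<^sup>d)\<close>.\<close>

definition Lp_norm_pow ::
    "real \<Rightarrow> real \<Rightarrow> (real \<Rightarrow> 'a::euclidean_space \<Rightarrow> real) \<Rightarrow> ennreal" where
  "Lp_norm_pow T p g =
     (\<integral>\<^sup>+ z \<in> {0<..<T} \<times> UNIV. ennreal (\<bar>g (fst z) (snd z)\<bar> powr p) \<partial>lborel)"

text \<open>The solution of the one-dimensional heat equation \<open>\<partial>\<^sub>t u = D\<^sup>2 u + f\<close> with zero initial
  data. The last condition is part of the class in which the solution is unique: continuous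
  solutions that are bounded for each \<open>t\<close>, but not uniformly in \<open>t\<close>, need not be unique.\<close>

definition heat_solution_1d ::
    "real \<Rightarrow> real \<Rightarrow> (real \<Rightarrow> real \<Rightarrow> real) \<Rightarrow> (real \<Rightarrow> real \<Rightarrow> real) \<Rightarrow> bool" where
  "heat_solution_1d T \<alpha> f u \<longleftrightarrow>
     continuous_on ({0..T} \<times> UNIV) (\<lambda>(t, x). u t x) \<and>
     is_time_integral T (\<lambda>s x. partials [1, 1] (u s) x + f s x) u \<and>
     (\<forall>t\<in>{0..T}. u t \<in> C_2_holder \<alpha>) \<and>
     (SUP t\<in>{0..T}. C_2_holder_norm \<alpha> (u t)) < \<infinity>"

text \<open>The defining properties of the constants \<open>N\<^sub>0(\<alpha>)\<close> and \<open>N\<^sub>p\<close>.\<close>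

definition heat_holder_constant :: "real \<Rightarrow> real \<Rightarrow> real \<Rightarrow> bool" where
  "heat_holder_constant T \<alpha> N \<longleftrightarrow> (\<forall>f\<in>B_c T. \<forall>u. heat_solution_1d T \<alpha> f u \<longrightarrow>
     (SUP t\<in>{0..T}. holder_seminorm \<alpha> (partials [1, 1] (u t)))
       \<le> ennreal N * (SUP t\<in>{0<..<T}. holder_seminorm \<alpha> (f t)))"

definition heat_Lp_constant :: "real \<Rightarrow> real \<Rightarrow> real \<Rightarrow> real \<Rightarrow> bool" where
  "heat_Lp_constant T \<alpha> p N \<longleftrightarrow> (\<forall>f\<in>B_c T. \<forall>u. heat_solution_1d T \<alpha> f u \<longrightarrow>
     Lp_norm_pow T p (\<lambda>t. partials [1, 1] (u t)) \<le> ennreal N * Lp_norm_pow T p f)"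

definition D2 :: "'n::finite \<Rightarrow> 'n \<Rightarrow> (real^'n \<Rightarrow> real) \<Rightarrow> real^'n \<Rightarrow> real" where
  "D2 i j f = partials [axis i 1, axis j 1] f"

definition D2_dir :: "real^'n \<Rightarrow> (real^'n \<Rightarrow> real) \<Rightarrow> real^'n \<Rightarrow> real" where
  "D2_dir l f x = (\<Sum>i\<in>UNIV. \<Sum>j\<in>UNIV. l $ i * l $ j * D2 i j f x)"

text \<open>The defining property of the constant \<open>N'(\<alpha>)\<close>; the dimension is that of the type \<open>'n\<close>.\<close>

definition directional_holder_constant :: "'n::finite itself \<Rightarrow> real \<Rightarrow> real \<Rightarrow> bool" where
  "directional_holder_constant _ \<alpha> N \<longleftrightarrow>
     (\<forall>v \<in> (C_2_holder \<alpha> :: (real^'n \<Rightarrow> real) set).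
        (\<forall>l. norm l = 1 \<longrightarrow>
           (SUP x. holder_seminorm \<alpha> (\<lambda>\<mu>::real. D2_dir l v (x + \<mu> *\<^sub>R l))) \<le> 1) \<longrightarrow>
        (\<forall>i j. holder_seminorm \<alpha> (D2 i j v) \<le> ennreal N))"

end

theory Submission
  imports Defs
begin

text \<open>
  Fix a unit vector \<open>l\<close>. Since \<open>a(t) \<ge> I \<ge> l l^T\<close>, the equation is the heat equation along \<open>l\<close>,
  perturbed by the degenerate elliptic operator \<open>(a - l l^T) : D^2\<close>. Such a perturbation can be
  produced by moving the data around at random: if \<open>y\<close> is a path in \<open>\<real>^d\<close> and \<open>v\<close> solves the heat
  equation along \<open>l\<close> with the data \<open>f(t, x - y(t))\<close>, then \<open>v(t, x + y(t))\<close> solves it with the data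
  \<open>f\<close> between two jumps of \<open>y\<close>, and the expectation of this function picks up the second order term
  \<open>B : D^2\<close> when \<open>y\<close> is a centred random walk whose increment over a time interval has the
  covariance \<open>2 \<integral> B\<close>. Shifting changes neither side of the one-dimensional estimates, and the
  estimates are convex in the solution. So they hold, with the same constants, for every average of
  shifted solutions, and then for the limit in which the jumps get small.

  It is enough to use walks that jump at dyadic times and take finitely many values in each jump.
  One jump is the operation \<open>jump\<close>, which turns a solution operator into another one. That it
  inserts \<open>B : D^2\<close> up to a negligible error is the Taylor expansion \<open>walk_expansion\<close>. Steps of a
  random walk do not increase the supremum norm, so the errors only add up (\<open>walk_stability\<close>); this
  discrete maximum principle gives the convergence of the scheme
  (\<open>perturbed_solution_operator\<close>) and also uniqueness (\<open>homogeneous_solution_zero\<close>).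

  The perturbation theorem is used three times: with \<open>B = a\<close> and with \<open>B = l l^T\<close>, starting from the
  equation \<open>\<partial>\<^sub>t u = f\<close> without diffusion, it gives the solution \<open>u\<close> and the solutions of the heat
  equation along \<open>l\<close>; with \<open>B = a - l l^T\<close>, starting from the latter, it gives an operator that has
  the two line estimates. By uniqueness this operator is the one that produced \<open>u\<close>
  (\<open>elliptic_line_estimates\<close>). On a line the heat equation along \<open>l\<close> is the one-dimensional heat
  equation, which brings in \<open>N\<^sub>0\<close> and \<open>N\<^sub>p\<close>; for the \<open>L\<^sub>p\<close> norm the lines are collected by Tonelli's
  theorem (\<open>Lp_norm_pow_lines\<close>). The supremum bound holds for the equation without diffusion and
  survives averaging, and the estimate of all \<open>D\<^sub>i D\<^sub>j u\<close> follows from the line estimates by the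
  definition of \<open>N'\<close> after scaling (\<open>directional_to_full_holder\<close>).
\<close>


section \<open>Positive semidefinite forms and random walks\<close>

text \<open>A matrix is given by its entries on pairs of basis vectors, so that everything works over an
  arbitrary Euclidean space, in particular over \<open>\<real>\<close> and \<open>\<real>^d\<close>. The product \<open>contract A H\<close> is the
  trace product \<open>A : H\<close>; with \<open>H = D^2 u\<close> it is the second order operator of the equation.\<close>

definition contract :: "('a::euclidean_space \<Rightarrow> 'a \<Rightarrow> real) \<Rightarrow> ('a \<Rightarrow> 'a \<Rightarrow> real) \<Rightarrow> real" where
  "contract A H = (\<Sum>b\<in>Basis. \<Sum>c\<in>Basis. A b c * H b c)"

definition outer :: "'a::euclidean_space \<Rightarrow> 'a \<Rightarrow> 'a \<Rightarrow> real" where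
  "outer v b c = (v \<bullet> b) * (v \<bullet> c)"

text \<open>For \<open>H = D^2 u\<close> this is the second derivative of \<open>u\<close> in the direction \<open>v\<close>.\<close>

definition quad :: "('a::euclidean_space \<Rightarrow> 'a \<Rightarrow> real) \<Rightarrow> 'a \<Rightarrow> real" where
  "quad H v = contract (outer v) H"

definition tr :: "('a::euclidean_space \<Rightarrow> 'a \<Rightarrow> real) \<Rightarrow> real" where
  "tr A = (\<Sum>b\<in>Basis. A b b)"

definition psd :: "('a::euclidean_space \<Rightarrow> 'a \<Rightarrow> real) \<Rightarrow> bool" where
  "psd A \<longleftrightarrow> (\<forall>b\<in>Basis. \<forall>c\<in>Basis. A b c = A c b) \<and> (\<forall>\<xi>. 0 \<le> contract A (outer \<xi>))"

lemma contract_cong: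
  assumes "\<And>b c. b \<in> Basis \<Longrightarrow> c \<in> Basis \<Longrightarrow> A b c = A' b c"
    and "\<And>b c. b \<in> Basis \<Longrightarrow> c \<in> Basis \<Longrightarrow> H b c = H' b c"
  shows "contract A H = contract A' H'"
  using assms by (simp add: contract_def)

lemma contract_add_left: "contract (\<lambda>b c. A b c + B b c) H = contract A H + contract B H"
  by (simp add: contract_def algebra_simps sum.distrib)

lemma contract_add_right: "contract A (\<lambda>b c. H b c + G b c) = contract A H + contract A G"
  by (simp add: contract_def algebra_simps sum.distrib)

lemma contract_diff_left: "contract (\<lambda>b c. A b c - B b c) H = contract A H - contract B H"
  by (simp add: contract_def algebra_simps sum_subtractf)

lemma contract_diff_right: "contract A (\<lambda>b c. H b c - G b c) = contract A H - contract A G"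
  by (simp add: contract_def algebra_simps sum_subtractf)

lemma contract_scale_right: "contract A (\<lambda>b c. k * H b c) = k * contract A H"
  by (simp add: contract_def sum_distrib_left mult_ac)

lemma contract_sum_right: "contract A (\<lambda>b c. \<Sum>j\<in>J. H j b c) = (\<Sum>j\<in>J. contract A (H j))"
  by (induction J rule: infinite_finite_induct) (simp_all add: contract_add_right, simp_all add: contract_def)

lemma contract_sum_left: "contract (\<lambda>b c. \<Sum>j\<in>J. A j b c) H = (\<Sum>j\<in>J. contract (A j) H)"
  by (induction J rule: infinite_finite_induct) (simp_all add: contract_add_left, simp_all add: contract_def)

lemma contract_outer_Basis: "b \<in> Basis \<Longrightarrow> contract A (outer b) = A b b"
  by (simp add: contract_def outer_def inner_Basis if_distrib [where f = "\<lambda>x. _ * x"]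
      if_distrib [where f = "\<lambda>x. x * _"] sum.delta cong: if_cong)

lemma quad_scaleR: "quad H (k *\<^sub>R v) = k\<^sup>2 * quad H v"
  by (simp add: quad_def contract_def outer_def sum_distrib_left power2_eq_square mult_ac)

lemma quad_minus [simp]: "quad H (- v) = quad H v"
  using quad_scaleR[of H "-1" v] by simp

lemma quad_diff: "quad (\<lambda>b c. H b c - G b c) v = quad H v - quad G v"
  by (simp add: quad_def contract_diff_right)

lemma contract_entries_bound:
  assumes "\<And>b c. b \<in> Basis \<Longrightarrow> c \<in> Basis \<Longrightarrow> \<bar>H b c\<bar> \<le> C"
  shows "\<bar>contract A H\<bar> \<le> (\<Sum>b\<in>Basis. \<Sum>c\<in>Basis. \<bar>A b c\<bar>) * C"
proof -
  have "\<bar>contract A H\<bar> \<le> (\<Sum>b\<in>Basis. \<Sum>c\<in>Basis. \<bar>A b c * H b c\<bar>)"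
    unfolding contract_def
    by (rule order_trans[OF sum_abs]) (intro sum_mono sum_abs)
  also have "\<dots> \<le> (\<Sum>b\<in>Basis. \<Sum>c\<in>Basis. \<bar>A b c\<bar> * C)"
    using assms by (intro sum_mono) (auto simp: abs_mult intro!: mult_left_mono)
  finally show ?thesis by (simp add: sum_distrib_right)
qed

lemma quad_entries_bound:
  fixes v :: "'a::euclidean_space"
  assumes "\<And>b c. b \<in> Basis \<Longrightarrow> c \<in> Basis \<Longrightarrow> \<bar>H b c\<bar> \<le> C"
  shows "\<bar>quad H v\<bar> \<le> C * (real DIM('a))\<^sup>2 * (norm v)\<^sup>2"
proof -
  have C: "0 \<le> C"
    using assms[OF SOME_Basis SOME_Basis] by linarith
  have "\<bar>quad H v\<bar> \<le> (\<Sum>b\<in>(Basis::'a set). \<Sum>c\<in>(Basis::'a set). \<bar>outer v b c\<bar>) * C"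
    unfolding quad_def by (rule contract_entries_bound) (use assms in auto)
  also have "\<dots> \<le> (\<Sum>b\<in>(Basis::'a set). \<Sum>c\<in>(Basis::'a set). norm v * norm v) * C"
    using C by (intro mult_right_mono sum_mono)
      (auto simp: outer_def abs_mult intro!: mult_mono Basis_le_norm)
  finally show ?thesis
    by (simp add: power2_eq_square mult_ac)
qed

lemma contract_outer_shift:
  fixes e \<xi> :: "'a::euclidean_space"
  assumes e: "e \<in> Basis" and sym: "\<And>b c. b \<in> Basis \<Longrightarrow> c \<in> Basis \<Longrightarrow> A b c = A c b"
  shows "contract A (outer (\<xi> + t *\<^sub>R e))
    = contract A (outer \<xi>) + 2 * t * (\<Sum>c\<in>Basis. A e c * (\<xi> \<bullet> c)) + t\<^sup>2 * A e e"
proof -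
  have d: "e \<bullet> b = (if b = e then 1 else 0)" if "b \<in> Basis" for b
    using that e by (auto simp: inner_Basis)
  have "contract A (outer (\<xi> + t *\<^sub>R e)) = contract A (\<lambda>b c. outer \<xi> b c
      + (t * ((if b = e then 1 else 0) * (\<xi> \<bullet> c)) + (t * ((\<xi> \<bullet> b) * (if c = e then 1 else 0))
      + t\<^sup>2 * outer e b c)))"
    by (rule contract_cong) (auto simp: outer_def inner_add_left d algebra_simps power2_eq_square)
  also have "\<dots> = contract A (outer \<xi>) + (t * contract A (\<lambda>b c. (if b = e then 1 else 0) * (\<xi> \<bullet> c))
      + (t * contract A (\<lambda>b c. (\<xi> \<bullet> b) * (if c = e then 1 else 0)) + t\<^sup>2 * A e e))"
    by (simp add: contract_add_right contract_scale_right contract_outer_Basis e)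
  also have "contract A (\<lambda>b c. (if b = e then 1 else 0) * (\<xi> \<bullet> c)) = (\<Sum>b\<in>Basis. if b = e then (\<Sum>c\<in>Basis. A e c * (\<xi> \<bullet> c)) else 0)"
    unfolding contract_def by (intro sum.cong) auto
  also have "\<dots> = (\<Sum>c\<in>Basis. A e c * (\<xi> \<bullet> c))"
    using e by simp
  also have "contract A (\<lambda>b c. (\<xi> \<bullet> b) * (if c = e then 1 else 0)) = (\<Sum>b\<in>Basis. \<Sum>c\<in>Basis. if c = e then A e b * (\<xi> \<bullet> b) else 0)"
    unfolding contract_def using sym e by (intro sum.cong refl) auto
  also have "\<dots> = (\<Sum>c\<in>Basis. A e c * (\<xi> \<bullet> c))"
    using e by simp
  finally show ?thesis by (simp add: algebra_simps)
qed

text \<open>Cholesky's algorithm. If \<open>A e e = 0\<close> then the whole row of \<open>e\<close> vanishes, because a nonnegative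
  quadratic polynomial without quadratic term has no linear term; otherwise subtracting a rank one
  form clears the row of \<open>e\<close> and leaves a form that is again positive semidefinite.\<close>

lemma psd_factor_on:
  fixes A :: "'a::euclidean_space \<Rightarrow> 'a \<Rightarrow> real"
  assumes "finite S" "S \<subseteq> Basis" "psd A"
    and "\<And>b c. b \<in> Basis \<Longrightarrow> c \<in> Basis \<Longrightarrow> b \<notin> S \<or> c \<notin> S \<Longrightarrow> A b c = 0"
  shows "\<exists>v. \<forall>b\<in>Basis. \<forall>c\<in>Basis. A b c = (\<Sum>e\<in>S. outer (v e) b c)"
  using assms
proof (induction S arbitrary: A)
  case empty
  then show ?case by simp
next
  case (insert e S)
  have e: "e \<in> Basis" using insert by auto
  have sym: "\<And>b c. b \<in> Basis \<Longrightarrow> c \<in> Basis \<Longrightarrow> A b c = A c b"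
    and pos: "\<And>\<xi>. 0 \<le> contract A (outer \<xi>)"
    using \<open>psd A\<close> unfolding psd_def by auto
  define rw where "rw \<xi> = (\<Sum>c\<in>Basis. A e c * (\<xi> \<bullet> c))" for \<xi>
  have q: "0 \<le> contract A (outer \<xi>) + 2 * t * rw \<xi> + t\<^sup>2 * A e e" for t \<xi>
    using pos[of "\<xi> + t *\<^sub>R e"] contract_outer_shift[OF e sym, where \<xi> = \<xi> and t = t] by (simp add: rw_def)
  have rwb: "rw c = A e c" if "c \<in> Basis" for c
    using that unfolding rw_def
    by (simp add: inner_Basis if_distrib [where f = "\<lambda>x. _ * x"] cong: if_cong)
  have Aee: "0 \<le> A e e" using pos[of e] by (simp add: contract_outer_Basis e)
  show ?case
  proof (cases "A e e = 0")
    case True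
    have r0: "rw \<xi> = 0" for \<xi>
    proof (rule ccontr)
      assume n: "rw \<xi> \<noteq> 0"
      define t where "t = - (contract A (outer \<xi>) + 1) / (2 * rw \<xi>)"
      have "2 * t * rw \<xi> = - (contract A (outer \<xi>) + 1)" using n by (simp add: t_def field_simps)
      then show False using q[of \<xi> t] True by simp
    qed
    have "A b c = 0" if "b \<in> Basis" "c \<in> Basis" "b \<notin> S \<or> c \<notin> S" for b c
      using that insert.prems(3)[of b c] r0 rwb sym e by (cases "b = e"; cases "c = e") auto
    then obtain v where v: "\<forall>b\<in>Basis. \<forall>c\<in>Basis. A b c = (\<Sum>e\<in>S. outer (v e) b c)"
      using insert.IH[of A] insert.prems by auto
    have s: "(\<Sum>k\<in>S. outer ((v(e := 0)) k) b c) = (\<Sum>k\<in>S. outer (v k) b c)" for b c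
      using insert.hyps(2) by (intro sum.cong) auto
    have "\<forall>b\<in>Basis. \<forall>c\<in>Basis. A b c = (\<Sum>k\<in>insert e S. outer ((v(e := 0)) k) b c)"
      using v insert.hyps s by (simp add: outer_def)
    then show ?thesis by blast
  next
    case False
    then have p: "0 < A e e" using Aee by simp
    \<comment> \<open>Completing the square in the variable \<open>e\<close> leaves a form that ignores \<open>e\<close>.\<close>
    define w where "w = (\<Sum>c\<in>Basis. (A e c / sqrt (A e e)) *\<^sub>R c)"
    have w: "w \<bullet> c = A e c / sqrt (A e e)" if "c \<in> Basis" for c
      using that unfolding w_def by (simp add: inner_sum_left_Basis)
    have ww: "outer w b c = A e b * A e c / A e e" if "b \<in> Basis" "c \<in> Basis" for b c
      using that p by (simp add: outer_def w)
    define A' where "A' b c = A b c - outer w b c" for b c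
    have "0 \<le> contract A' (outer \<xi>)" for \<xi>
    proof -
      have "contract (outer w) (outer \<xi>) = (\<Sum>b\<in>Basis. \<Sum>c\<in>Basis. (A e b * (\<xi> \<bullet> b)) * (A e c * (\<xi> \<bullet> c)) / A e e)"
        unfolding contract_def by (intro sum.cong refl) (simp add: ww outer_def[of \<xi>] mult_ac)
      also have "\<dots> = (rw \<xi>)\<^sup>2 / A e e"
        by (simp add: rw_def power2_eq_square sum_product sum_divide_distrib)
      finally have "contract A' (outer \<xi>) = contract A (outer \<xi>) - (rw \<xi>)\<^sup>2 / A e e"
        unfolding A'_def by (simp add: contract_diff_left)
      moreover have "0 \<le> contract A (outer \<xi>) - (rw \<xi>)\<^sup>2 / A e e"
        using q[of \<xi> "- rw \<xi> / A e e"] p by (simp add: field_simps power2_eq_square)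
      ultimately show ?thesis by simp
    qed
    moreover have "A' b c = A' c b" if "b \<in> Basis" "c \<in> Basis" for b c
      using that sym by (simp add: A'_def outer_def mult.commute)
    ultimately have psd': "psd A'" unfolding psd_def by blast
    have "A' b c = 0" if "b \<in> Basis" "c \<in> Basis" "b \<notin> S \<or> c \<notin> S" for b c
      using that insert.prems(3)[of b c] insert.prems(3)[of b e] insert.prems(3)[of e c] sym[of b e] p e
      by (cases "b = e"; cases "c = e") (auto simp: A'_def ww)
    then obtain v where v: "\<forall>b\<in>Basis. \<forall>c\<in>Basis. A' b c = (\<Sum>e\<in>S. outer (v e) b c)"
      using insert.IH[of A'] insert.prems psd' by auto
    have s: "(\<Sum>k\<in>S. outer ((v(e := w)) k) b c) = (\<Sum>k\<in>S. outer (v k) b c)" for b c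
      using insert.hyps(2) by (intro sum.cong) auto
    have "\<forall>b\<in>Basis. \<forall>c\<in>Basis. A b c = (\<Sum>k\<in>insert e S. outer ((v(e := w)) k) b c)"
    proof (intro ballI)
      fix b c :: 'a assume "b \<in> Basis" "c \<in> Basis"
      then have "A b c - outer w b c = (\<Sum>e\<in>S. outer (v e) b c)" using v unfolding A'_def by blast
      then show "A b c = (\<Sum>k\<in>insert e S. outer ((v(e := w)) k) b c)"
        using insert.hyps s[of b c] by (simp del: fun_upd_apply) simp
    qed
    then show ?thesis by blast
  qed
qed

text \<open>The vectors \<open>v e\<close> are the columns of a matrix \<open>V\<close> with \<open>A = V V^T\<close>; they are the directions in which a random
  walk with covariance proportional to \<open>A\<close> steps.\<close>

definition factors :: "('a::euclidean_space \<Rightarrow> 'a) \<Rightarrow> ('a \<Rightarrow> 'a \<Rightarrow> real) \<Rightarrow> bool" where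
  "factors v A \<longleftrightarrow> (\<forall>b\<in>Basis. \<forall>c\<in>Basis. A b c = (\<Sum>e\<in>Basis. outer (v e) b c))"

lemma psd_factor: "psd A \<Longrightarrow> \<exists>v. factors v A"
  unfolding factors_def by (rule psd_factor_on) auto

lemma factors_contract: "factors v A \<Longrightarrow> contract A H = (\<Sum>e\<in>Basis. quad H (v e))"
  unfolding factors_def quad_def contract_sum_left[symmetric] by (rule contract_cong) auto

lemma factors_tr:
  assumes "factors v A" shows "tr A = (\<Sum>e\<in>Basis. (norm (v e))\<^sup>2)"
proof -
  have "tr A = (\<Sum>b\<in>Basis. \<Sum>e\<in>Basis. outer (v e) b b)"
    using assms unfolding tr_def factors_def by simp
  also have "\<dots> = (\<Sum>e\<in>Basis. \<Sum>b\<in>Basis. outer (v e) b b)" by (rule sum.swap)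
  also have "\<dots> = (\<Sum>e\<in>Basis. (norm (v e))\<^sup>2)"
    by (simp add: outer_def power2_norm_eq_inner euclidean_inner[of "v _" "v _"])
  finally show ?thesis .
qed

lemma psd_tr_nonneg: "psd A \<Longrightarrow> 0 \<le> tr A"
  by (metis (no_types, lifting) factors_tr psd_factor sum_nonneg zero_le_power2)

text \<open>Contracting with a positive semidefinite form only sees second derivatives in the directions of a
  factorization. This is why estimates of pure directional second derivatives suffice throughout.\<close>

lemma psd_contract_bound:
  assumes "psd A" and "\<And>v. \<bar>quad H v\<bar> \<le> \<kappa> * (norm v)\<^sup>2"
  shows "\<bar>contract A H\<bar> \<le> \<kappa> * tr A"
proof -
  obtain v where v: "factors v A" using psd_factor[OF assms(1)] by blast
  have "\<bar>contract A H\<bar> \<le> (\<Sum>e\<in>Basis. \<bar>quad H (v e)\<bar>)"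
    by (simp add: factors_contract[OF v])
  also have "\<dots> \<le> (\<Sum>e\<in>Basis. \<kappa> * (norm (v e))\<^sup>2)"
    using assms(2) by (intro sum_mono)
  finally show ?thesis by (simp add: factors_tr[OF v] sum_distrib_left)
qed

lemma psd_entry_bound:
  assumes "psd A" "b \<in> Basis" "c \<in> Basis"
  shows "\<bar>A b c\<bar> \<le> tr A"
proof -
  obtain v where v: "factors v A" using psd_factor[OF assms(1)] by blast
  have "\<bar>A b c\<bar> \<le> (\<Sum>e\<in>Basis. \<bar>outer (v e) b c\<bar>)"
    using v assms unfolding factors_def by simp
  also have "\<dots> \<le> (\<Sum>e\<in>Basis. (norm (v e))\<^sup>2)"
    using assms by (intro sum_mono) (auto simp: outer_def abs_mult power2_eq_square intro!: mult_mono Basis_le_norm)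
  finally show ?thesis by (simp add: factors_tr[OF v])
qed

lemma contract_outer_outer: "contract (outer l) (outer \<xi>) = (l \<bullet> \<xi>)\<^sup>2"
proof -
  have "contract (outer l) (outer \<xi>) = (\<Sum>b\<in>Basis. (l \<bullet> b) * (\<xi> \<bullet> b))\<^sup>2"
    by (simp add: contract_def outer_def power2_eq_square sum_product mult_ac)
  then show ?thesis by (simp add: euclidean_inner[of l \<xi>])
qed

lemma psd_outer: "psd (outer l)"
  unfolding psd_def contract_outer_outer by (simp add: outer_def mult.commute)

lemma psd_add: "psd A \<Longrightarrow> psd B \<Longrightarrow> psd (\<lambda>b c. A b c + B b c)"
  unfolding psd_def by (auto simp: contract_add_left)

section \<open>Taylor expansion of one step of a random walk\<close>

definition has_hessian ::
    "('a::euclidean_space \<Rightarrow> real) \<Rightarrow> ('a \<Rightarrow> 'a \<Rightarrow> real) \<Rightarrow> ('a \<Rightarrow> 'a \<Rightarrow> 'a \<Rightarrow> real) \<Rightarrow> bool" where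
  "has_hessian g g1 g2 \<longleftrightarrow>
     (\<forall>x. (g has_derivative (\<lambda>h. \<Sum>b\<in>Basis. (h \<bullet> b) * g1 b x)) (at x)) \<and>
     (\<forall>c\<in>Basis. \<forall>x. (g1 c has_derivative (\<lambda>h. \<Sum>b\<in>Basis. (h \<bullet> b) * g2 b c x)) (at x))"

text \<open>Hoelder continuity of the Hessian, measured by its quadratic form: this is what the Taylor formula
  consumes. The exponent \<open>\<alpha> = 0\<close> is allowed and then says that the Hessian has bounded oscillation.\<close>

definition holder2 :: "real \<Rightarrow> real \<Rightarrow> ('a::euclidean_space \<Rightarrow> 'a \<Rightarrow> 'a \<Rightarrow> real) \<Rightarrow> bool" where
  "holder2 K \<alpha> H \<longleftrightarrow> (\<forall>x y v. \<bar>quad (\<lambda>b c. H b c x) v - quad (\<lambda>b c. H b c y) v\<bar>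
     \<le> K * norm (x - y) powr \<alpha> * (norm v)\<^sup>2)"

lemma has_hessian_diff:
  assumes "has_hessian g g1 g2" "has_hessian k k1 k2"
  shows "has_hessian (\<lambda>x. g x - k x) (\<lambda>b x. g1 b x - k1 b x) (\<lambda>b c x. g2 b c x - k2 b c x)"
  using assms unfolding has_hessian_def
  by (auto intro!: derivative_eq_intros simp: algebra_simps sum_subtractf)

lemma holder2_diff:
  assumes "holder2 K \<alpha> H" "holder2 L \<alpha> G"
  shows "holder2 (K + L) \<alpha> (\<lambda>b c x. H b c x - G b c x)"
  unfolding holder2_def
proof (intro allI)
  fix x y v :: 'a
  have "\<bar>quad (\<lambda>b c. H b c x) v - quad (\<lambda>b c. H b c y) v\<bar> \<le> K * norm (x - y) powr \<alpha> * (norm v)\<^sup>2"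
    "\<bar>quad (\<lambda>b c. G b c x) v - quad (\<lambda>b c. G b c y) v\<bar> \<le> L * norm (x - y) powr \<alpha> * (norm v)\<^sup>2"
    using assms unfolding holder2_def by auto
  then show "\<bar>quad (\<lambda>b c. H b c x - G b c x) v - quad (\<lambda>b c. H b c y - G b c y) v\<bar>
      \<le> (K + L) * norm (x - y) powr \<alpha> * (norm v)\<^sup>2"
    unfolding quad_diff by (simp add: algebra_simps)
qed

lemma DERIV_along_line:
  fixes g :: "'a::euclidean_space \<Rightarrow> real"
  assumes "(g has_derivative (\<lambda>h. \<Sum>b\<in>Basis. (h \<bullet> b) * g1 b)) (at (x + r *\<^sub>R v))"
  shows "((\<lambda>r. g (x + r *\<^sub>R v)) has_field_derivative (\<Sum>b\<in>Basis. (v \<bullet> b) * g1 b)) (at r)"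
proof -
  have "((\<lambda>r. x + r *\<^sub>R v) has_derivative (\<lambda>s. s *\<^sub>R v)) (at r)"
    by (auto intro!: derivative_eq_intros)
  from diff_chain_at[OF this assms]
  have "((\<lambda>r. g (x + r *\<^sub>R v)) has_derivative (\<lambda>s. \<Sum>b\<in>Basis. ((s *\<^sub>R v) \<bullet> b) * g1 b)) (at r)"
    by (simp add: o_def)
  also have "(\<lambda>s. \<Sum>b\<in>Basis. ((s *\<^sub>R v) \<bullet> b) * g1 b) = (*) (\<Sum>b\<in>Basis. (v \<bullet> b) * g1 b)"
    by (rule ext) (simp add: sum_distrib_left mult_ac)
  finally show ?thesis
    by (simp add: has_field_derivative_def)
qed

text \<open>Taylor's formula with Lagrange remainder along the segment from \<open>x\<close> to \<open>x + v\<close>; the Hessian at the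
  intermediate point differs from the one at \<open>x\<close> by at most the Hoelder bound.\<close>

lemma taylor2:
  fixes g :: "'a::euclidean_space \<Rightarrow> real"
  assumes h: "has_hessian g g1 g2" and H: "holder2 K \<alpha> g2" and "0 \<le> \<alpha>" "0 \<le> K"
  shows "\<bar>g (x + v) - g x - (\<Sum>b\<in>Basis. (v \<bullet> b) * g1 b x) - quad (\<lambda>b c. g2 b c x) v / 2\<bar>
    \<le> K / 2 * norm v powr (2 + \<alpha>)"
proof (cases "v = 0")
  case True
  then show ?thesis by (simp add: quad_def contract_def outer_def)
next
  case False
  define d :: "nat \<Rightarrow> real \<Rightarrow> real" where
    "d m r = (if m = 0 then g (x + r *\<^sub>R v) else if m = 1 then (\<Sum>b\<in>Basis. (v \<bullet> b) * g1 b (x + r *\<^sub>R v))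
       else quad (\<lambda>b c. g2 b c (x + r *\<^sub>R v)) v)" for m r
  have d1: "DERIV (d 0) r :> d 1 r" for r
    using h unfolding d_def has_hessian_def by (auto intro: DERIV_along_line)
  have d2: "DERIV (d 1) r :> d 2 r" for r
  proof -
    have "DERIV (\<lambda>r. \<Sum>c\<in>Basis. (v \<bullet> c) * g1 c (x + r *\<^sub>R v)) r :>
        (\<Sum>c\<in>Basis. (v \<bullet> c) * (\<Sum>b\<in>Basis. (v \<bullet> b) * g2 b c (x + r *\<^sub>R v)))"
      using h unfolding has_hessian_def
      by (intro DERIV_sum DERIV_cmult DERIV_along_line) auto
    also have "(\<Sum>c\<in>Basis. (v \<bullet> c) * (\<Sum>b\<in>Basis. (v \<bullet> b) * g2 b c (x + r *\<^sub>R v))) = d 2 r"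
      unfolding d_def quad_def contract_def outer_def
      by (simp add: sum_distrib_left) (subst sum.swap, simp add: mult_ac)
    finally show ?thesis unfolding d_def by simp
  qed
  have "\<exists>t::real. 0 < t \<and> t < 1 \<and>
      d 0 1 = sum (\<lambda>m. (d m 0 / fact m) * 1 ^ m) {..<2} + (d 2 t / fact 2) * 1 ^ 2"
  proof (rule Maclaurin)
    show "\<forall>m t. m < 2 \<and> 0 \<le> t \<and> t \<le> 1 \<longrightarrow> DERIV (d m) t :> d (Suc m) t"
    proof (intro allI impI)
      fix m :: nat and t :: real assume "m < 2 \<and> 0 \<le> t \<and> t \<le> 1"
      then have "m = 0 \<or> m = 1" by linarith
      then show "DERIV (d m) t :> d (Suc m) t"
        using d1[of t] d2[of t] by (auto simp: numeral_2_eq_2)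
    qed
  qed auto
  then obtain t where t: "0 < t" "t < 1" "d 0 1 = d 0 0 + d 1 0 + d 2 t / 2"
    by (auto simp: numeral_2_eq_2)
  have "\<bar>g (x + v) - g x - (\<Sum>b\<in>Basis. (v \<bullet> b) * g1 b x) - quad (\<lambda>b c. g2 b c x) v / 2\<bar> = \<bar>d 2 t - d 2 0\<bar> / 2"
    using t(3) by (simp add: d_def) (simp add: abs_if field_simps)
  also have "\<bar>d 2 t - d 2 0\<bar> \<le> K * norm ((x + t *\<^sub>R v) - x) powr \<alpha> * (norm v)\<^sup>2"
    using H[unfolded holder2_def, rule_format, of "x + t *\<^sub>R v" v x] by (simp add: d_def)
  also have "\<dots> \<le> K * norm v powr \<alpha> * (norm v)\<^sup>2"
    using t assms by (intro mult_right_mono mult_left_mono powr_mono2) (auto simp: mult_left_le_one_le)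
  also have "\<dots> = K * norm v powr (2 + \<alpha>)"
    using False by (simp add: powr_add powr_numeral)
  finally show ?thesis by simp
qed

text \<open>One step of the walk chooses a vector \<open>v e\<close> of a factorization and a sign, with equal
  probabilities.\<close>

definition signs :: "('a::euclidean_space \<times> real) set" where
  "signs = Basis \<times> {-1, 1}"

text \<open>The factor \<open>sqrt (2 * DIM('a))\<close> compensates for the probability \<open>1 / DIM('a)\<close> of each direction and
  makes the covariance of the step twice the factored form, as for the heat equation
  \<open>\<partial>\<^sub>t u = B : D^2 u\<close>.\<close>

definition walk_step :: "('a::euclidean_space \<Rightarrow> 'a) \<Rightarrow> 'a \<times> real \<Rightarrow> 'a" where
  "walk_step v j = (snd j * sqrt (2 * DIM('a))) *\<^sub>R v (fst j)"

definition walk :: "('a::euclidean_space \<Rightarrow> 'a) \<Rightarrow> ('a \<Rightarrow> real) \<Rightarrow> 'a \<Rightarrow> real" where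
  "walk v g x = (\<Sum>j\<in>signs. g (x + walk_step v j)) / (2 * DIM('a))"

lemma finite_signs [simp]: "finite signs"
  by (simp add: signs_def)

lemma card_signs: "card (signs :: ('a::euclidean_space \<times> real) set) = 2 * DIM('a)"
  by (simp add: signs_def card_cartesian_product)

lemma sum_signs: "sum g signs = (\<Sum>e\<in>Basis. g (e, -1) + g (e, 1))"
proof -
  have "sum g signs = (\<Sum>e\<in>Basis. \<Sum>s\<in>{-1,1}. g (e, s))"
    unfolding signs_def by (subst sum.cartesian_product) simp
  then show ?thesis by simp
qed

lemma average_const: "(\<Sum>j\<in>(signs :: ('a::euclidean_space \<times> real) set). c) / (2 * DIM('a)) = (c::real)"
  by (simp add: card_signs)

lemma average_mono:
  fixes g :: "'a::euclidean_space \<times> real \<Rightarrow> real"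
  assumes "\<And>j. j \<in> signs \<Longrightarrow> \<bar>g j\<bar> \<le> c"
  shows "\<bar>sum g signs / (2 * DIM('a))\<bar> \<le> c"
proof -
  have "\<bar>sum g signs\<bar> \<le> (\<Sum>j\<in>(signs :: ('a \<times> real) set). c)"
    by (rule order_trans[OF sum_abs sum_mono]) (use assms in auto)
  then have "\<bar>sum g signs\<bar> / (2 * DIM('a)) \<le> (\<Sum>j\<in>(signs :: ('a \<times> real) set). c) / (2 * DIM('a))"
    by (intro divide_right_mono) auto
  then show ?thesis by (simp only: average_const abs_divide abs_of_nat)
qed

lemma walk_bound: "(\<And>x. \<bar>g x\<bar> \<le> c) \<Longrightarrow> \<bar>walk v g x\<bar> \<le> c"
  unfolding walk_def by (rule average_mono) auto

text \<open>The first order terms cancel because steps are symmetric, and the second order terms average to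
  \<open>B : D^2 g\<close> by the choice of the step length. The error is of higher order than \<open>tr B\<close> as soon as
  \<open>\<alpha> > 0\<close>; for \<open>\<alpha> = 0\<close> it is still a bound for a single step.\<close>

lemma walk_expansion:
  fixes g :: "'a::euclidean_space \<Rightarrow> real"
  assumes v: "factors v B" and h: "has_hessian g g1 g2" and H: "holder2 K \<alpha> g2" and "0 \<le> \<alpha>" "0 \<le> K"
  shows "\<bar>walk v g x - g x - contract B (\<lambda>b c. g2 b c x)\<bar> \<le> K / 2 * (2 * DIM('a) * tr B) powr (1 + \<alpha> / 2)"
proof -
  let ?d = "real DIM('a)"
  let ?L = "\<lambda>w. \<Sum>b\<in>Basis. (w \<bullet> b) * g1 b x"
  let ?Q = "quad (\<lambda>b c. g2 b c x)"
  define R where "R j = g (x + walk_step v j) - g x - ?L (walk_step v j) - ?Q (walk_step v j) / 2" for j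
  have R: "\<bar>R j\<bar> \<le> K / 2 * (2 * ?d * tr B) powr (1 + \<alpha> / 2)" if j: "j \<in> signs" for j
  proof -
    obtain e s where es: "j = (e, s)" "e \<in> Basis" "s = -1 \<or> s = 1" using j by (auto simp: signs_def)
    have "(norm (v e))\<^sup>2 \<le> tr B"
      unfolding factors_tr[OF v] using es(2) by (intro member_le_sum) auto
    moreover have "(norm (walk_step v j))\<^sup>2 = 2 * ?d * (norm (v e))\<^sup>2"
      using es by (auto simp: walk_step_def power_mult_distrib)
    ultimately have le: "(norm (walk_step v j))\<^sup>2 \<le> 2 * ?d * tr B"
      by (simp add: mult_left_mono)
    have "norm (walk_step v j) powr (2 + \<alpha>) = ((norm (walk_step v j))\<^sup>2) powr (1 + \<alpha> / 2)"
    proof -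
      have "(norm (walk_step v j))\<^sup>2 = norm (walk_step v j) powr 2" by simp
      then show ?thesis by (simp only: powr_powr) (simp add: distrib_left)
    qed
    also have "\<dots> \<le> (2 * ?d * tr B) powr (1 + \<alpha> / 2)"
      using le assms by (intro powr_mono2) auto
    finally have "K / 2 * norm (walk_step v j) powr (2 + \<alpha>) \<le> K / 2 * (2 * ?d * tr B) powr (1 + \<alpha> / 2)"
      using assms(5) by (intro mult_left_mono) auto
    with taylor2[OF h H assms(4,5), of x "walk_step v j"] show ?thesis
      unfolding R_def by (rule order_trans)
  qed
  have lin: "(\<Sum>j\<in>signs. ?L (walk_step v j)) = 0"
    unfolding sum_signs by (simp add: walk_step_def sum_negf)
  have Q1: "?Q (walk_step v (e, 1)) = 2 * ?d * ?Q (v e)" for e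
    by (simp add: walk_step_def quad_scaleR)
  have Q2: "?Q (walk_step v (e, -1)) = 2 * ?d * ?Q (v e)" for e
    by (simp add: walk_step_def quad_scaleR)
  have "(\<Sum>j\<in>signs. ?Q (walk_step v j) / 2) = 2 * ?d * (\<Sum>e\<in>Basis. ?Q (v e))"
    unfolding sum_signs by (simp add: Q1 Q2 sum_distrib_left mult.assoc)
  also have "\<dots> = 2 * ?d * contract B (\<lambda>b c. g2 b c x)"
    by (simp add: factors_contract[OF v])
  finally have "sum R signs = 2 * ?d * walk v g x - 2 * ?d * g x - 2 * ?d * contract B (\<lambda>b c. g2 b c x)"
    unfolding R_def sum_subtractf lin walk_def by (simp add: card_signs)
  then have "sum R signs / (2 * ?d) = walk v g x - g x - contract B (\<lambda>b c. g2 b c x)"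
    by (simp add: field_simps)
  then show ?thesis using average_mono[of R, OF R] by simp
qed

text \<open>A discrete maximum principle. A function that follows \<open>w\<^sub>k\<^sub>+\<^sub>1 \<approx> w\<^sub>k + B\<^sub>k : D^2 w\<^sub>k\<close> also follows
  \<open>w\<^sub>k\<^sub>+\<^sub>1 \<approx> walk w\<^sub>k\<close>, and averages do not increase the supremum, so only the errors accumulate.\<close>

lemma walk_stability:
  fixes w :: "nat \<Rightarrow> 'a::euclidean_space \<Rightarrow> real"
  assumes B: "\<And>k. k < n \<Longrightarrow> psd (B k)"
    and h: "\<And>k. k < n \<Longrightarrow> has_hessian (w k) (w1 k) (w2 k)"
    and H: "\<And>k. k < n \<Longrightarrow> holder2 K \<alpha> (w2 k)" and "0 \<le> \<alpha>" "0 \<le> K"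
    and step: "\<And>k x. k < n \<Longrightarrow> \<bar>w (Suc k) x - w k x - contract (B k) (\<lambda>b c. w2 k b c x)\<bar> \<le> e k"
    and init: "\<And>x. w 0 x = 0"
  shows "\<bar>w n x\<bar> \<le> (\<Sum>k<n. e k + K / 2 * (2 * DIM('a) * tr (B k)) powr (1 + \<alpha> / 2))"
proof -
  have "m \<le> n \<Longrightarrow> \<bar>w m x\<bar> \<le> (\<Sum>k<m. e k + K / 2 * (2 * DIM('a) * tr (B k)) powr (1 + \<alpha> / 2))" for m x
  proof (induction m arbitrary: x)
    case 0
    then show ?case using init by simp
  next
    case (Suc m)
    then have m: "m < n" by simp
    obtain v where v: "factors v (B m)" using psd_factor[OF B[OF m]] by blast
    have "\<bar>walk v (w m) x\<bar> \<le> (\<Sum>k<m. e k + K / 2 * (2 * DIM('a) * tr (B k)) powr (1 + \<alpha> / 2))"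
      by (rule walk_bound) (use Suc in auto)
    with walk_expansion[OF v h[OF m] H[OF m] assms(4,5), of x] step[OF m, of x]
    show ?case unfolding sum.lessThan_Suc abs_le_iff by linarith
  qed
  then show ?thesis by simp
qed


section \<open>Integrals over time intervals\<close>

lemma set_integrable_subinterval:
  fixes g :: "real \<Rightarrow> real"
  assumes "set_integrable lborel {a<..<b} g" "a \<le> r" "t \<le> b"
  shows "set_integrable lborel {r<..<t} g"
  by (rule set_integrable_subset[OF assms(1)]) (use assms in auto)

lemma time_integral_split:
  fixes g :: "real \<Rightarrow> real"
  assumes "r \<le> q" "q \<le> t" and g: "set_integrable lborel {r<..<t} g"
  shows "(LINT s:{r<..<t}|lborel. g s) = (LINT s:{r<..<q}|lborel. g s) + (LINT s:{q<..<t}|lborel. g s)"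
proof -
  have i: "set_integrable lborel {r<..<q} g" "set_integrable lborel {q<..<t} g"
    using set_integrable_subinterval[OF g] assms by auto
  have "(LINT s:{r<..<t}|lborel. g s) =
      (LINT s|lborel. indicator {r<..<q} s *\<^sub>R g s + indicator {q<..<t} s *\<^sub>R g s)"
    unfolding set_lebesgue_integral_def
  proof (rule integral_cong_AE)
    show "AE s in lborel. indicator {r<..<t} s *\<^sub>R g s
        = indicator {r<..<q} s *\<^sub>R g s + indicator {q<..<t} s *\<^sub>R g s"
      using AE_lborel_singleton[of q]
      by (rule AE_mp) (use assms in \<open>auto simp: indicator_def\<close>)
  qed (use g i in \<open>auto simp: set_integrable_def\<close>)
  also have "\<dots> = (LINT s:{r<..<q}|lborel. g s) + (LINT s:{q<..<t}|lborel. g s)"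
    using i unfolding set_lebesgue_integral_def set_integrable_def by simp
  finally show ?thesis .
qed

lemma time_integral_bound:
  fixes g h :: "real \<Rightarrow> real"
  assumes "set_integrable lborel {r<..<t} g" "set_integrable lborel {r<..<t} h"
    and "\<And>s. r < s \<Longrightarrow> s < t \<Longrightarrow> \<bar>g s\<bar> \<le> h s"
  shows "\<bar>LINT s:{r<..<t}|lborel. g s\<bar> \<le> (LINT s:{r<..<t}|lborel. h s)"
proof -
  have "\<bar>LINT s:{r<..<t}|lborel. g s\<bar> \<le> (LINT s:{r<..<t}|lborel. \<bar>g s\<bar>)"
    using set_integral_norm_bound[OF assms(1)] by simp
  also have "\<dots> \<le> (LINT s:{r<..<t}|lborel. h s)"
    using assms by (intro set_integral_mono set_integrable_abs) auto
  finally show ?thesis .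
qed

lemma time_integral_nonneg:
  fixes h :: "real \<Rightarrow> real"
  assumes "\<And>s. r < s \<Longrightarrow> s < t \<Longrightarrow> 0 \<le> h s"
  shows "0 \<le> (LINT s:{r<..<t}|lborel. h s)"
  unfolding set_lebesgue_integral_def
  by (rule Bochner_Integration.integral_nonneg) (use assms in \<open>auto simp: indicator_def\<close>)

lemma time_integral_mono_interval:
  fixes h :: "real \<Rightarrow> real"
  assumes h: "set_integrable lborel {r<..<t} h" and nn: "\<And>s. r < s \<Longrightarrow> s < t \<Longrightarrow> 0 \<le> h s"
    and "r \<le> r'" "r' \<le> t'" "t' \<le> t"
  shows "(LINT s:{r'<..<t'}|lborel. h s) \<le> (LINT s:{r<..<t}|lborel. h s)"
proof -
  have "(LINT s:{r<..<t}|lborel. h s) = (LINT s:{r<..<r'}|lborel. h s) + (LINT s:{r'<..<t}|lborel. h s)"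
    using assms by (intro time_integral_split) auto
  also have "(LINT s:{r'<..<t}|lborel. h s) = (LINT s:{r'<..<t'}|lborel. h s) + (LINT s:{t'<..<t}|lborel. h s)"
    using assms by (intro time_integral_split set_integrable_subinterval[OF h]) auto
  finally show ?thesis
    using time_integral_nonneg[of r r' h] time_integral_nonneg[of t' t h] assms by force
qed

lemma time_integral_sum_grid:
  fixes g :: "real \<Rightarrow> real"
  assumes "\<And>k. p \<le> k \<Longrightarrow> k < q \<Longrightarrow> \<tau> k \<le> \<tau> (Suc k)" "p \<le> q" and g: "set_integrable lborel {\<tau> p<..<\<tau> q} g"
  shows "(\<Sum>k=p..<q. LINT s:{\<tau> k<..<\<tau> (Suc k)}|lborel. g s) = (LINT s:{\<tau> p<..<\<tau> q}|lborel. g s)"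
  using assms(2,1,3)
proof (induction q rule: dec_induct)
  case base
  then show ?case by (simp add: set_lebesgue_integral_def)
next
  case (step q)
  have m: "\<tau> p \<le> \<tau> q" using step(1,4)
  proof (induction q rule: dec_induct)
    case (step n)
    then show ?case using step(4)[of n] by fastforce
  qed simp
  have l: "\<tau> q \<le> \<tau> (Suc q)" using step by simp
  have "set_integrable lborel {\<tau> p<..<\<tau> q} g"
    using set_integrable_subinterval[OF step(5)] l by auto
  then have "(\<Sum>k=p..<q. LINT s:{\<tau> k<..<\<tau> (Suc k)}|lborel. g s) = (LINT s:{\<tau> p<..<\<tau> q}|lborel. g s)"
    using step by auto
  then show ?case using time_integral_split[OF m l step(5)] step(1) by simp
qed

text \<open>Absolute continuity of the integral: the primitive of \<open>g\<close> is uniformly continuous.\<close>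

lemma fine_grid:
  fixes g :: "real \<Rightarrow> real"
  assumes "0 \<le> T" and g: "set_integrable lborel {0<..<T} g" and "0 < \<delta>"
  shows "\<exists>N>0. \<forall>n\<ge>N. \<forall>k<n. (LINT s:{T * real k / real n<..<T * real (Suc k) / real n}|lborel. g s) \<le> \<delta>"
proof -
  have gi: "g integrable_on {0..T}"
    using set_borel_integral_eq_integral(1)[OF g] by (simp add: integrable_on_Icc_iff_Ioo)
  then have "uniformly_continuous_on {0..T} (\<lambda>t. integral {0..t} g)"
    by (intro compact_uniformly_continuous indefinite_integral_continuous_1) auto
  then obtain \<eta> where \<eta>: "\<eta> > 0"
    "\<And>t r. t \<in> {0..T} \<Longrightarrow> r \<in> {0..T} \<Longrightarrow> dist r t < \<eta> \<Longrightarrow> dist (integral {0..r} g) (integral {0..t} g) < \<delta>"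
    unfolding uniformly_continuous_on_def using \<open>0 < \<delta>\<close> by metis
  obtain N :: nat where N: "T / \<eta> < real N" using reals_Archimedean2 by blast
  have "(LINT s:{T * real k / real n<..<T * real (Suc k) / real n}|lborel. g s) \<le> \<delta>"
    if "Suc N \<le> n" "k < n" for n k
  proof -
    let ?r = "T * real k / real n" and ?t = "T * real (Suc k) / real n"
    have n: "0 < real n" using that by simp
    have r: "0 \<le> ?r" using \<open>0 \<le> T\<close> by simp
    have rt: "?r \<le> ?t" using \<open>0 \<le> T\<close> by (intro divide_right_mono mult_left_mono) auto
    have "T * real (Suc k) \<le> T * real n" using that \<open>0 \<le> T\<close> by (intro mult_left_mono) auto
    then have t: "?t \<le> T" using n by (simp add: pos_divide_le_eq)
    have "?t - ?r = T / real n" by (simp add: field_simps diff_divide_distrib[symmetric])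
    also have "\<dots> < \<eta>"
    proof -
      have "T < \<eta> * real N" using N \<eta>(1) by (simp add: field_simps)
      also have "\<dots> \<le> \<eta> * real n" using that \<eta>(1) by (intro mult_left_mono) auto
      finally show ?thesis using n by (simp add: field_simps)
    qed
    finally have d: "dist ?t ?r < \<eta>" using rt by (simp add: dist_real_def)
    have s: "set_integrable lborel {?r<..<?t} g"
      by (rule set_integrable_subinterval[OF g r t])
    have "(LINT s:{?r<..<?t}|lborel. g s) = integral {?r..?t} g"
      using set_borel_integral_eq_integral(2)[OF s] by (simp add: integral_open_interval_real)
    also have "\<dots> = integral {0..?t} g - integral {0..?r} g"
    proof -
      have "g integrable_on {0..?t}"
        by (rule integrable_on_subinterval[OF gi]) (use t in auto)
      from Henstock_Kurzweil_Integration.integral_combine[OF r rt this] show ?thesis by simp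
    qed
    also have "\<dots> \<le> \<delta>"
      using \<eta>(2)[of ?r ?t] d r rt t by (auto simp: dist_real_def)
    finally show ?thesis .
  qed
  then show ?thesis by blast
qed

lemma contract_integrable:
  assumes "\<And>b c. b \<in> Basis \<Longrightarrow> c \<in> Basis \<Longrightarrow> set_integrable lborel I (\<lambda>s. A s b c)"
  shows "set_integrable lborel I (\<lambda>s. contract (A s) H)"
  using assms unfolding set_integrable_def contract_def scaleR_sum_right scaleR_right_distrib
  by (intro Bochner_Integration.integrable_sum) (simp add: mult.assoc[symmetric])

text \<open>Freezing the Hessian and integrating the coefficients commute. This lets coefficients be merely
  integrable in time: only their integrals over the cells of a grid enter the scheme.\<close>

lemma contract_integral:
  assumes "\<And>b c. b \<in> Basis \<Longrightarrow> c \<in> Basis \<Longrightarrow> set_integrable lborel I (\<lambda>s. A s b c)"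
  shows "contract (\<lambda>b c. LINT s:I|lborel. A s b c) H = (LINT s:I|lborel. contract (A s) H)"
proof -
  have "(LINT s:I|lborel. contract (A s) H)
      = (LINT s|lborel. (\<Sum>b\<in>Basis. \<Sum>c\<in>Basis. (indicator I s *\<^sub>R A s b c) * H b c))"
    unfolding set_lebesgue_integral_def contract_def
    by (simp add: sum_distrib_left mult.assoc)
  also have "\<dots> = (\<Sum>b\<in>Basis. \<Sum>c\<in>Basis. (LINT s|lborel. (indicator I s *\<^sub>R A s b c) * H b c))"
  proof -
    have i: "integrable lborel (\<lambda>s. (indicator I s *\<^sub>R A s b c) * H b c)" if "b \<in> Basis" "c \<in> Basis" for b c
      using assms[OF that] unfolding set_integrable_def by (rule integrable_mult_left)
    have "(LINT s|lborel. (\<Sum>b\<in>Basis. \<Sum>c\<in>Basis. (indicator I s *\<^sub>R A s b c) * H b c))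
        = (\<Sum>b\<in>Basis. (LINT s|lborel. (\<Sum>c\<in>Basis. (indicator I s *\<^sub>R A s b c) * H b c)))"
      by (intro Bochner_Integration.integral_sum Bochner_Integration.integrable_sum i)
    also have "\<dots> = (\<Sum>b\<in>Basis. \<Sum>c\<in>Basis. (LINT s|lborel. (indicator I s *\<^sub>R A s b c) * H b c))"
      by (intro sum.cong refl Bochner_Integration.integral_sum i)
    finally show ?thesis .
  qed
  also have "\<dots> = contract (\<lambda>b c. LINT s:I|lborel. A s b c) H"
    unfolding contract_def set_lebesgue_integral_def by simp
  finally show ?thesis by simp
qed

lemma tr_integrable:
  assumes "\<And>b c. b \<in> Basis \<Longrightarrow> c \<in> Basis \<Longrightarrow> set_integrable lborel I (\<lambda>s. A s b c)"
  shows "set_integrable lborel I (\<lambda>s. tr (A s))"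
  using assms unfolding set_integrable_def tr_def scaleR_sum_right
  by (intro Bochner_Integration.integrable_sum) auto

lemma tr_integral:
  assumes "\<And>b c. b \<in> Basis \<Longrightarrow> c \<in> Basis \<Longrightarrow> set_integrable lborel I (\<lambda>s. A s b c)"
  shows "tr (\<lambda>b c. LINT s:I|lborel. A s b c) = (LINT s:I|lborel. tr (A s))"
  using assms unfolding set_integrable_def tr_def set_lebesgue_integral_def scaleR_sum_right
  by (subst Bochner_Integration.integral_sum) auto

lemma psd_integral:
  fixes A :: "real \<Rightarrow> 'a::euclidean_space \<Rightarrow> 'a \<Rightarrow> real"
  assumes "\<And>s. r < s \<Longrightarrow> s < t \<Longrightarrow> psd (A s)"
    and i: "\<And>b c. b \<in> Basis \<Longrightarrow> c \<in> Basis \<Longrightarrow> set_integrable lborel {r<..<t} (\<lambda>s. A s b c)"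
  shows "psd (\<lambda>b c. LINT s:{r<..<t}|lborel. A s b c)"
  unfolding psd_def
proof (intro conjI ballI allI)
  fix b c :: 'a assume "b \<in> Basis" "c \<in> Basis"
  then show "(LINT s:{r<..<t}|lborel. A s b c) = (LINT s:{r<..<t}|lborel. A s c b)"
    using assms(1) unfolding psd_def by (intro set_lebesgue_integral_cong) auto
next
  fix \<xi> :: 'a
  show "0 \<le> contract (\<lambda>b c. LINT s:{r<..<t}|lborel. A s b c) (outer \<xi>)"
  proof -
    have "contract (\<lambda>b c. LINT s:{r<..<t}|lborel. A s b c) (outer \<xi>) = (LINT s:{r<..<t}|lborel. contract (A s) (outer \<xi>))"
      by (rule contract_integral) (rule i)
    also have "\<dots> \<ge> 0"
      by (rule time_integral_nonneg) (use assms(1) in \<open>auto simp: psd_def\<close>)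
    finally show ?thesis .
  qed
qed

section \<open>Uniqueness for the homogeneous equation\<close>

text \<open>Second differences recover \<open>D\<^sub>u\<^sup>2 g\<close> from values of \<open>g\<close> alone. Below this turns control of a function
  into control of its second derivatives, at the price of the Hoelder error.\<close>

lemma second_difference:
  fixes g :: "'a::euclidean_space \<Rightarrow> real"
  assumes h: "has_hessian g g1 g2" and H: "holder2 K \<alpha> g2" and "0 \<le> \<alpha>" "0 \<le> K" and "norm u = 1" "0 < \<epsilon>"
  shows "\<bar>(g (x + \<epsilon> *\<^sub>R u) + g (x - \<epsilon> *\<^sub>R u) - 2 * g x) / \<epsilon>\<^sup>2 - quad (\<lambda>b c. g2 b c x) u\<bar> \<le> K * \<epsilon> powr \<alpha>"
proof -
  let ?Q = "quad (\<lambda>b c. g2 b c x)"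
  let ?L = "\<Sum>b\<in>Basis. (u \<bullet> b) * g1 b x"
  have "\<bar>g (x + \<epsilon> *\<^sub>R u) - g x - \<epsilon> * ?L - \<epsilon>\<^sup>2 * ?Q u / 2\<bar> \<le> K / 2 * \<epsilon> powr (2 + \<alpha>)"
    using taylor2[OF assms(1-4), of x "\<epsilon> *\<^sub>R u"] assms(5,6)
    by (simp add: quad_scaleR sum_distrib_left mult.assoc)
  moreover have "\<bar>g (x - \<epsilon> *\<^sub>R u) - g x + \<epsilon> * ?L - \<epsilon>\<^sup>2 * ?Q u / 2\<bar> \<le> K / 2 * \<epsilon> powr (2 + \<alpha>)"
    using taylor2[OF assms(1-4), of x "- (\<epsilon> *\<^sub>R u)"] assms(5,6)
    by (simp add: quad_scaleR sum_distrib_left mult.assoc sum_negf)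
  ultimately have "\<bar>g (x + \<epsilon> *\<^sub>R u) + g (x - \<epsilon> *\<^sub>R u) - 2 * g x - \<epsilon>\<^sup>2 * ?Q u\<bar> \<le> K * \<epsilon> powr (2 + \<alpha>)"
    by (simp only: abs_le_iff) linarith
  also have "\<epsilon> powr (2 + \<alpha>) = \<epsilon>\<^sup>2 * \<epsilon> powr \<alpha>"
    using \<open>0 < \<epsilon>\<close> by (simp add: powr_add)
  finally have le: "\<bar>g (x + \<epsilon> *\<^sub>R u) + g (x - \<epsilon> *\<^sub>R u) - 2 * g x - \<epsilon>\<^sup>2 * ?Q u\<bar> \<le> \<epsilon>\<^sup>2 * (K * \<epsilon> powr \<alpha>)"
    by (simp add: mult_ac)
  have "(g (x + \<epsilon> *\<^sub>R u) + g (x - \<epsilon> *\<^sub>R u) - 2 * g x) / \<epsilon>\<^sup>2 - ?Q u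
      = (g (x + \<epsilon> *\<^sub>R u) + g (x - \<epsilon> *\<^sub>R u) - 2 * g x - \<epsilon>\<^sup>2 * ?Q u) / \<epsilon>\<^sup>2"
    using \<open>0 < \<epsilon>\<close> by (simp add: field_simps)
  then show ?thesis using le \<open>0 < \<epsilon>\<close> by (simp add: abs_divide pos_divide_le_eq mult_ac)
qed

lemma quad_bound_from_unit:
  fixes v :: "'a::euclidean_space"
  assumes "\<And>u. norm u = 1 \<Longrightarrow> \<bar>quad H u\<bar> \<le> c"
  shows "\<bar>quad H v\<bar> \<le> c * (norm v)\<^sup>2"
proof (cases "v = 0")
  case True
  then show ?thesis by (simp add: quad_def contract_def outer_def)
next
  case False
  have "quad H v = (norm v)\<^sup>2 * quad H (v /\<^sub>R norm v)"
    using False by (simp add: quad_scaleR power_divide divide_inverse[symmetric] power_inverse)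
  then show ?thesis
    using assms[of "v /\<^sub>R norm v"] False by (simp add: abs_mult mult.commute mult_right_mono)
qed

lemma powr_one_plus_le:
  fixes x y a :: real
  assumes "0 \<le> x" "x \<le> y" "0 \<le> a"
  shows "x powr (1 + a) \<le> x * y powr a"
proof -
  have "x powr (1 + a) = x * x powr a"
    using assms by (cases "x = 0") (auto simp: powr_add)
  then show ?thesis using assms by (auto intro!: mult_left_mono powr_mono2)
qed

text \<open>The idea is to compare \<open>w\<close>, on a fine grid, with random walk averages of itself. By
  \<open>walk_stability\<close> it remains to see that \<open>D^2 w\<close> hardly changes within a cell. Second differences
  show first that directional second derivatives are bounded, then by the equation that \<open>w\<close> changes
  in a cell by at most a multiple of the mass \<open>\<delta>\<close> of the coefficients, and then that directional
  second derivatives change by a power of \<open>\<delta>\<close>, uniformly in space. Letting the grid get finer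
  gives \<open>w = 0\<close>.\<close>

lemma homogeneous_solution_zero:
  fixes w :: "real \<Rightarrow> 'a::euclidean_space \<Rightarrow> real"
  assumes A: "\<And>s. s \<in> {0<..<T} \<Longrightarrow> psd (A s)"
    and Ai: "\<And>b c. b \<in> Basis \<Longrightarrow> c \<in> Basis \<Longrightarrow> set_integrable lborel {0<..<T} (\<lambda>s. A s b c)"
    and h: "\<And>t. t \<in> {0..T} \<Longrightarrow> has_hessian (w t) (w1 t) (w2 t)"
    and H: "\<And>t. t \<in> {0..T} \<Longrightarrow> holder2 K \<alpha> (w2 t)" and \<alpha>: "0 < \<alpha>" and K: "0 \<le> K"
    and C: "\<And>t x. t \<in> {0..T} \<Longrightarrow> \<bar>w t x\<bar> \<le> C"
    and wi: "\<And>t x. t \<in> {0..T} \<Longrightarrow> set_integrable lborel {0<..<t} (\<lambda>s. contract (A s) (\<lambda>b c. w2 s b c x))"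
    and w: "\<And>t x. t \<in> {0..T} \<Longrightarrow> w t x = (LINT s:{0<..<t}|lborel. contract (A s) (\<lambda>b c. w2 s b c x))"
    and t0: "t0 \<in> {0..T}"
  shows "w t0 x0 = 0"
proof -
  let ?d = "real DIM('a)"
  define \<beta> where "\<beta> r t = (LINT s:{r<..<t}|lborel. tr (A s))" for r t
  have tri: "set_integrable lborel {r<..<t} (\<lambda>s. tr (A s))" if "0 \<le> r" "t \<le> T" for r t
    using set_integrable_subinterval[OF tr_integrable[of "{0<..<T}" A, OF Ai]] that by auto
  have Ai': "set_integrable lborel {r<..<t} (\<lambda>s. A s b c)" if "0 \<le> r" "t \<le> T" "b \<in> Basis" "c \<in> Basis" for r t b c
    using set_integrable_subinterval[OF Ai] that by auto
  have trn: "0 \<le> tr (A s)" if "s \<in> {0<..<T}" for s using psd_tr_nonneg[OF A[OF that]] .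
  have C0: "0 \<le> C" using C[OF t0, of 0] by linarith
  define M where "M = 4 * C + K"
  have M0: "0 \<le> M" using C0 K by (simp add: M_def)
  have Qu: "\<bar>quad (\<lambda>b c. w2 t b c x) u\<bar> \<le> M" if "t \<in> {0..T}" "norm u = 1" for t x u
    using second_difference[OF h[OF that(1)] H[OF that(1)] less_imp_le[OF \<alpha>] K that(2), of 1 x]
      C[OF that(1), of "x + u"] C[OF that(1), of "x - u"] C[OF that(1), of x]
    by (simp add: M_def abs_le_iff)
  have Q: "\<bar>quad (\<lambda>b c. w2 t b c x) v\<bar> \<le> M * (norm v)\<^sup>2" if "t \<in> {0..T}" for t x v
    by (rule quad_bound_from_unit) (rule Qu[OF that])
  have incr: "w t x - w r x = (LINT s:{r<..<t}|lborel. contract (A s) (\<lambda>b c. w2 s b c x))"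
    if "0 \<le> r" "r \<le> t" "t \<le> T" for r t x
    using time_integral_split[OF that(1,2) wi[of t x]] that w[of t x] w[of r x] by simp
  have wi': "set_integrable lborel {r<..<t} (\<lambda>s. contract (A s) (\<lambda>b c. w2 s b c x))" if "0 \<le> r" "0 \<le> t" "t \<le> T" for r t x
    using set_integrable_subinterval[OF wi[of t x]] that by auto
  have mod: "\<bar>w t x - w r x\<bar> \<le> M * \<beta> r t" if "0 \<le> r" "r \<le> t" "t \<le> T" for r t x
  proof -
    have "\<bar>w t x - w r x\<bar> \<le> (LINT s:{r<..<t}|lborel. M * tr (A s))"
      unfolding incr[OF that]
    proof (rule time_integral_bound)
      fix s assume s: "r < s" "s < t"
      show "\<bar>contract (A s) (\<lambda>b c. w2 s b c x)\<bar> \<le> M * tr (A s)"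
        by (rule psd_contract_bound) (use A Q s that in auto)
    qed (use wi' tri that in auto)
    then show ?thesis by (simp add: \<beta>_def)
  qed
  define \<rho> where "\<rho> \<delta> = 4 * M * \<delta> powr (1/2) + 2 * K * \<delta> powr (\<alpha>/4)" for \<delta> :: real
  have osc: "\<bar>quad (\<lambda>b c. w2 t b c x - w2 r b c x) v\<bar> \<le> \<rho> \<delta> * (norm v)\<^sup>2"
    if rt: "0 \<le> r" "r \<le> t" "t \<le> T" and \<delta>: "0 < \<delta>" "\<beta> r t \<le> \<delta>" for r t x v \<delta>
  proof (rule quad_bound_from_unit)
    fix u :: 'a assume u: "norm u = 1"
    \<comment> \<open>With the difference step \<open>\<epsilon>\<close> the errors are \<open>\<delta> / \<epsilon>^2\<close> and \<open>\<epsilon>^\<alpha>\<close>; any power of \<open>\<delta>\<close> between \<open>0\<close> and \<open>1/2\<close> makes both small.\<close>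
    define \<epsilon> where "\<epsilon> = \<delta> powr (1/4)"
    have \<epsilon>: "0 < \<epsilon>" using \<delta> by (simp add: \<epsilon>_def)
    have \<epsilon>2: "\<epsilon>\<^sup>2 = \<delta> powr (1/2)" using \<delta> unfolding \<epsilon>_def by (simp add: powr_powr flip: powr_numeral)
    have \<epsilon>\<alpha>: "\<epsilon> powr \<alpha> = \<delta> powr (\<alpha>/4)" unfolding \<epsilon>_def by (simp add: powr_powr)
    let ?D = "\<lambda>t. (w t (x + \<epsilon> *\<^sub>R u) + w t (x - \<epsilon> *\<^sub>R u) - 2 * w t x) / \<epsilon>\<^sup>2"
    have 1: "\<bar>?D t - quad (\<lambda>b c. w2 t b c x) u\<bar> \<le> K * \<delta> powr (\<alpha>/4)" if "t \<in> {0..T}" for t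
      using second_difference[OF h[OF that] H[OF that] less_imp_le[OF \<alpha>] K u \<epsilon>] unfolding \<epsilon>\<alpha> .
    have md: "\<bar>w t y - w r y\<bar> \<le> M * \<delta>" for y
      using mod[OF rt, of y] mult_left_mono[OF \<delta>(2) M0] by linarith
    have "\<bar>(w t (x + \<epsilon> *\<^sub>R u) + w t (x - \<epsilon> *\<^sub>R u) - 2 * w t x) - (w r (x + \<epsilon> *\<^sub>R u) + w r (x - \<epsilon> *\<^sub>R u) - 2 * w r x)\<bar> \<le> 4 * M * \<delta>"
      using md[of "x + \<epsilon> *\<^sub>R u"] md[of "x - \<epsilon> *\<^sub>R u"] md[of x] by (simp only: abs_le_iff) linarith
    then have "\<bar>?D t - ?D r\<bar> \<le> 4 * M * \<delta> / \<epsilon>\<^sup>2"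
      unfolding diff_divide_distrib[symmetric] abs_divide using \<epsilon> by (simp add: divide_right_mono)
    also have "\<dots> = 4 * M * \<delta> powr (1/2)"
      unfolding \<epsilon>2 using \<delta>(1) powr_add[of \<delta> "1/2" "1/2"] by (simp add: field_simps)
    finally have "\<bar>?D t - ?D r\<bar> \<le> 4 * M * \<delta> powr (1/2)" .
    then show "\<bar>quad (\<lambda>b c. w2 t b c x - w2 r b c x) u\<bar> \<le> \<rho> \<delta>"
    proof -
      have "t \<in> {0..T}" "r \<in> {0..T}" using rt by auto
      from \<open>\<bar>?D t - ?D r\<bar> \<le> 4 * M * \<delta> powr (1/2)\<close> 1[OF this(1)] 1[OF this(2)] show ?thesis
        unfolding quad_diff \<rho>_def by (simp only: abs_le_iff) linarith
    qed
  qed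
  define S where "S \<delta> = (\<rho> \<delta> + K * ?d * (2 * ?d * \<delta>) powr (\<alpha>/2)) * \<beta> 0 t0" for \<delta>
  have key: "\<bar>w t0 x0\<bar> \<le> S \<delta>" if \<delta>: "0 < \<delta>" for \<delta>
  proof -
    have t0': "0 \<le> t0" "t0 \<le> T" using t0 by auto
    obtain n where n: "0 < n" "\<forall>k<n. (LINT s:{t0 * real k / real n<..<t0 * real (Suc k) / real n}|lborel. tr (A s)) \<le> \<delta>"
      using fine_grid[OF t0'(1) tri[OF order_refl t0'(2)] \<delta>] by blast
    define \<tau> where "\<tau> k = t0 * real k / real n" for k
    have \<tau>0: "\<tau> 0 = 0" and \<tau>n: "\<tau> n = t0" using n by (auto simp: \<tau>_def)
    have \<tau>mono: "\<tau> k \<le> \<tau> m" if "k \<le> m" for k m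
      unfolding \<tau>_def using that t0' by (intro divide_right_mono mult_left_mono) auto
    have \<tau>r: "\<tau> k \<in> {0..T}" if "k \<le> n" for k
      using \<tau>mono[of 0 k] \<tau>mono[OF that] \<tau>0 \<tau>n t0' by auto
    have \<beta>\<delta>: "\<beta> (\<tau> k) (\<tau> (Suc k)) \<le> \<delta>" if "k < n" for k
      using n(2) that unfolding \<tau>_def \<beta>_def by auto
    have \<beta>0: "0 \<le> \<beta> (\<tau> k) (\<tau> (Suc k))" if "k < n" for k
      unfolding \<beta>_def by (rule time_integral_nonneg, rule trn) (use \<tau>r[of k] \<tau>r[of "Suc k"] that in auto)
    define B where "B k b c = (LINT s:{\<tau> k<..<\<tau> (Suc k)}|lborel. A s b c)" for k b c
    have Ak: "set_integrable lborel {\<tau> k<..<\<tau> (Suc k)} (\<lambda>s. A s b c)" if "k < n" "b \<in> Basis" "c \<in> Basis" for k b c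
      using Ai'[of "\<tau> k" "\<tau> (Suc k)" b c] \<tau>r[of k] \<tau>r[of "Suc k"] that by auto
    have trB: "tr (B k) = \<beta> (\<tau> k) (\<tau> (Suc k))" if "k < n" for k
      unfolding B_def \<beta>_def by (rule tr_integral) (rule Ak[OF that])
    have "\<bar>w (\<tau> n) x0\<bar> \<le> (\<Sum>k<n. \<rho> \<delta> * \<beta> (\<tau> k) (\<tau> (Suc k)) + K / 2 * (2 * DIM('a) * tr (B k)) powr (1 + \<alpha> / 2))"
    proof (rule walk_stability)
      fix k assume k: "k < n"
      have kr: "0 \<le> \<tau> k" "\<tau> k \<le> \<tau> (Suc k)" "\<tau> (Suc k) \<le> T"
        using \<tau>r[of k] \<tau>r[of "Suc k"] \<tau>mono[of k "Suc k"] k by auto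
      show "psd (B k)" unfolding B_def
        by (rule psd_integral) (use A kr Ak[OF k] in auto)
      show "has_hessian (w (\<tau> k)) (w1 (\<tau> k)) (w2 (\<tau> k))" "holder2 K \<alpha> (w2 (\<tau> k))"
        using h H \<tau>r k by auto
      fix x :: 'a
      have Bi: "contract (B k) (\<lambda>b c. w2 (\<tau> k) b c x) = (LINT s:{\<tau> k<..<\<tau> (Suc k)}|lborel. contract (A s) (\<lambda>b c. w2 (\<tau> k) b c x))"
        unfolding B_def by (rule contract_integral) (rule Ak[OF k])
      have ci: "set_integrable lborel {\<tau> k<..<\<tau> (Suc k)} (\<lambda>s. contract (A s) (\<lambda>b c. w2 (\<tau> k) b c x))"
        by (rule contract_integrable) (rule Ak[OF k])
      have wk: "set_integrable lborel {\<tau> k<..<\<tau> (Suc k)} (\<lambda>s. contract (A s) (\<lambda>b c. w2 s b c x))"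
        using wi' kr by auto
      have "w (\<tau> (Suc k)) x - w (\<tau> k) x - contract (B k) (\<lambda>b c. w2 (\<tau> k) b c x)
          = (LINT s:{\<tau> k<..<\<tau> (Suc k)}|lborel. contract (A s) (\<lambda>b c. w2 s b c x - w2 (\<tau> k) b c x))"
        unfolding incr[OF kr] Bi contract_diff_right by (rule set_integral_diff(2)[symmetric, OF wk ci])
      also have "\<bar>\<dots>\<bar> \<le> (LINT s:{\<tau> k<..<\<tau> (Suc k)}|lborel. \<rho> \<delta> * tr (A s))"
      proof (rule time_integral_bound)
        show "set_integrable lborel {\<tau> k<..<\<tau> (Suc k)} (\<lambda>s. contract (A s) (\<lambda>b c. w2 s b c x - w2 (\<tau> k) b c x))"
          unfolding contract_diff_right by (rule set_integral_diff(1)[OF wk ci])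
        show "set_integrable lborel {\<tau> k<..<\<tau> (Suc k)} (\<lambda>s. \<rho> \<delta> * tr (A s))"
          using tri kr by auto
        fix s assume s: "\<tau> k < s" "s < \<tau> (Suc k)"
        have "\<beta> (\<tau> k) s \<le> \<beta> (\<tau> k) (\<tau> (Suc k))"
          unfolding \<beta>_def by (rule time_integral_mono_interval) (use s kr tri trn in auto)
        then have "\<beta> (\<tau> k) s \<le> \<delta>" using \<beta>\<delta>[OF k] by simp
        then show "\<bar>contract (A s) (\<lambda>b c. w2 s b c x - w2 (\<tau> k) b c x)\<bar> \<le> \<rho> \<delta> * tr (A s)"
          using s kr \<delta> by (intro psd_contract_bound osc A) auto
      qed
      also have "\<dots> = \<rho> \<delta> * \<beta> (\<tau> k) (\<tau> (Suc k))" by (simp add: \<beta>_def)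
      finally show "\<bar>w (\<tau> (Suc k)) x - w (\<tau> k) x - contract (B k) (\<lambda>b c. w2 (\<tau> k) b c x)\<bar> \<le> \<rho> \<delta> * \<beta> (\<tau> k) (\<tau> (Suc k))" .
    next
      fix x show "w (\<tau> 0) x = 0" using w[of 0 x] t0' unfolding \<tau>0 by (simp add: set_lebesgue_integral_def)
    qed (use \<alpha> K in auto)
    also have "\<dots> \<le> (\<Sum>k<n. (\<rho> \<delta> + K * ?d * (2 * ?d * \<delta>) powr (\<alpha>/2)) * \<beta> (\<tau> k) (\<tau> (Suc k)))"
    proof (rule sum_mono)
      fix k assume "k \<in> {..<n}"
      then have k: "k < n" by simp
      have "(2 * ?d * tr (B k)) powr (1 + \<alpha>/2) \<le> (2 * ?d * tr (B k)) * (2 * ?d * \<delta>) powr (\<alpha>/2)"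
        by (rule powr_one_plus_le) (use \<beta>\<delta>[OF k] \<beta>0[OF k] \<alpha> in \<open>auto simp: trB[OF k]\<close>)
      then have "K / 2 * (2 * ?d * tr (B k)) powr (1 + \<alpha>/2) \<le> K / 2 * ((2 * ?d * tr (B k)) * (2 * ?d * \<delta>) powr (\<alpha>/2))"
        by (rule mult_left_mono) (use K in auto)
      then show "\<rho> \<delta> * \<beta> (\<tau> k) (\<tau> (Suc k)) + K / 2 * (2 * DIM('a) * tr (B k)) powr (1 + \<alpha> / 2)
          \<le> (\<rho> \<delta> + K * ?d * (2 * ?d * \<delta>) powr (\<alpha>/2)) * \<beta> (\<tau> k) (\<tau> (Suc k))"
        unfolding trB[OF k] by (simp add: algebra_simps)
    qed
    also have "\<dots> = S \<delta>"
    proof -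
      have "(\<Sum>k=0..<n. \<beta> (\<tau> k) (\<tau> (Suc k))) = \<beta> (\<tau> 0) (\<tau> n)"
        unfolding \<beta>_def by (rule time_integral_sum_grid) (use \<tau>mono tri[of "\<tau> 0" "\<tau> n"] \<tau>0 \<tau>n t0' in auto)
      then show ?thesis
        unfolding S_def \<tau>0 \<tau>n sum_distrib_left[symmetric] atLeast0LessThan by simp
    qed
    finally show ?thesis unfolding \<tau>n .
  qed
  \<comment> \<open>Here \<open>0 powr r = 0\<close>, so the limit is \<open>0\<close>.\<close>
  have "(S \<longlongrightarrow> (4 * M * 0 powr (1/2) + 2 * K * 0 powr (\<alpha>/4) + K * ?d * (2 * ?d * 0) powr (\<alpha>/2)) * \<beta> 0 t0) (at_right 0)"
    unfolding S_def \<rho>_def using \<alpha>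
    by (intro tendsto_intros) (auto intro!: eventually_at_right_less[THEN eventually_mono] tendsto_mult_right_zero tendsto_eq_intros)
  then have "(S \<longlongrightarrow> 0) (at_right 0)" by simp
  moreover have "eventually (\<lambda>\<delta>. \<bar>w t0 x0\<bar> \<le> S \<delta>) (at_right 0)"
    using eventually_at_right_less by (rule eventually_mono) (rule key)
  ultimately have "\<bar>w t0 x0\<bar> \<le> 0"
    by (intro tendsto_lowerbound) auto
  then show ?thesis by simp
qed


section \<open>Smooth data and admissible solution operators\<close>

text \<open>A function together with all its iterated partial derivatives, \<open>F (b # bs)\<close> being the derivative
  of \<open>F bs\<close> in the direction \<open>b\<close>; all of them are bounded and Borel measurable in \<open>(t, x)\<close>. Carrying
  the derivatives along makes it trivial to differentiate shifts, averages and integrals. Time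
  runs through all of \<open>\<real>\<close>; data on \<open>(0,T)\<close> are extended by zero.\<close>

definition jet :: "('a::euclidean_space list \<Rightarrow> real \<Rightarrow> 'a \<Rightarrow> real) \<Rightarrow> bool" where
  "jet F \<longleftrightarrow>
     (\<forall>bs t x. (F bs t has_derivative (\<lambda>h. \<Sum>b\<in>Basis. (h \<bullet> b) * F (b # bs) t x)) (at x)) \<and>
     (\<forall>bs. \<exists>C. \<forall>t x. \<bar>F bs t x\<bar> \<le> C) \<and>
     (\<forall>bs. (\<lambda>z. F bs (fst z) (snd z)) \<in> borel_measurable borel)"

definition smooth :: "(real \<Rightarrow> 'a::euclidean_space \<Rightarrow> real) \<Rightarrow> bool" where
  "smooth f \<longleftrightarrow> (\<exists>F. jet F \<and> F [] = f)"

text \<open>A common bound for the derivatives of order at most \<open>N\<close>. Directions are restricted to the basis, so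
  that only finitely many derivatives are involved.\<close>

definition jet_bound :: "nat \<Rightarrow> real \<Rightarrow> ('a::euclidean_space list \<Rightarrow> real \<Rightarrow> 'a \<Rightarrow> real) \<Rightarrow> bool" where
  "jet_bound N C F \<longleftrightarrow> 0 \<le> C \<and> (\<forall>bs t x. set bs \<subseteq> Basis \<longrightarrow> length bs \<le> N \<longrightarrow> \<bar>F bs t x\<bar> \<le> C)"

lemma jet_boundD: "jet_bound N C F \<Longrightarrow> set bs \<subseteq> Basis \<Longrightarrow> length bs \<le> N \<Longrightarrow> \<bar>F bs t x\<bar> \<le> C"
  unfolding jet_bound_def by blast

lemma jet_bound_nonneg: "jet_bound N C F \<Longrightarrow> 0 \<le> C"
  unfolding jet_bound_def by blast

lemma jet_derivative:
  "jet F \<Longrightarrow> (F bs t has_derivative (\<lambda>h. \<Sum>b\<in>Basis. (h \<bullet> b) * F (b # bs) t x)) (at x)"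
  unfolding jet_def by blast

lemma jet_bounded: "jet F \<Longrightarrow> \<exists>C. \<forall>t x. \<bar>F bs t x\<bar> \<le> C"
  unfolding jet_def by blast

lemma jet_measurable: "jet F \<Longrightarrow> (\<lambda>z. F bs (fst z) (snd z)) \<in> borel_measurable borel"
  unfolding jet_def by blast

lemma measurable_section:
  assumes "(\<lambda>z. f (fst z) (snd z)) \<in> borel_measurable (borel :: (real \<times> 'a::euclidean_space) measure)"
  shows "(\<lambda>s. f s x) \<in> borel_measurable borel"
proof -
  have "(\<lambda>s. (s, x)) \<in> borel_measurable borel" by (intro borel_measurable_continuous_onI continuous_intros)
  from measurable_compose[OF this assms] show ?thesis by simp
qed

lemma jet_has_bound:
  assumes "jet F" shows "\<exists>C. jet_bound N C F"
proof -
  let ?B = "{bs :: 'a list. set bs \<subseteq> Basis \<and> length bs \<le> N}"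
  obtain C where C: "\<And>bs t x. \<bar>F bs t x\<bar> \<le> C bs"
    using assms unfolding jet_def by metis
  have C0: "0 \<le> C bs" for bs using C[of bs 0 0] by linarith
  have fin: "finite ?B" by (rule finite_lists_length_le) simp
  have "\<bar>F bs t x\<bar> \<le> sum C ?B" if "bs \<in> ?B" for bs t x
    using member_le_sum[OF that, of C] C0 fin C[of bs t x] by force
  then have "jet_bound N (sum C ?B) F"
    unfolding jet_bound_def using C0 by (auto intro: sum_nonneg)
  then show ?thesis by blast
qed

lemma jet_append: "jet F \<Longrightarrow> jet (\<lambda>cs. F (cs @ bs))"
  unfolding jet_def by simp

lemma jet_bound_append:
  assumes "jet_bound N C F" "set bs \<subseteq> Basis" "length bs + M \<le> N"
  shows "jet_bound M C (\<lambda>cs. F (cs @ bs))"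
  using assms unfolding jet_bound_def by auto

lemma smoothI: "jet F \<Longrightarrow> smooth (F bs)"
  unfolding smooth_def using jet_append[of F bs] by (metis append_Nil)

lemma jet_hessian: "jet F \<Longrightarrow> has_hessian (F bs t) (\<lambda>b. F (b # bs) t) (\<lambda>b c. F (b # c # bs) t)"
  unfolding has_hessian_def using jet_derivative by blast

text \<open>At distances at most \<open>1\<close> the Lipschitz bound is stronger than the Hoelder bound, and at larger
  distances the bound for \<open>g\<close> itself is enough.\<close>

lemma bounded_gradient_holder:
  fixes g :: "'a::euclidean_space \<Rightarrow> real" and C :: real
  assumes g: "\<And>x. (g has_derivative (\<lambda>h. \<Sum>b\<in>Basis. (h \<bullet> b) * g1 b x)) (at x)"
    and C: "\<And>x. \<bar>g x\<bar> \<le> C" "\<And>b x. b \<in> Basis \<Longrightarrow> \<bar>g1 b x\<bar> \<le> C" and \<alpha>: "0 \<le> \<alpha>" "\<alpha> \<le> 1"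
  shows "\<bar>g x - g y\<bar> \<le> 2 * DIM('a) * C * norm (x - y) powr \<alpha>"
proof (cases "x = y")
  case False
  have C0: "0 \<le> C" using C(1)[of x] by linarith
  have d: "1 \<le> real DIM('a)" by (simp add: DIM_positive Suc_leI)
  have "\<bar>\<Sum>b\<in>Basis. (h \<bullet> b) * g1 b x\<bar> \<le> norm h * (DIM('a) * C)" for h x
  proof -
    have "\<bar>\<Sum>b\<in>Basis. (h \<bullet> b) * g1 b x\<bar> \<le> (\<Sum>b\<in>(Basis :: 'a set). norm h * C)"
      by (rule order_trans[OF sum_abs sum_mono]) (auto simp: abs_mult intro!: mult_mono C Basis_le_norm)
    then show ?thesis by (simp add: mult_ac)
  qed
  then have on: "onorm (\<lambda>h. \<Sum>b\<in>Basis. (h \<bullet> b) * g1 b x) \<le> DIM('a) * C" for x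
    using C0 by (intro onorm_bound) (auto simp: mult.commute)
  have lip: "\<bar>g x - g y\<bar> \<le> DIM('a) * C * norm (x - y)"
    using differentiable_bound[of UNIV g _ "DIM('a) * C" x y, OF convex_UNIV g on] by simp
  show ?thesis
  proof (cases "norm (x - y) \<le> 1")
    case True
    have "norm (x - y) = norm (x - y) powr 1" using False by simp
    also have "\<dots> \<le> norm (x - y) powr \<alpha>"
      using True \<alpha> False by (intro powr_mono') auto
    finally have "real DIM('a) * C * norm (x - y) \<le> real DIM('a) * C * norm (x - y) powr \<alpha>"
      using C0 by (intro mult_left_mono) auto
    also have "\<dots> \<le> 2 * DIM('a) * C * norm (x - y) powr \<alpha>"
      using C0 by (simp add: mult_right_mono)
    finally show ?thesis using lip by linarith
  next
    case False
    then have "1 \<le> norm (x - y) powr \<alpha>" using \<alpha> by (simp add: ge_one_powr_ge_zero)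
    then have "2 * C * 1 \<le> 2 * C * norm (x - y) powr \<alpha>"
      using C0 by (intro mult_left_mono) auto
    also have "\<dots> \<le> real DIM('a) * (2 * C * norm (x - y) powr \<alpha>)"
      using mult_right_mono[OF d, of "2 * C * norm (x - y) powr \<alpha>"] C0 by simp
    finally show ?thesis using C(1)[of x] C(1)[of y] by (simp add: mult_ac abs_le_iff)
  qed
qed simp

lemma jet_lipschitz:
  fixes F :: "'a::euclidean_space list \<Rightarrow> real \<Rightarrow> 'a \<Rightarrow> real" and C :: real
  assumes "jet F" "jet_bound N C F" "set bs \<subseteq> Basis" "Suc (length bs) \<le> N" "0 \<le> \<alpha>" "\<alpha> \<le> 1"
  shows "\<bar>F bs t x - F bs t y\<bar> \<le> 2 * DIM('a) * C * norm (x - y) powr \<alpha>"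
proof (rule bounded_gradient_holder[OF jet_derivative[OF assms(1)]])
  show "\<bar>F bs t x\<bar> \<le> C" for x by (rule jet_boundD[OF assms(2)]) (use assms in auto)
  show "\<bar>F (b # bs) t x\<bar> \<le> C" if "b \<in> Basis" for b x
    by (rule jet_boundD[OF assms(2)]) (use assms that in auto)
qed (use assms in auto)

lemma jet_holder2:
  fixes F :: "'a::euclidean_space list \<Rightarrow> real \<Rightarrow> 'a \<Rightarrow> real" and C :: real
  assumes "jet F" "jet_bound 3 C F" "0 \<le> \<alpha>" "\<alpha> \<le> 1"
  shows "holder2 (2 * real DIM('a) ^ 3 * C) \<alpha> (\<lambda>b c. F [b, c] t)"
  unfolding holder2_def
proof (intro allI)
  fix x y v :: 'a
  have "\<bar>quad (\<lambda>b c. F [b, c] t x - F [b, c] t y) v\<bar>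
      \<le> (2 * DIM('a) * C * norm (x - y) powr \<alpha>) * (real DIM('a))\<^sup>2 * (norm v)\<^sup>2"
    by (intro quad_entries_bound jet_lipschitz[OF assms(1,2)]) (use assms in auto)
  then show "\<bar>quad (\<lambda>b c. F [b, c] t x) v - quad (\<lambda>b c. F [b, c] t y) v\<bar>
      \<le> 2 * real DIM('a) ^ 3 * C * norm (x - y) powr \<alpha> * (norm v)\<^sup>2"
    by (simp add: quad_diff mult_ac power2_eq_square power3_eq_cube)
qed

lemma jet_holder2_rough:
  fixes F :: "'a::euclidean_space list \<Rightarrow> real \<Rightarrow> 'a \<Rightarrow> real" and C :: real
  assumes "jet_bound 2 C F"
  shows "holder2 (2 * (real DIM('a))\<^sup>2 * C) 0 (\<lambda>b c. F [b, c] t)"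
  unfolding holder2_def
proof (intro allI)
  fix x y v :: 'a
  have C: "\<bar>F [b, c] t z\<bar> \<le> C" if "b \<in> Basis" "c \<in> Basis" for b c z
    using jet_boundD[OF assms, of "[b, c]"] that by simp
  have "\<bar>quad (\<lambda>b c. F [b, c] t x - F [b, c] t y) v\<bar> \<le> (2 * C) * (real DIM('a))\<^sup>2 * (norm v)\<^sup>2"
  proof (rule quad_entries_bound)
    fix b c :: 'a assume bc: "b \<in> Basis" "c \<in> Basis"
    show "\<bar>F [b, c] t x - F [b, c] t y\<bar> \<le> 2 * C" using C[OF bc, of x] C[OF bc, of y] by linarith
  qed
  then show "\<bar>quad (\<lambda>b c. F [b, c] t x) v - quad (\<lambda>b c. F [b, c] t y) v\<bar>
      \<le> 2 * (real DIM('a))\<^sup>2 * C * norm (x - y) powr 0 * (norm v)\<^sup>2"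
    by (cases "x = y") (simp_all add: quad_diff mult_ac)
qed

text \<open>The constant is uniform in \<open>t\<close> and \<open>x\<close>. An operator that is bounded in the supremum norm can
  therefore be applied to the difference quotients.\<close>

lemma jet_remainder:
  fixes F :: "'a::euclidean_space list \<Rightarrow> real \<Rightarrow> 'a \<Rightarrow> real" and C :: real
  assumes "jet F"
  shows "\<exists>C. \<forall>t x h. \<bar>F bs t (x + h) - F bs t x - (\<Sum>b\<in>Basis. (h \<bullet> b) * F (b # bs) t x)\<bar> \<le> C * (norm h)\<^sup>2"
proof -
  let ?G = "\<lambda>cs. F (cs @ bs)"
  obtain C where C: "jet_bound 2 C ?G" using jet_has_bound[OF jet_append[OF assms]] by blast
  define D where "D = 2 * (real DIM('a))\<^sup>2 * C"
  have D0: "0 \<le> D" using jet_bound_nonneg[OF C] by (simp add: D_def)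
  have "\<bar>F bs t (x + h) - F bs t x - (\<Sum>b\<in>Basis. (h \<bullet> b) * F (b # bs) t x)\<bar> \<le> D * (norm h)\<^sup>2" for t x h
  proof -
    have 1: "\<bar>F bs t (x + h) - F bs t x - (\<Sum>b\<in>Basis. (h \<bullet> b) * F (b # bs) t x) - quad (\<lambda>b c. F (b # c # bs) t x) h / 2\<bar>
        \<le> D / 2 * norm h powr (2 + 0)"
      by (rule taylor2[OF jet_hessian[OF assms]])
        (use jet_holder2_rough[OF C, of t] D0 in \<open>auto simp: D_def\<close>)
    have 2: "\<bar>quad (\<lambda>b c. F (b # c # bs) t x) h\<bar> \<le> C * (real DIM('a))\<^sup>2 * (norm h)\<^sup>2"
      by (rule quad_entries_bound) (use jet_boundD[OF C, of "[_, _]"] in auto)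
    have "C * (real DIM('a))\<^sup>2 * (norm h)\<^sup>2 = D * (norm h)\<^sup>2 / 2" by (simp add: D_def)
    moreover have "norm h powr (2 + 0) = (norm h)\<^sup>2" by simp
    ultimately show ?thesis using 1 2 by (simp only: abs_le_iff) linarith
  qed
  then show ?thesis by blast
qed

lemma jet_shift:
  assumes F: "jet F" and y: "y \<in> borel_measurable borel"
  shows "jet (\<lambda>bs t x. F bs t (x + y t))"
  unfolding jet_def
proof (intro conjI allI)
  fix bs t x
  have "((\<lambda>x. x + y t) has_derivative (\<lambda>h. h)) (at x)" by (auto intro!: derivative_eq_intros)
  from diff_chain_at[OF this jet_derivative[OF F]]
  show "((\<lambda>x. F bs t (x + y t)) has_derivative (\<lambda>h. \<Sum>b\<in>Basis. (h \<bullet> b) * F (b # bs) t (x + y t))) (at x)"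
    by (simp add: o_def)
next
  fix bs show "\<exists>C. \<forall>t x. \<bar>F bs t (x + y t)\<bar> \<le> C"
    using jet_bounded[OF F, of bs] by blast
next
  fix bs
  have "(\<lambda>z :: real \<times> 'a. (fst z, snd z + y (fst z))) \<in> borel_measurable borel"
    using measurable_compose[OF measurable_fst'' y] y
    by (intro borel_measurable_Pair borel_measurable_add) (auto simp: borel_prod[symmetric])
  from measurable_compose[OF this jet_measurable[OF F, of bs]]
  show "(\<lambda>z. F bs (fst z) (snd z + y (fst z))) \<in> borel_measurable borel" by simp
qed

lemma jet_lincomb:
  assumes "jet F" "jet G"
  shows "jet (\<lambda>bs t x. F bs t x + k * G bs t x)"
  unfolding jet_def
proof (intro conjI allI)
  fix bs t x
  show "((\<lambda>x. F bs t x + k * G bs t x) has_derivative (\<lambda>h. \<Sum>b\<in>Basis. (h \<bullet> b) * (F (b # bs) t x + k * G (b # bs) t x))) (at x)"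
  proof -
    have "((\<lambda>x. F bs t x + k * G bs t x) has_derivative
        (\<lambda>h. (\<Sum>b\<in>Basis. (h \<bullet> b) * F (b # bs) t x) + k * (\<Sum>b\<in>Basis. (h \<bullet> b) * G (b # bs) t x))) (at x)"
      by (intro has_derivative_add has_derivative_mult_right jet_derivative assms)
    then show ?thesis by (simp add: sum.distrib sum_distrib_left algebra_simps)
  qed
next
  fix bs
  obtain C D where "\<And>t x. \<bar>F bs t x\<bar> \<le> C" "\<And>t x. \<bar>G bs t x\<bar> \<le> D"
    using jet_bounded[OF assms(1)] jet_bounded[OF assms(2)] by meson
  then have "\<bar>F bs t x + k * G bs t x\<bar> \<le> C + \<bar>k\<bar> * D" for t x
    by (intro order_trans[OF abs_triangle_ineq] add_mono) (auto simp: abs_mult mult_left_mono)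
  then show "\<exists>C. \<forall>t x. \<bar>F bs t x + k * G bs t x\<bar> \<le> C" by blast
next
  fix bs
  show "(\<lambda>z. F bs (fst z) (snd z) + k * G bs (fst z) (snd z)) \<in> borel_measurable borel"
    using jet_measurable[OF assms(1)] jet_measurable[OF assms(2)] by auto
qed

lemma jet_zero: "jet (\<lambda>bs t x. 0)"
  unfolding jet_def by auto

lemma smooth_lincomb: "smooth f \<Longrightarrow> smooth g \<Longrightarrow> smooth (\<lambda>t x. f t x + k * g t x)"
  unfolding smooth_def using jet_lincomb by fastforce

lemma smooth_zero: "smooth (\<lambda>t x. 0)"
  unfolding smooth_def using jet_zero by fastforce

lemma smooth_sum:
  "finite B \<Longrightarrow> (\<And>b. b \<in> B \<Longrightarrow> smooth (f b)) \<Longrightarrow> smooth (\<lambda>t x. \<Sum>b\<in>B. k b * f b t x)"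
proof (induction B rule: finite_induct)
  case (insert b B)
  then show ?case
    using smooth_lincomb[of "\<lambda>t x. \<Sum>b\<in>B. k b * f b t x" "f b" "k b"] by (simp add: add.commute)
qed (simp add: smooth_zero)

lemma smooth_shift: "smooth f \<Longrightarrow> y \<in> borel_measurable borel \<Longrightarrow> smooth (\<lambda>t x. f t (x + y t))"
  unfolding smooth_def using jet_shift by fastforce

text \<open>The properties of a solution operator \<open>f \<mapsto> u\<close> that pass to averages and limits: it is linear,
  commutes with translations in space, is bounded by \<open>T\<close> in the supremum norm, produces measurable
  functions, and is causal. Outside \<open>[0,T]\<close> its values are zero, so that the other properties can be
  stated for all times.\<close>

definition admissible ::
    "real \<Rightarrow> ((real \<Rightarrow> 'a::euclidean_space \<Rightarrow> real) \<Rightarrow> (real \<Rightarrow> 'a \<Rightarrow> real)) \<Rightarrow> bool" where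
  "admissible T S \<longleftrightarrow>
    (\<forall>f g k. smooth f \<longrightarrow> smooth g \<longrightarrow>
       S (\<lambda>t x. f t x + k * g t x) = (\<lambda>t x. S f t x + k * S g t x)) \<and>
    (\<forall>f h. smooth f \<longrightarrow> S (\<lambda>t x. f t (x + h)) = (\<lambda>t x. S f t (x + h))) \<and>
    (\<forall>f C t x. smooth f \<longrightarrow> (\<forall>t x. \<bar>f t x\<bar> \<le> C) \<longrightarrow> \<bar>S f t x\<bar> \<le> T * C) \<and>
    (\<forall>f. smooth f \<longrightarrow> (\<lambda>z. S f (fst z) (snd z)) \<in> borel_measurable borel) \<and>
    (\<forall>f g \<tau> t. smooth f \<longrightarrow> smooth g \<longrightarrow> (\<forall>s<\<tau>. f s = g s) \<longrightarrow> t \<le> \<tau> \<longrightarrow> S f t = S g t) \<and>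
    (\<forall>f t. smooth f \<longrightarrow> t \<notin> {0..T} \<longrightarrow> S f t = (\<lambda>x. 0))"

lemma admissible_linear:
  "admissible T S \<Longrightarrow> smooth f \<Longrightarrow> smooth g \<Longrightarrow> S (\<lambda>t x. f t x + k * g t x) = (\<lambda>t x. S f t x + k * S g t x)"
  unfolding admissible_def by blast

lemma admissible_translate:
  "admissible T S \<Longrightarrow> smooth f \<Longrightarrow> S (\<lambda>t x. f t (x + h)) = (\<lambda>t x. S f t (x + h))"
  unfolding admissible_def by blast

lemma admissible_bound:
  "admissible T S \<Longrightarrow> smooth f \<Longrightarrow> (\<And>t x. \<bar>f t x\<bar> \<le> C) \<Longrightarrow> \<bar>S f t x\<bar> \<le> T * C"
  unfolding admissible_def by blast

lemma admissible_measurable: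
  "admissible T S \<Longrightarrow> smooth f \<Longrightarrow> (\<lambda>z. S f (fst z) (snd z)) \<in> borel_measurable borel"
  unfolding admissible_def by blast

lemma admissible_causal:
  "admissible T S \<Longrightarrow> smooth f \<Longrightarrow> smooth g \<Longrightarrow> (\<And>s. s < \<tau> \<Longrightarrow> f s = g s) \<Longrightarrow> t \<le> \<tau> \<Longrightarrow> S f t = S g t"
  unfolding admissible_def by blast

lemma admissible_outside:
  "admissible T S \<Longrightarrow> smooth f \<Longrightarrow> t \<notin> {0..T} \<Longrightarrow> S f t = (\<lambda>x. 0)"
  unfolding admissible_def by blast

lemma admissible_zero:
  assumes "admissible T S" shows "S (\<lambda>t x. 0) = (\<lambda>t x. 0)"
  using admissible_bound[OF assms smooth_zero, of 0] by (intro ext) simp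

lemma admissible_sum:
  assumes S: "admissible T S" and "finite B" "\<And>b. b \<in> B \<Longrightarrow> smooth (f b)"
  shows "S (\<lambda>t x. \<Sum>b\<in>B. k b * f b t x) = (\<lambda>t x. \<Sum>b\<in>B. k b * S (f b) t x)"
  using assms(2,3)
proof (induction B rule: finite_induct)
  case (insert b B)
  have "S (\<lambda>t x. (\<Sum>b\<in>B. k b * f b t x) + k b * f b t x)
      = (\<lambda>t x. S (\<lambda>t x. \<Sum>b\<in>B. k b * f b t x) t x + k b * S (f b) t x)"
    using insert by (intro admissible_linear[OF S] smooth_sum) auto
  with insert show ?case by (simp add: add.commute)
qed (simp add: admissible_zero[OF S])

lemma has_derivative_quadratic_remainder:
  fixes g :: "'a::euclidean_space \<Rightarrow> real"
  assumes L: "bounded_linear L" and C: "\<And>h. \<bar>g (x + h) - g x - L h\<bar> \<le> C * (norm h)\<^sup>2"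
  shows "(g has_derivative L) (at x)"
  unfolding has_derivative_at
proof (intro conjI L)
  have "((\<lambda>h::'a. C * norm h) \<longlongrightarrow> 0) (at 0)" by (auto intro!: tendsto_eq_intros)
  then show "(\<lambda>h. norm (g (x + h) - g x - L h) / norm h) \<midarrow>0\<rightarrow> 0"
  proof (rule Lim_null_comparison[rotated])
    show "\<forall>\<^sub>F h in at 0. norm (norm (g (x + h) - g x - L h) / norm h) \<le> C * norm h"
      unfolding eventually_at_filter using C
      by (intro always_eventually) (auto simp: divide_le_eq power2_eq_square mult_ac)
  qed
qed

text \<open>An operator that is linear, bounded and commutes with translations commutes with derivatives:
  apply it to the first order Taylor remainder of the data.\<close>

lemma admissible_jet:
  assumes S: "admissible T S" and F: "jet F"
  shows "jet (\<lambda>bs. S (F bs))"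
  unfolding jet_def
proof (intro conjI allI)
  fix bs t x
  obtain C where C: "\<And>t x h. \<bar>F bs t (x + h) - F bs t x - (\<Sum>b\<in>Basis. (h \<bullet> b) * F (b # bs) t x)\<bar> \<le> C * (norm h)\<^sup>2"
    using jet_remainder[OF F] by blast
  show "(S (F bs) t has_derivative (\<lambda>h. \<Sum>b\<in>Basis. (h \<bullet> b) * S (F (b # bs)) t x)) (at x)"
  proof (rule has_derivative_quadratic_remainder)
    show "bounded_linear (\<lambda>h. \<Sum>b\<in>Basis. (h \<bullet> b) * S (F (b # bs)) t x)"
      by (intro bounded_linear_sum bounded_linear_mult_const bounded_linear_inner_left)
    fix h
    let ?sh = "\<lambda>t x. F bs t (x + h)"
    let ?L = "\<lambda>t x. \<Sum>b\<in>Basis. (h \<bullet> b) * F (b # bs) t x"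
    let ?r = "\<lambda>t x. (?sh t x + (-1) * F bs t x) + (-1) * ?L t x"
    have s: "smooth ?sh" "smooth (F bs)" "smooth ?L"
      using smooth_shift[OF smoothI[OF F], of "\<lambda>_. h"] by (auto intro!: smooth_sum smoothI[OF F])
    have "\<bar>S ?r t x\<bar> \<le> T * (C * (norm h)\<^sup>2)"
    proof (rule admissible_bound[OF S])
      show "smooth ?r" by (intro smooth_lincomb s)
      show "\<bar>?r t x\<bar> \<le> C * (norm h)\<^sup>2" for t x using C[of t x h] by simp
    qed
    also have "S ?r = (\<lambda>t x. S (\<lambda>t x. ?sh t x + (-1) * F bs t x) t x + (-1) * S ?L t x)"
      by (intro admissible_linear[OF S] smooth_lincomb s)
    also have "S (\<lambda>t x. ?sh t x + (-1) * F bs t x) = (\<lambda>t x. S ?sh t x + (-1) * S (F bs) t x)"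
      by (intro admissible_linear[OF S] s)
    also have "S ?sh = (\<lambda>t x. S (F bs) t (x + h))"
      by (rule admissible_translate[OF S s(2)])
    also have "S ?L = (\<lambda>t x. \<Sum>b\<in>Basis. (h \<bullet> b) * S (F (b # bs)) t x)"
      by (rule admissible_sum[OF S]) (auto intro: smoothI[OF F])
    finally show "\<bar>S (F bs) t (x + h) - S (F bs) t x - (\<Sum>b\<in>Basis. (h \<bullet> b) * S (F (b # bs)) t x)\<bar> \<le> T * C * (norm h)\<^sup>2"
      by (simp add: mult.assoc)
  qed
next
  fix bs
  obtain C where "\<And>t x. \<bar>F bs t x\<bar> \<le> C" using jet_bounded[OF F] by blast
  then show "\<exists>C. \<forall>t x. \<bar>S (F bs) t x\<bar> \<le> C"
    using admissible_bound[OF S smoothI[OF F]] by blast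
next
  fix bs show "(\<lambda>z. S (F bs) (fst z) (snd z)) \<in> borel_measurable borel"
    by (rule admissible_measurable[OF S smoothI[OF F]])
qed

lemma admissible_jet_bound:
  assumes S: "admissible T S" and F: "jet F" "jet_bound N C F" and "0 \<le> T"
  shows "jet_bound N (T * C) (\<lambda>bs. S (F bs))"
proof -
  have "\<bar>S (F bs) t x\<bar> \<le> T * C" if "set bs \<subseteq> Basis" "length bs \<le> N" for bs t x
    by (rule admissible_bound[OF S smoothI[OF F(1)]]) (rule jet_boundD[OF F(2) that])
  then show ?thesis
    using jet_bound_nonneg[OF F(2)] \<open>0 \<le> T\<close> unfolding jet_bound_def by simp
qed

section \<open>Inserting a random kick\<close>

text \<open>The path that is at the origin up to and including the time \<open>\<tau>\<close> and at \<open>w\<close> afterwards. With this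
  convention the value at \<open>\<tau>\<close> is still the one before the jump.\<close>

definition kick :: "real \<Rightarrow> 'a::real_vector \<Rightarrow> real \<Rightarrow> 'a" where
  "kick \<tau> w s = (if \<tau> < s then w else 0)"

text \<open>The solution as seen by an observer who follows a random path with a single jump at time \<open>\<tau>\<close>: the
  data are shifted against the path, the equation is solved, the solution is shifted back along the
  path, and the result is averaged over the steps of the walk.\<close>

definition jump ::
    "real \<Rightarrow> ('a::euclidean_space \<Rightarrow> 'a) \<Rightarrow> ((real \<Rightarrow> 'a \<Rightarrow> real) \<Rightarrow> (real \<Rightarrow> 'a \<Rightarrow> real)) \<Rightarrow>
     (real \<Rightarrow> 'a \<Rightarrow> real) \<Rightarrow> (real \<Rightarrow> 'a \<Rightarrow> real)" where
  "jump \<tau> v S f t x =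
     (\<Sum>j\<in>signs. S (\<lambda>s y. f s (y + kick \<tau> (- walk_step v j) s)) t (x + kick \<tau> (walk_step v j) t)) / (2 * DIM('a))"

lemma kick_measurable [measurable]: "kick \<tau> (w :: 'a::euclidean_space) \<in> borel_measurable borel"
  unfolding kick_def by measurable

lemma admissible_jump:
  fixes S :: "(real \<Rightarrow> 'a::euclidean_space \<Rightarrow> real) \<Rightarrow> (real \<Rightarrow> 'a \<Rightarrow> real)"
  assumes S: "admissible T S"
  shows "admissible T (jump \<tau> v S)"
proof -
  let ?k = "\<lambda>j. kick \<tau> (- walk_step v j)" and ?k' = "\<lambda>j. kick \<tau> (walk_step v j)"
  have sm: "smooth (\<lambda>s y. f s (y + ?k j s))" if "smooth f" for f j
    by (rule smooth_shift[OF that]) measurable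
  show ?thesis
    unfolding admissible_def
  proof (intro conjI allI impI)
    fix f g :: "real \<Rightarrow> 'a \<Rightarrow> real" and k assume fg: "smooth f" "smooth g"
    show "jump \<tau> v S (\<lambda>t x. f t x + k * g t x) = (\<lambda>t x. jump \<tau> v S f t x + k * jump \<tau> v S g t x)"
      unfolding jump_def admissible_linear[OF S sm[OF fg(1)] sm[OF fg(2)]]
      by (intro ext) (simp add: sum.distrib sum_distrib_left add_divide_distrib)
  next
    fix f :: "real \<Rightarrow> 'a \<Rightarrow> real" and h :: 'a assume f: "smooth f"
    have "S (\<lambda>s y. f s (y + ?k j s + h)) = (\<lambda>t x. S (\<lambda>s y. f s (y + ?k j s)) t (x + h))" for j
      using admissible_translate[OF S sm[OF f, of j], of h] by (simp add: add_ac)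
    then show "jump \<tau> v S (\<lambda>t x. f t (x + h)) = (\<lambda>t x. jump \<tau> v S f t (x + h))"
      unfolding jump_def by (intro ext) (simp add: add_ac)
  next
    fix f :: "real \<Rightarrow> 'a \<Rightarrow> real" and C t x assume "smooth f" "\<forall>t x. \<bar>f t x\<bar> \<le> C"
    then show "\<bar>jump \<tau> v S f t x\<bar> \<le> T * C"
      unfolding jump_def by (intro average_mono admissible_bound[OF S] sm) auto
  next
    fix f :: "real \<Rightarrow> 'a \<Rightarrow> real" assume f: "smooth f"
    have "(\<lambda>z :: real \<times> 'a. (fst z, snd z + ?k' j (fst z))) \<in> borel_measurable borel" for j
      using measurable_compose[OF measurable_fst'' kick_measurable]
      by (intro borel_measurable_Pair borel_measurable_add) (auto simp: borel_prod[symmetric])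
    from measurable_compose[OF this admissible_measurable[OF S sm[OF f]]]
    show "(\<lambda>z. jump \<tau> v S f (fst z) (snd z)) \<in> borel_measurable borel"
      unfolding jump_def by (intro borel_measurable_divide borel_measurable_sum) auto
  next
    fix f g :: "real \<Rightarrow> 'a \<Rightarrow> real" and \<tau>' t assume fg: "smooth f" "smooth g" "\<forall>s<\<tau>'. f s = g s" "t \<le> \<tau>'"
    have "S (\<lambda>s y. f s (y + ?k j s)) t = S (\<lambda>s y. g s (y + ?k j s)) t" for j
      by (rule admissible_causal[OF S sm sm]) (use fg in auto)
    then show "jump \<tau> v S f t = jump \<tau> v S g t"
      unfolding jump_def by auto
  next
    fix f :: "real \<Rightarrow> 'a \<Rightarrow> real" and t assume "smooth f" "t \<notin> {0..T}"
    then show "jump \<tau> v S f t = (\<lambda>x. 0)"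
      unfolding jump_def using admissible_outside[OF S sm] by auto
  qed
qed

text \<open>Up to time \<open>\<tau>\<close> neither the data nor the solution are shifted, and causality hides the later shift of
  the data.\<close>

lemma jump_before:
  fixes S :: "(real \<Rightarrow> 'a::euclidean_space \<Rightarrow> real) \<Rightarrow> (real \<Rightarrow> 'a \<Rightarrow> real)"
  assumes S: "admissible T S" and f: "smooth f" and "t \<le> \<tau>"
  shows "jump \<tau> v S f t = S f t"
proof -
  have "S (\<lambda>s y. f s (y + kick \<tau> (- walk_step v j) s)) t = S f t" for j
    by (rule admissible_causal[OF S smooth_shift[OF f] f _ \<open>t \<le> \<tau>\<close>]) (auto simp: kick_def)
  moreover have "kick \<tau> (walk_step v j) t = 0" for j using assms by (simp add: kick_def)
  ultimately show ?thesis
    unfolding jump_def by (intro ext) (simp add: card_signs)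
qed

text \<open>The right-hand side of the equation for \<open>u = S (F [])\<close>, integrated from \<open>r\<close> to \<open>t\<close>.\<close>

definition increment ::
    "(real \<Rightarrow> 'a::euclidean_space \<Rightarrow> 'a \<Rightarrow> real) \<Rightarrow> ((real \<Rightarrow> 'a \<Rightarrow> real) \<Rightarrow> (real \<Rightarrow> 'a \<Rightarrow> real)) \<Rightarrow>
     ('a list \<Rightarrow> real \<Rightarrow> 'a \<Rightarrow> real) \<Rightarrow> real \<Rightarrow> real \<Rightarrow> 'a \<Rightarrow> real" where
  "increment A S F r t x =
     (LINT s:{r<..<t}|lborel. contract (A s) (\<lambda>b c. S (F [b, c]) s x) + F [] s x)"

definition solves ::
    "real \<Rightarrow> (real \<Rightarrow> 'a::euclidean_space \<Rightarrow> 'a \<Rightarrow> real) \<Rightarrow> ((real \<Rightarrow> 'a \<Rightarrow> real) \<Rightarrow> (real \<Rightarrow> 'a \<Rightarrow> real)) \<Rightarrow> bool" where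
  "solves T A S \<longleftrightarrow> (\<forall>F x. jet F \<longrightarrow> S (F []) 0 x = 0 \<and>
     (\<forall>r t. 0 \<le> r \<longrightarrow> r \<le> t \<longrightarrow> t \<le> T \<longrightarrow> S (F []) t x = S (F []) r x + increment A S F r t x))"

definition integrable_coeff :: "real \<Rightarrow> (real \<Rightarrow> 'a::euclidean_space \<Rightarrow> 'a \<Rightarrow> real) \<Rightarrow> bool" where
  "integrable_coeff T A \<longleftrightarrow> (\<forall>b\<in>Basis. \<forall>c\<in>Basis. set_integrable lborel {0<..<T} (\<lambda>s. A s b c))"

lemma set_integrable_mult_bounded:
  fixes g h :: "real \<Rightarrow> real"
  assumes g: "set_integrable lborel I g" and h: "h \<in> borel_measurable borel" "\<And>s. \<bar>h s\<bar> \<le> C"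
  shows "set_integrable lborel I (\<lambda>s. g s * h s)"
  unfolding set_integrable_def
proof (rule Bochner_Integration.integrable_bound)
  show "integrable lborel (\<lambda>s. C * (indicator I s *\<^sub>R g s))"
    using g unfolding set_integrable_def by (rule integrable_mult_right)
  have "(\<lambda>s. (indicator I s *\<^sub>R g s) * h s) \<in> borel_measurable lborel"
    using g h unfolding set_integrable_def by (intro borel_measurable_times) auto
  then show "(\<lambda>s. indicator I s *\<^sub>R (g s * h s)) \<in> borel_measurable lborel"
    by (simp add: mult.assoc)
  show "AE s in lborel. norm (indicator I s *\<^sub>R (g s * h s)) \<le> norm (C * (indicator I s *\<^sub>R g s))"
  proof (rule AE_I2)
    fix s
    have "\<bar>g s\<bar> * \<bar>h s\<bar> \<le> \<bar>g s\<bar> * \<bar>C\<bar>" using h(2)[of s] by (intro mult_left_mono) auto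
    then show "norm (indicator I s *\<^sub>R (g s * h s)) \<le> norm (C * (indicator I s *\<^sub>R g s))"
      by (simp add: abs_mult indicator_def mult.commute)
  qed
qed

lemma set_integrable_bounded:
  fixes h :: "real \<Rightarrow> real"
  assumes "h \<in> borel_measurable borel" "\<And>s. \<bar>h s\<bar> \<le> C"
  shows "set_integrable lborel {r<..<t} h"
  using set_integrable_mult_bounded[of "{r<..<t}" "\<lambda>_. 1" h C] assms
  by (cases "r \<le> t") (simp_all add: set_integrable_def)

lemma integrable_coeffD:
  "integrable_coeff T A \<Longrightarrow> 0 \<le> r \<Longrightarrow> t \<le> T \<Longrightarrow> b \<in> Basis \<Longrightarrow> c \<in> Basis \<Longrightarrow> set_integrable lborel {r<..<t} (\<lambda>s. A s b c)"
  unfolding integrable_coeff_def using set_integrable_subinterval by blast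

lemma jet_section:
  assumes "jet U" shows "(\<lambda>s. U bs s x) \<in> borel_measurable borel"
  by (rule measurable_section[OF jet_measurable[OF assms]])

lemma contract_jet_integrable:
  assumes A: "integrable_coeff T A" and U: "jet U" and "0 \<le> r" "t \<le> T"
  shows "set_integrable lborel {r<..<t} (\<lambda>s. contract (A s) (\<lambda>b c. U [b, c] s x))"
proof -
  have "set_integrable lborel {r<..<t} (\<lambda>s. A s b c * U [b, c] s x)" if "b \<in> Basis" "c \<in> Basis" for b c
  proof -
    obtain C where "\<And>t x. \<bar>U [b, c] t x\<bar> \<le> C" using jet_bounded[OF U] by blast
    then show ?thesis
      using integrable_coeffD[OF A assms(3,4) that] jet_section[OF U]
      by (intro set_integrable_mult_bounded) auto
  qed
  then show ?thesis
    unfolding contract_def set_integrable_def scaleR_sum_right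
    by (intro Bochner_Integration.integrable_sum) auto
qed

lemma jet_time_integrable:
  assumes "jet U" shows "set_integrable lborel {r<..<t} (\<lambda>s. U bs s x)"
  using jet_bounded[OF assms, of bs] jet_section[OF assms] set_integrable_bounded by metis

lemma increment_integrable:
  assumes "integrable_coeff T A" "admissible T S" "jet F" "0 \<le> r" "t \<le> T"
  shows "set_integrable lborel {r<..<t} (\<lambda>s. contract (A s) (\<lambda>b c. S (F [b, c]) s x) + F [] s x)"
  using contract_jet_integrable[OF assms(1) admissible_jet[OF assms(2,3)] assms(4,5)] jet_time_integrable[OF assms(3)]
  by (intro set_integral_add(1)) auto

text \<open>After the jump the two shifts cancel in the data, so that averaging the equation gives the same
  equation; only the initial value at \<open>r\<close> has been averaged.\<close>

lemma jump_increment: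
  fixes S :: "(real \<Rightarrow> 'a::euclidean_space \<Rightarrow> real) \<Rightarrow> (real \<Rightarrow> 'a \<Rightarrow> real)"
  assumes S: "admissible T S" and A: "integrable_coeff T A" and F: "jet F"
    and rt: "0 \<le> r" "\<tau> \<le> r" "r < t" "t \<le> T"
    and inc: "\<And>F x. jet F \<Longrightarrow> S (F []) t x = S (F []) r x + increment A S F r t x"
  shows "jump \<tau> v S (F []) t x
    = (\<Sum>j\<in>signs. S (\<lambda>s y. F [] s (y + kick \<tau> (- walk_step v j) s)) r (x + walk_step v j)) / (2 * DIM('a))
      + increment A (jump \<tau> v S) F r t x"
proof -
  let ?w = "walk_step v" and ?d = "2 * real DIM('a)"
  define G where "G j bs s y = F bs s (y + kick \<tau> (- ?w j) s)" for j bs s y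
  have G: "jet (G j)" for j unfolding G_def by (rule jet_shift[OF F]) measurable
  have k: "kick \<tau> (?w j) s = ?w j" if "r < s" for j s using that rt by (simp add: kick_def)
  have jmp: "jump \<tau> v S (F bs) s x = (\<Sum>j\<in>signs. S (G j bs) s (x + ?w j)) / ?d" if "r < s" for bs s
    unfolding jump_def k[OF that] G_def by simp
  let ?I = "\<lambda>j s. contract (A s) (\<lambda>b c. S (G j [b, c]) s (x + ?w j)) + G j [] s (x + ?w j)"
  have int: "set_integrable lborel {r<..<t} (?I j)" for j
    by (rule increment_integrable[OF A S G rt(1,4)])
  have "(\<Sum>j\<in>signs. increment A S (G j) r t (x + ?w j)) / ?d = (LINT s:{r<..<t}|lborel. (\<Sum>j\<in>signs. ?I j s) / ?d)"
    using int unfolding increment_def set_lebesgue_integral_def set_integrable_def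
    by (subst Bochner_Integration.integral_sum[symmetric]) (auto simp: scaleR_sum_right simp flip: sum_divide_distrib sum_distrib_left)
  also have "\<dots> = increment A (jump \<tau> v S) F r t x"
    unfolding increment_def
  proof (rule set_lebesgue_integral_cong)
    show "\<forall>s. s \<in> {r<..<t} \<longrightarrow> (\<Sum>j\<in>signs. ?I j s) / ?d = contract (A s) (\<lambda>b c. jump \<tau> v S (F [b, c]) s x) + F [] s x"
    proof (intro allI impI)
      fix s assume "s \<in> {r<..<t}"
      then have s: "r < s" by simp
      have "G j [] s (x + ?w j) = F [] s x" for j
        unfolding G_def using s rt by (simp add: kick_def)
      then have "(\<Sum>j\<in>signs. ?I j s) / ?d = (\<Sum>j\<in>signs. contract (A s) (\<lambda>b c. S (G j [b, c]) s (x + ?w j))) / ?d + F [] s x"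
        by (simp add: sum.distrib add_divide_distrib card_signs)
      also have "(\<Sum>j\<in>signs. contract (A s) (\<lambda>b c. S (G j [b, c]) s (x + ?w j))) / ?d
          = contract (A s) (\<lambda>b c. (\<Sum>j\<in>signs. S (G j [b, c]) s (x + ?w j)) / ?d)"
        using contract_scale_right[of "A s" "1 / ?d" "\<lambda>b c. \<Sum>j\<in>signs. S (G j [b, c]) s (x + ?w j)"]
        by (simp add: contract_sum_right)
      finally show "(\<Sum>j\<in>signs. ?I j s) / ?d = contract (A s) (\<lambda>b c. jump \<tau> v S (F [b, c]) s x) + F [] s x"
        unfolding jmp[OF s] .
    qed
  qed simp
  finally have I: "(\<Sum>j\<in>signs. increment A S (G j) r t (x + ?w j)) / ?d = increment A (jump \<tau> v S) F r t x" .
  have "jump \<tau> v S (F []) t x = (\<Sum>j\<in>signs. S (G j []) r (x + ?w j) + increment A S (G j) r t (x + ?w j)) / ?d"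
    unfolding jmp[OF rt(3)] using inc[OF G] by simp
  then show ?thesis
    unfolding sum.distrib add_divide_distrib I by (simp add: G_def[abs_def])
qed

lemma jump_after:
  assumes S: "admissible T S" and A: "integrable_coeff T A" and F: "jet F"
    and rt: "0 \<le> r" "\<tau> < r" "r \<le> t" "t \<le> T"
    and inc: "\<And>F x. jet F \<Longrightarrow> S (F []) t x = S (F []) r x + increment A S F r t x"
  shows "jump \<tau> v S (F []) t x = jump \<tau> v S (F []) r x + increment A (jump \<tau> v S) F r t x"
proof (cases "r = t")
  case True
  then show ?thesis by (simp add: increment_def set_lebesgue_integral_def)
next
  case False
  then show ?thesis
    using jump_increment[OF S A F _ _ _ _ inc, of \<tau> v x] rt by (simp add: jump_def kick_def)
qed

text \<open>The value at \<open>\<tau>\<close> does not depend on the step taken at \<open>\<tau>\<close> and is averaged by one step of the walk.\<close>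

lemma jump_across:
  assumes S: "admissible T S" and A: "integrable_coeff T A" and F: "jet F"
    and rt: "0 \<le> \<tau>" "\<tau> < t" "t \<le> T"
    and inc: "\<And>F x. jet F \<Longrightarrow> S (F []) t x = S (F []) \<tau> x + increment A S F \<tau> t x"
  shows "jump \<tau> v S (F []) t x = walk v (jump \<tau> v S (F []) \<tau>) x + increment A (jump \<tau> v S) F \<tau> t x"
proof -
  have "S (\<lambda>s y. F [] s (y + kick \<tau> (- walk_step v j) s)) \<tau> = S (F []) \<tau>" for j
    by (rule admissible_causal[OF S smooth_shift[OF smoothI[OF F]] smoothI[OF F], of _ \<tau>]) (auto simp: kick_def)
  then show ?thesis
    using jump_increment[OF S A F rt(1) order_refl rt(2,3) inc, of v x]
    unfolding walk_def jump_before[OF S smoothI[OF F] order_refl] by simp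
qed


lemma solves_increment:
  "solves T A S \<Longrightarrow> jet F \<Longrightarrow> 0 \<le> r \<Longrightarrow> r \<le> t \<Longrightarrow> t \<le> T \<Longrightarrow>
    S (F []) t x = S (F []) r x + increment A S F r t x"
  unfolding solves_def by blast

lemma solves_initial: "solves T A S \<Longrightarrow> jet F \<Longrightarrow> S (F []) 0 x = 0"
  unfolding solves_def by blast

text \<open>The jumps are inserted in increasing order of time, so that each new jump leaves the evolution
  before it unchanged.\<close>

primrec scheme ::
    "(nat \<Rightarrow> real) \<Rightarrow> (nat \<Rightarrow> 'a::euclidean_space \<Rightarrow> 'a) \<Rightarrow> ((real \<Rightarrow> 'a \<Rightarrow> real) \<Rightarrow> (real \<Rightarrow> 'a \<Rightarrow> real)) \<Rightarrow> nat \<Rightarrow>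
     (real \<Rightarrow> 'a \<Rightarrow> real) \<Rightarrow> (real \<Rightarrow> 'a \<Rightarrow> real)" where
  "scheme \<tau> v S 0 = S"
| "scheme \<tau> v S (Suc m) = jump (\<tau> m) (v m) (scheme \<tau> v S m)"

lemma admissible_scheme: "admissible T S \<Longrightarrow> admissible T (scheme \<tau> v S m)"
  by (induction m) (auto intro: admissible_jump)

text \<open>The three claims are proved together: at the start of a new step the evolution must be known to be
  free of jumps after the last one (third claim), and inserting the jump turns this into the
  second claim.\<close>

lemma scheme_steps:
  assumes S: "admissible T S" "solves T A S" and A: "integrable_coeff T A"
    and \<tau>: "\<tau> 0 = 0" "\<And>k. \<tau> k < \<tau> (Suc k)"
  shows "jet F \<Longrightarrow> scheme \<tau> v S m (F []) 0 x = 0"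
    and "jet F \<Longrightarrow> k < m \<Longrightarrow> \<tau> k < t \<Longrightarrow> t \<le> \<tau> (Suc k) \<Longrightarrow> t \<le> T \<Longrightarrow>
      scheme \<tau> v S m (F []) t x = walk (v k) (scheme \<tau> v S m (F []) (\<tau> k)) x + increment A (scheme \<tau> v S m) F (\<tau> k) t x"
    and "jet F \<Longrightarrow> 0 \<le> r \<Longrightarrow> (\<And>k. k < m \<Longrightarrow> \<tau> k < r) \<Longrightarrow> r \<le> t \<Longrightarrow> t \<le> T \<Longrightarrow>
      scheme \<tau> v S m (F []) t x = scheme \<tau> v S m (F []) r x + increment A (scheme \<tau> v S m) F r t x"
proof (induction m arbitrary: F r t x k)
  case 0
  {
    case 1 then show ?case by (simp add: solves_initial[OF S(2)])
  next
    case 2 then show ?case by simp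
  next
    case 3 then show ?case unfolding scheme.simps by (intro solves_increment[OF S(2)])
  }
next
  case (Suc m)
  have sm: "strict_mono \<tau>" using \<tau>(2) by (simp add: strict_mono_Suc_iff)
  have \<tau>0: "0 \<le> \<tau> k" for k using strict_mono_less_eq[OF sm, of 0 k] \<tau>(1) by simp
  let ?S = "scheme \<tau> v S m"
  have Sm: "admissible T ?S" by (rule admissible_scheme[OF S(1)])
  {
    case 1
    have "jump (\<tau> m) (v m) ?S (F []) 0 = ?S (F []) 0"
      by (rule jump_before[OF Sm smoothI[OF 1] \<tau>0])
    then show ?case using Suc.IH(1)[OF 1, of x] by (simp only: scheme.simps)
  next
    case 2
    note F = \<open>jet F\<close>
    show ?case
    proof (cases "k = m")
      case True
      show ?thesis unfolding True scheme.simps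
      proof (rule jump_across[OF Sm A F \<tau>0])
        show "\<tau> m < t" "t \<le> T" using 2 True by auto
        fix F :: "'a list \<Rightarrow> real \<Rightarrow> 'a \<Rightarrow> real" and x assume "jet F"
        then show "?S (F []) t x = ?S (F []) (\<tau> m) x + increment A ?S F (\<tau> m) t x"
          using 2(3,5) True strict_monoD[OF sm] by (intro Suc.IH(3) \<tau>0) auto
      qed
    next
      case False
      then have k: "k < m" using 2 by simp
      have km: "\<tau> (Suc k) \<le> \<tau> m" using k by (simp add: strict_mono_less_eq[OF sm])
      have tm: "t \<le> \<tau> m" "\<tau> k \<le> \<tau> m" using km 2 by auto
      have e: "jump (\<tau> m) (v m) ?S (F bs) s = ?S (F bs) s" if "s \<le> \<tau> m" for s bs
        by (rule jump_before[OF Sm smoothI[OF F] that])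
      have "increment A (jump (\<tau> m) (v m) ?S) F (\<tau> k) t x = increment A ?S F (\<tau> k) t x"
        unfolding increment_def by (rule set_lebesgue_integral_cong) (use e tm in auto)
      then show ?thesis
        using Suc.IH(2)[OF F k 2(3,4,5), of x] by (simp only: scheme.simps e[OF tm(1)] e[OF tm(2)])
    qed
  next
    case (3 F r t x)
    show ?case unfolding scheme.simps
    proof (rule jump_after[OF Sm A 3(1)])
      fix F :: "'a list \<Rightarrow> real \<Rightarrow> 'a \<Rightarrow> real" and x assume "jet F"
      then show "?S (F []) t x = ?S (F []) r x + increment A ?S F r t x"
        using 3(2,4,5) by (intro Suc.IH(3) 3(3)) auto
    qed (use 3(2,4,5) 3(3)[of m] in simp_all)
  }
qed


section \<open>Convergence of the kicked evolutions\<close>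

text \<open>A norm of the coefficient matrix that bounds both its trace and its contractions.\<close>

definition mass :: "('a::euclidean_space \<Rightarrow> 'a \<Rightarrow> real) \<Rightarrow> real" where
  "mass A = (\<Sum>b\<in>Basis. \<Sum>c\<in>Basis. \<bar>A b c\<bar>)"

lemma mass_nonneg: "0 \<le> mass A"
  by (simp add: mass_def sum_nonneg)

lemma tr_le_mass: "tr A \<le> mass A"
  unfolding tr_def mass_def
proof (rule sum_mono)
  fix b :: 'a assume b: "b \<in> Basis"
  have "A b b \<le> \<bar>A b b\<bar>" by simp
  also have "\<dots> \<le> (\<Sum>c\<in>Basis. \<bar>A b c\<bar>)" using b by (intro member_le_sum) auto
  finally show "A b b \<le> (\<Sum>c\<in>Basis. \<bar>A b c\<bar>)" .
qed

lemma contract_mass_bound: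
  assumes "\<And>b c. b \<in> Basis \<Longrightarrow> c \<in> Basis \<Longrightarrow> \<bar>H b c\<bar> \<le> C"
  shows "\<bar>contract A H\<bar> \<le> mass A * C"
  unfolding mass_def by (rule contract_entries_bound[OF assms])

lemma mass_integrable:
  assumes "integrable_coeff T A" shows "set_integrable lborel {0<..<T} (\<lambda>s. mass (A s))"
proof -
  have "set_integrable lborel {0<..<T} (\<lambda>s. \<bar>A s b c\<bar>)" if "b \<in> Basis" "c \<in> Basis" for b c
    using assms that unfolding integrable_coeff_def by (intro set_integrable_abs) auto
  then show ?thesis
    unfolding mass_def set_integrable_def scaleR_sum_right
    by (intro Bochner_Integration.integrable_sum) auto
qed

lemma integrable_coeff_add:
  "integrable_coeff T A \<Longrightarrow> integrable_coeff T B \<Longrightarrow> integrable_coeff T (\<lambda>s b c. A s b c + B s b c)"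
  unfolding integrable_coeff_def by (auto intro!: set_integral_add(1))

lemma jet_bound_mono: "jet_bound N C F \<Longrightarrow> C \<le> D \<Longrightarrow> M \<le> N \<Longrightarrow> jet_bound M D F"
  unfolding jet_bound_def by (meson order_trans)

text \<open>The operator \<open>S0\<close> solves the equation with the coefficients \<open>A\<close>; kicks with the covariance \<open>2 \<integral> B\<close>
  are to produce the coefficients \<open>A + B\<close>.\<close>

locale kicked_evolution =
  fixes T :: real
    and A B :: "real \<Rightarrow> 'a::euclidean_space \<Rightarrow> 'a \<Rightarrow> real"
    and S0 :: "(real \<Rightarrow> 'a \<Rightarrow> real) \<Rightarrow> (real \<Rightarrow> 'a \<Rightarrow> real)"
  assumes T: "0 < T"
    and S0: "admissible T S0" "solves T A S0"
    and A: "integrable_coeff T A" and B: "integrable_coeff T B"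
    and psdA: "\<And>s. 0 < s \<Longrightarrow> s < T \<Longrightarrow> psd (A s)" and psdB: "\<And>s. 0 < s \<Longrightarrow> s < T \<Longrightarrow> psd (B s)"
begin

text \<open>A density that dominates, up to constants, all integrands that occur; \<open>total r t\<close> measures time on the scale on which
  solutions vary. The summand \<open>1\<close> accounts for the data.\<close>

definition weight :: "real \<Rightarrow> real" where
  "weight s = 1 + mass (A s) + mass (B s)"

definition total :: "real \<Rightarrow> real \<Rightarrow> real" where
  "total r t = (LINT s:{r<..<t}|lborel. weight s)"

definition grid :: "nat \<Rightarrow> nat \<Rightarrow> real" where
  "grid n k = T * real k / real n"

definition cov :: "nat \<Rightarrow> nat \<Rightarrow> 'a \<Rightarrow> 'a \<Rightarrow> real" where
  "cov n k b c = (LINT s:{grid n k<..<grid n (Suc k)}|lborel. B s b c)"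

definition vecs :: "nat \<Rightarrow> nat \<Rightarrow> 'a \<Rightarrow> 'a" where
  "vecs n k = (SOME v. factors v (cov n k))"

text \<open>On a uniform grid with \<open>n\<close> cells, the jump at the left end of a cell carries the covariance of
  the whole cell.\<close>

definition approx :: "nat \<Rightarrow> (real \<Rightarrow> 'a \<Rightarrow> real) \<Rightarrow> (real \<Rightarrow> 'a \<Rightarrow> real)" where
  "approx n = scheme (grid n) (vecs n) S0 n"

definition AB :: "real \<Rightarrow> 'a \<Rightarrow> 'a \<Rightarrow> real" where
  "AB s b c = A s b c + B s b c"

lemma weight_ge_1: "1 \<le> weight s"
  using mass_nonneg[of "A s"] mass_nonneg[of "B s"] by (simp add: weight_def)

lemma weight_integrable: "0 \<le> r \<Longrightarrow> t \<le> T \<Longrightarrow> set_integrable lborel {r<..<t} weight"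
  unfolding weight_def
  using set_integrable_subinterval[OF mass_integrable[OF A]] set_integrable_subinterval[OF mass_integrable[OF B]]
    set_integrable_bounded[of "\<lambda>_. 1" 1]
  by (simp add: set_integral_add(1))

lemma AB: "integrable_coeff T AB"
  unfolding AB_def by (rule integrable_coeff_add[OF A B])

lemma total_nonneg: "0 \<le> total r t"
  unfolding total_def by (rule time_integral_nonneg) (use weight_ge_1 in \<open>auto intro: order_trans[of 0 1]\<close>)

lemma total_mono: "0 \<le> r \<Longrightarrow> r \<le> r' \<Longrightarrow> r' \<le> t' \<Longrightarrow> t' \<le> t \<Longrightarrow> t \<le> T \<Longrightarrow> total r' t' \<le> total r t"
  unfolding total_def
  by (rule time_integral_mono_interval[OF weight_integrable]) (use weight_ge_1 in \<open>auto intro: order_trans[of 0 1]\<close>)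

lemma total_split: "0 \<le> r \<Longrightarrow> r \<le> q \<Longrightarrow> q \<le> t \<Longrightarrow> t \<le> T \<Longrightarrow> total r t = total r q + total q t"
  unfolding total_def by (rule time_integral_split) (auto intro: weight_integrable)

lemma grid_0 [simp]: "grid n 0 = 0" by (simp add: grid_def)

lemma grid_end: "0 < n \<Longrightarrow> grid n n = T" by (simp add: grid_def)

lemma grid_mono: "p \<le> q \<Longrightarrow> grid n p \<le> grid n q"
  unfolding grid_def using T by (intro divide_right_mono mult_left_mono) auto

lemma grid_nonneg: "0 \<le> grid n k"
  using grid_mono[of 0 k n] by simp

lemma grid_less: "0 < n \<Longrightarrow> grid n k < grid n (Suc k)"
  unfolding grid_def using T by (intro divide_strict_right_mono mult_strict_left_mono) auto

lemma grid_le_T: "0 < n \<Longrightarrow> k \<le> n \<Longrightarrow> grid n k \<le> T"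
  using grid_mono[of k n n] by (simp add: grid_end)

lemma grid_refine: "0 < m \<Longrightarrow> grid (n * m) (k * m) = grid n k"
  unfolding grid_def by simp

text \<open>The cells are taken closed, and the first one whose right end is at least \<open>t\<close> is chosen.\<close>

lemma grid_cell:
  assumes "0 < n" "0 \<le> t" "t \<le> T"
  obtains k where "k < n" "grid n k \<le> t" "t \<le> grid n (Suc k)"
proof -
  define k where "k = (LEAST k. t \<le> grid n (Suc k))"
  have ex: "t \<le> grid n (Suc (n - 1))" using assms by (simp add: grid_end)
  have k1: "t \<le> grid n (Suc k)" unfolding k_def using ex by (rule LeastI)
  have "k \<le> n - 1" unfolding k_def using ex by (rule Least_le)
  then have k2: "k < n" using assms by simp
  have "grid n k \<le> t"
  proof (cases k)
    case (Suc j)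
    then have "j < k" by simp
    then have "\<not> t \<le> grid n (Suc j)" unfolding k_def by (rule not_less_Least)
    then show ?thesis using Suc by simp
  qed (use assms in simp)
  then show ?thesis using that k1 k2 by blast
qed

lemma coeff_cell_integrable:
  assumes "integrable_coeff T M" "0 < n" "k < n" "b \<in> Basis" "c \<in> Basis"
  shows "set_integrable lborel {grid n k<..<grid n (Suc k)} (\<lambda>s. M s b c)"
  by (rule integrable_coeffD[OF assms(1) grid_nonneg grid_le_T]) (use assms in auto)

lemma cov_psd: "0 < n \<Longrightarrow> k < n \<Longrightarrow> psd (cov n k)"
  unfolding cov_def
  by (rule psd_integral[OF psdB coeff_cell_integrable[OF B]])
    (use grid_nonneg[of n k] grid_le_T[of n "Suc k"] in auto)

lemma AB_cell_psd:
  assumes n: "0 < n" and k: "k < n"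
  shows "psd (\<lambda>b c. LINT s:{grid n k<..<grid n (Suc k)}|lborel. AB s b c)"
proof (rule psd_integral)
  show "set_integrable lborel {grid n k<..<grid n (Suc k)} (\<lambda>s. AB s b c)" if "b \<in> Basis" "c \<in> Basis" for b c
    by (rule coeff_cell_integrable[OF AB n k that])
  fix s assume "grid n k < s" "s < grid n (Suc k)"
  then have "0 < s" "s < T" using grid_nonneg[of n k] grid_le_T[OF n, of "Suc k"] k by auto
  then show "psd (AB s)" unfolding AB_def by (intro psd_add psdA psdB)
qed

lemma vecs: "0 < n \<Longrightarrow> k < n \<Longrightarrow> factors (vecs n k) (cov n k)"
  unfolding vecs_def by (rule someI_ex[OF psd_factor[OF cov_psd]])

lemma tr_integral_le_total:
  assumes M: "integrable_coeff T M" and "\<And>s. tr (M s) \<le> weight s" "0 < n" "k < n"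
  shows "tr (\<lambda>b c. LINT s:{grid n k<..<grid n (Suc k)}|lborel. M s b c) \<le> total (grid n k) (grid n (Suc k))"
proof -
  have "tr (\<lambda>b c. LINT s:{grid n k<..<grid n (Suc k)}|lborel. M s b c) = (LINT s:{grid n k<..<grid n (Suc k)}|lborel. tr (M s))"
    by (rule tr_integral) (rule coeff_cell_integrable[OF M assms(3,4)])
  also have "\<dots> \<le> total (grid n k) (grid n (Suc k))"
    unfolding total_def using assms grid_nonneg[of n k] grid_le_T[of n "Suc k"]
    by (intro set_integral_mono tr_integrable coeff_cell_integrable[OF M] weight_integrable) auto
  finally show ?thesis .
qed

lemma tr_cov: "0 < n \<Longrightarrow> k < n \<Longrightarrow> tr (cov n k) \<le> total (grid n k) (grid n (Suc k))"
  unfolding cov_def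
proof (rule tr_integral_le_total[OF B])
  show "tr (B s) \<le> weight s" for s
    using tr_le_mass[of "B s"] mass_nonneg[of "A s"] by (simp add: weight_def)
qed

lemma approx_admissible: "admissible T (approx n)"
  unfolding approx_def by (rule admissible_scheme[OF S0(1)])

lemma approx_step:
  assumes "0 < n" "k < n" "grid n k < t" "t \<le> grid n (Suc k)" "jet F"
  shows "approx n (F []) t x = walk (vecs n k) (approx n (F []) (grid n k)) x + increment A (approx n) F (grid n k) t x"
  unfolding approx_def
  by (rule scheme_steps(2)[OF S0 A, where \<tau> = "grid n" and v = "vecs n" and F = F and k = k])
    (use assms grid_less grid_le_T[of n "Suc k"] in auto)

lemma approx_0: "0 < n \<Longrightarrow> jet F \<Longrightarrow> approx n (F []) 0 x = 0"
  unfolding approx_def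
  by (rule scheme_steps(1)[OF S0 A, where \<tau> = "grid n" and v = "vecs n" and F = F]) (auto intro: grid_less)

text \<open>The constants only depend on the dimension. They are written out because the comparison of
  two grids needs them to be the same for both.\<close>

definition mod_const :: real where
  "mod_const = 1 + (real DIM('a))\<^sup>2 + 2 * (real DIM('a)) ^ 3"

lemma mod_const_nonneg: "0 \<le> mod_const"
  by (simp add: mod_const_def)

lemma integrand_bound:
  assumes "jet_bound 2 D F" "jet_bound 2 D U"
  shows "\<bar>contract (A s) (\<lambda>b c. U [b, c] s x) + F [] s x\<bar> \<le> D * weight s"
    and "\<bar>contract (AB s) (\<lambda>b c. U [b, c] s x) + F [] s x\<bar> \<le> D * weight s"
proof -
  have D: "0 \<le> D" using jet_bound_nonneg[OF assms(1)] .
  have f: "\<bar>F [] s x\<bar> \<le> D" using jet_boundD[OF assms(1), of "[]"] by simp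
  have u: "\<bar>U [b, c] s x\<bar> \<le> D" if "b \<in> Basis" "c \<in> Basis" for b c
    using jet_boundD[OF assms(2), of "[b, c]"] that by simp
  have a: "\<bar>contract (A s) (\<lambda>b c. U [b, c] s x)\<bar> \<le> mass (A s) * D"
    by (rule contract_mass_bound) (rule u)
  have b: "\<bar>contract (B s) (\<lambda>b c. U [b, c] s x)\<bar> \<le> mass (B s) * D"
    by (rule contract_mass_bound) (rule u)
  have "0 \<le> mass (B s) * D" using D mass_nonneg[of "B s"] by simp
  with f a show "\<bar>contract (A s) (\<lambda>b c. U [b, c] s x) + F [] s x\<bar> \<le> D * weight s"
    by (simp add: weight_def algebra_simps)
  from f a b show "\<bar>contract (AB s) (\<lambda>b c. U [b, c] s x) + F [] s x\<bar> \<le> D * weight s"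
    unfolding AB_def contract_add_left by (simp add: weight_def algebra_simps)
qed

lemma increment_bound:
  assumes F: "jet F" "jet_bound 2 D F" and S: "admissible T S" "jet_bound 2 D (\<lambda>bs. S (F bs))"
    and "0 \<le> r" "t \<le> T"
  shows "\<bar>increment A S F r t x\<bar> \<le> D * total r t" "\<bar>increment AB S F r t x\<bar> \<le> D * total r t"
proof -
  have w: "set_integrable lborel {r<..<t} (\<lambda>s. D * weight s)"
    using weight_integrable[OF assms(5,6)] by simp
  have e: "(LINT s:{r<..<t}|lborel. D * weight s) = D * total r t" by (simp add: total_def)
  show "\<bar>increment A S F r t x\<bar> \<le> D * total r t"
    unfolding increment_def e[symmetric]
    by (rule time_integral_bound[OF increment_integrable[OF A S(1) F(1) assms(5,6)] w])
      (rule integrand_bound(1)[OF F(2) S(2)])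
  show "\<bar>increment AB S F r t x\<bar> \<le> D * total r t"
    unfolding increment_def e[symmetric]
    by (rule time_integral_bound[OF increment_integrable[OF AB S(1) F(1) assms(5,6)] w])
      (rule integrand_bound(2)[OF F(2) S(2)])
qed

text \<open>Within a cell the solution moves by the jump at its left end and by the integrated equation. Only
  two derivatives are used here, so the walk is expanded with \<open>\<alpha> = 0\<close>.\<close>

lemma approx_modulus_cell:
  assumes n: "0 < n" "k < n" and t: "grid n k \<le> t" "t \<le> grid n (Suc k)"
    and F: "jet F" "jet_bound 2 D F" "jet_bound 2 D (\<lambda>bs. approx n (F bs))"
  shows "\<bar>approx n (F []) t x - approx n (F []) (grid n k) x\<bar> \<le> mod_const * D * total (grid n k) (grid n (Suc k))"
proof (cases "t = grid n k")
  case True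
  then show ?thesis using mod_const_nonneg total_nonneg jet_bound_nonneg[OF F(2)] by simp
next
  case False
  then have tk: "grid n k < t" using t by simp
  let ?U = "\<lambda>bs. approx n (F bs)" and ?g = "grid n k" and ?\<beta> = "total (grid n k) (grid n (Suc k))"
  have U: "jet ?U" by (rule admissible_jet[OF approx_admissible F(1)])
  have D: "0 \<le> D" using jet_bound_nonneg[OF F(2)] .
  have T1: "grid n (Suc k) \<le> T" by (rule grid_le_T) (use n in auto)
  have c0: "0 \<le> tr (cov n k)" by (rule psd_tr_nonneg[OF cov_psd[OF n]])
  have 1: "\<bar>walk (vecs n k) (?U [] ?g) x - ?U [] ?g x - contract (cov n k) (\<lambda>b c. ?U [b, c] ?g x)\<bar>
      \<le> (2 * (real DIM('a))\<^sup>2 * D) / 2 * (2 * DIM('a) * tr (cov n k)) powr (1 + 0 / 2)"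
    by (rule walk_expansion[OF vecs[OF n] jet_hessian[OF U] jet_holder2_rough[OF F(3)]])
      (use D in auto)
  have 2: "\<bar>contract (cov n k) (\<lambda>b c. ?U [b, c] ?g x)\<bar> \<le> (D * (real DIM('a))\<^sup>2) * tr (cov n k)"
  proof (rule psd_contract_bound[OF cov_psd[OF n]])
    have u: "\<bar>?U [b, c] ?g x\<bar> \<le> D" if "b \<in> Basis" "c \<in> Basis" for b c
      using jet_boundD[OF F(3), of "[b, c]" ?g x] that by simp
    show "\<bar>quad (\<lambda>b c. ?U [b, c] ?g x) v\<bar> \<le> D * (real DIM('a))\<^sup>2 * (norm v)\<^sup>2" for v
      by (rule quad_entries_bound) (rule u)
  qed
  have 3: "\<bar>increment A (approx n) F ?g t x\<bar> \<le> D * total ?g t"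
    by (rule increment_bound(1)[where S = "approx n" and F = F])
      (use F approx_admissible grid_nonneg t T1 in auto)
  have 4: "D * total ?g t \<le> D * ?\<beta>"
    using D by (intro mult_left_mono total_mono grid_nonneg) (use t T1 in auto)
  have p: "(2 * real DIM('a) * tr (cov n k)) powr (1 + 0 / 2) = 2 * (real DIM('a)) * tr (cov n k)"
    using c0 by simp
  have "\<bar>?U [] t x - ?U [] ?g x\<bar> \<le> D * ?\<beta> + ((real DIM('a))\<^sup>2 + 2 * (real DIM('a)) ^ 3) * D * tr (cov n k)"
  proof -
    have "(2 * (real DIM('a))\<^sup>2 * D) / 2 * (2 * DIM('a) * tr (cov n k)) powr (1 + 0 / 2) = 2 * (real DIM('a)) ^ 3 * D * tr (cov n k)"
      using p by (simp add: power2_eq_square power3_eq_cube)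
    moreover have "((real DIM('a))\<^sup>2 + 2 * (real DIM('a)) ^ 3) * D * tr (cov n k) = (D * (real DIM('a))\<^sup>2) * tr (cov n k) + 2 * (real DIM('a)) ^ 3 * D * tr (cov n k)"
      by (simp add: algebra_simps)
    ultimately show ?thesis
      using 1 2 3 4 approx_step[OF n tk t(2) F(1), of x] unfolding abs_le_iff by linarith
  qed
  also have "((real DIM('a))\<^sup>2 + 2 * (real DIM('a)) ^ 3) * D * tr (cov n k) \<le> ((real DIM('a))\<^sup>2 + 2 * (real DIM('a)) ^ 3) * D * ?\<beta>"
    using D tr_cov[OF n] by (intro mult_left_mono) auto
  finally show ?thesis by (simp add: mod_const_def algebra_simps)
qed

lemma approx_modulus:
  assumes n: "0 < n" and pq: "p < q" "q \<le> n" and t: "grid n p \<le> t" "t \<le> grid n q"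
    and F: "jet F" "jet_bound 2 D F" "jet_bound 2 D (\<lambda>bs. approx n (F bs))"
  shows "\<bar>approx n (F []) t x - approx n (F []) (grid n p) x\<bar> \<le> mod_const * D * total (grid n p) (grid n q)"
proof -
  have "Suc p \<le> q" using pq by simp
  then show ?thesis using pq(2) t
  proof (induction q arbitrary: t rule: dec_induct)
    case base
    then show ?case using approx_modulus_cell[OF n _ _ _ F] by simp
  next
    case (step q)
    have D: "0 \<le> mod_const * D" using jet_bound_nonneg[OF F(2)] mod_const_nonneg by simp
    have sp: "total (grid n p) (grid n (Suc q)) = total (grid n p) (grid n q) + total (grid n q) (grid n (Suc q))"
      by (rule total_split[OF grid_nonneg grid_mono grid_mono grid_le_T]) (use step n in auto)
    show ?case
    proof (cases "t \<le> grid n q")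
      case True
      then have "\<bar>approx n (F []) t x - approx n (F []) (grid n p) x\<bar> \<le> mod_const * D * total (grid n p) (grid n q)"
        using step by auto
      also have "\<dots> \<le> mod_const * D * total (grid n p) (grid n (Suc q))"
        using D total_nonneg[of "grid n q" "grid n (Suc q)"] unfolding sp by (intro mult_left_mono) auto
      finally show ?thesis .
    next
      case False
      have "\<bar>approx n (F []) (grid n q) x - approx n (F []) (grid n p) x\<bar> \<le> mod_const * D * total (grid n p) (grid n q)"
        using step grid_mono[of p q n] by auto
      moreover have "\<bar>approx n (F []) t x - approx n (F []) (grid n q) x\<bar> \<le> mod_const * D * total (grid n q) (grid n (Suc q))"
        using approx_modulus_cell[OF n _ _ _ F, of q t x] step False by simp
      ultimately show ?thesis unfolding sp distrib_left by linarith
    qed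
  qed
qed

definition defect_const :: real where
  "defect_const = mod_const + 2 * (real DIM('a)) ^ 4 * (2 * (real DIM('a))) powr (1/2)"

text \<open>All errors are brought to the form (power of the mesh) times (mass of the cell), so that
  their sum over the cells is small.\<close>

lemma sqrt_bounds:
  fixes \<beta> \<delta> :: real
  assumes "0 \<le> \<beta>" "\<beta> \<le> \<delta>" "\<delta> \<le> 1"
  shows "\<beta> \<le> \<delta> powr (1/2)"
    and "0 \<le> x \<Longrightarrow> x \<le> \<beta> \<Longrightarrow> (2 * (real DIM('a)) * x) powr (1 + 1 / 2) \<le> 2 * (real DIM('a)) * (2 * (real DIM('a))) powr (1/2) * \<delta> powr (1/2) * \<beta>"
proof -
  have \<delta>: "0 \<le> \<delta>" using assms by simp
  have "\<delta> = \<delta> powr (1/2) * \<delta> powr (1/2)"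
    using \<delta> powr_add[of \<delta> "1/2" "1/2"] by simp
  also have "\<dots> \<le> \<delta> powr (1/2) * 1"
    using \<delta> assms by (intro mult_left_mono) (auto simp: powr_le1)
  finally show "\<beta> \<le> \<delta> powr (1/2)" using assms by simp
  assume x: "0 \<le> x" "x \<le> \<beta>"
  have "(2 * (real DIM('a)) * x) powr (1 + 1 / 2) \<le> (2 * (real DIM('a)) * x) * (2 * (real DIM('a)) * \<delta>) powr (1/2)"
    by (rule powr_one_plus_le) (use x assms in \<open>auto intro!: mult_left_mono\<close>)
  also have "\<dots> \<le> (2 * (real DIM('a)) * \<beta>) * (2 * (real DIM('a)) * \<delta>) powr (1/2)"
    using x by (intro mult_right_mono mult_left_mono) auto
  also have "\<dots> = 2 * (real DIM('a)) * (2 * (real DIM('a))) powr (1/2) * \<delta> powr (1/2) * \<beta>"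
    using \<delta> by (simp add: powr_mult)
  finally show "(2 * (real DIM('a)) * x) powr (1 + 1 / 2) \<le> 2 * (real DIM('a)) * (2 * (real DIM('a))) powr (1/2) * \<delta> powr (1/2) * \<beta>" .
qed

text \<open>Over one cell the jump contributes \<open>\<integral> B : D^2 u\<close> with \<open>D^2 u\<close> frozen at the left end. The expansion with
  \<open>\<alpha> = 1\<close> and the slow variation of \<open>D^2 u\<close> within the cell control the two errors. Since derivatives
  of solutions solve the equation with differentiated data, the bound for the variation
  is \<open>approx_modulus_cell\<close> applied to the jet of \<open>D\<^sub>b D\<^sub>c u\<close>.\<close>

lemma approx_defect_cell:
  assumes n: "0 < n" "k < n" and \<delta>: "total (grid n k) (grid n (Suc k)) \<le> \<delta>" "\<delta> \<le> 1"
    and F: "jet F" "jet_bound 4 D F" "jet_bound 4 D (\<lambda>bs. approx n (F bs))"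
  shows "\<bar>approx n (F []) (grid n (Suc k)) x - approx n (F []) (grid n k) x
      - increment AB (approx n) F (grid n k) (grid n (Suc k)) x\<bar>
    \<le> defect_const * D * \<delta> powr (1/2) * total (grid n k) (grid n (Suc k))"
proof -
  let ?U = "\<lambda>bs. approx n (F bs)" and ?g = "grid n k" and ?h = "grid n (Suc k)"
  let ?\<beta> = "total ?g ?h"
  have U: "jet ?U" by (rule admissible_jet[OF approx_admissible F(1)])
  have D: "0 \<le> D" using jet_bound_nonneg[OF F(2)] .
  have gT: "?h \<le> T" by (rule grid_le_T) (use n in auto)
  have gh: "?g < ?h" by (rule grid_less[OF n(1)])
  have c0: "0 \<le> tr (cov n k)" by (rule psd_tr_nonneg[OF cov_psd[OF n]])
  have U3: "jet_bound 3 D ?U" by (rule jet_bound_mono[OF F(3)]) auto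
  have 1: "\<bar>walk (vecs n k) (?U [] ?g) x - ?U [] ?g x - contract (cov n k) (\<lambda>b c. ?U [b, c] ?g x)\<bar>
      \<le> (2 * (real DIM('a)) ^ 3 * D) / 2 * (2 * DIM('a) * tr (cov n k)) powr (1 + 1 / 2)"
    by (rule walk_expansion[OF vecs[OF n] jet_hessian[OF U] jet_holder2[OF U U3]]) (use D in auto)
  also have "\<dots> \<le> (2 * (real DIM('a)) ^ 3 * D) / 2 * (2 * (real DIM('a)) * (2 * (real DIM('a))) powr (1/2) * \<delta> powr (1/2) * ?\<beta>)"
    using sqrt_bounds(2)[OF total_nonneg \<delta> c0 tr_cov[OF n]] D by (intro mult_left_mono) auto
  also have "\<dots> = 2 * (real DIM('a)) ^ 4 * (2 * (real DIM('a))) powr (1/2) * D * \<delta> powr (1/2) * ?\<beta>"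
    by (simp add: power3_eq_cube power4_eq_xxxx)
  finally have 1: "\<bar>walk (vecs n k) (?U [] ?g) x - ?U [] ?g x - contract (cov n k) (\<lambda>b c. ?U [b, c] ?g x)\<bar>
      \<le> 2 * (real DIM('a)) ^ 4 * (2 * (real DIM('a))) powr (1/2) * D * \<delta> powr (1/2) * ?\<beta>" .
  have Bs: "set_integrable lborel {?g<..<?h} (\<lambda>s. contract (B s) (\<lambda>b c. ?U [b, c] s x))"
    by (rule contract_jet_integrable[OF B U grid_nonneg gT])
  have Bk: "set_integrable lborel {?g<..<?h} (\<lambda>s. contract (B s) (\<lambda>b c. ?U [b, c] ?g x))"
    by (rule contract_integrable) (rule coeff_cell_integrable[OF B n])
  have ck: "contract (cov n k) (\<lambda>b c. ?U [b, c] ?g x) = (LINT s:{?g<..<?h}|lborel. contract (B s) (\<lambda>b c. ?U [b, c] ?g x))"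
    unfolding cov_def by (rule contract_integral) (rule coeff_cell_integrable[OF B n])
  have osc: "\<bar>?U [b, c] s x - ?U [b, c] ?g x\<bar> \<le> mod_const * D * ?\<beta>"
    if "b \<in> Basis" "c \<in> Basis" "?g < s" "s < ?h" for b c s
  proof -
    have "jet (\<lambda>cs. F (cs @ [b, c]))" by (rule jet_append[OF F(1)])
    moreover have "jet_bound 2 D (\<lambda>cs. F (cs @ [b, c]))"
      by (rule jet_bound_append[OF F(2)]) (use that in auto)
    moreover have "jet_bound 2 D (\<lambda>cs. ?U (cs @ [b, c]))"
      by (rule jet_bound_append[OF F(3)]) (use that in auto)
    ultimately show ?thesis
      using approx_modulus_cell[where F = "\<lambda>cs. F (cs @ [b, c])" and t = s and D = D and x = x, OF n] that by simp
  qed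
  have 2: "\<bar>(LINT s:{?g<..<?h}|lborel. contract (B s) (\<lambda>b c. ?U [b, c] s x)) - contract (cov n k) (\<lambda>b c. ?U [b, c] ?g x)\<bar>
      \<le> mod_const * D * ?\<beta> * ?\<beta>"
  proof -
    let ?E = "mod_const * D * ?\<beta>"
    let ?I = "\<lambda>s. contract (B s) (\<lambda>b c. ?U [b, c] s x) - contract (B s) (\<lambda>b c. ?U [b, c] ?g x)"
    have E: "0 \<le> ?E" using mod_const_nonneg D total_nonneg[of ?g ?h] by simp
    have le: "\<bar>?I s\<bar> \<le> ?E * weight s" if s: "?g < s" "s < ?h" for s
    proof -
      have "\<bar>?I s\<bar> = \<bar>contract (B s) (\<lambda>b c. ?U [b, c] s x - ?U [b, c] ?g x)\<bar>"
        by (simp only: contract_diff_right)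
      also have "\<dots> \<le> mass (B s) * ?E"
        by (rule contract_mass_bound) (rule osc[OF _ _ s])
      also have "\<dots> \<le> weight s * ?E"
        using mass_nonneg[of "A s"] E by (intro mult_right_mono) (simp_all add: weight_def)
      finally show ?thesis by (simp only: mult.commute)
    qed
    have "\<bar>LINT s:{?g<..<?h}|lborel. ?I s\<bar> \<le> (LINT s:{?g<..<?h}|lborel. ?E * weight s)"
    proof (rule time_integral_bound[OF set_integral_diff(1)[OF Bs Bk] _ le])
      show "set_integrable lborel {?g<..<?h} (\<lambda>s. ?E * weight s)"
        using weight_integrable[OF grid_nonneg gT] by simp
    qed
    moreover have "(LINT s:{?g<..<?h}|lborel. ?E * weight s) = ?E * ?\<beta>" by (simp add: total_def)
    ultimately show ?thesis
      unfolding ck using set_integral_diff(2)[OF Bs Bk] by (simp only:)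
  qed
  have 3: "mod_const * D * ?\<beta> * ?\<beta> \<le> mod_const * D * \<delta> powr (1/2) * ?\<beta>"
  proof -
    have "mod_const * D * ?\<beta> \<le> mod_const * D * \<delta> powr (1/2)"
      using sqrt_bounds(1)[OF total_nonneg \<delta>] mod_const_nonneg D by (intro mult_left_mono) simp_all
    then show ?thesis by (rule mult_right_mono) (rule total_nonneg)
  qed
  have arith: "\<bar>u' - u - q\<bar> \<le> e" if "q = i + b" "u' = w + i" "e = e3 + e1" "\<bar>w - u - c\<bar> \<le> e1" "\<bar>b - c\<bar> \<le> e2" "e2 \<le> e3"
    for w u c i b e1 e2 e3 u' q e :: real
    using that by linarith
  have "increment AB (approx n) F ?g ?h x
      = increment A (approx n) F ?g ?h x + (LINT s:{?g<..<?h}|lborel. contract (B s) (\<lambda>b c. ?U [b, c] s x))"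
  proof -
    have "set_integrable lborel {?g<..<?h} (\<lambda>s. contract (A s) (\<lambda>b c. ?U [b, c] s x) + F [] s x)"
      by (rule increment_integrable[where S = "approx n" and F = F, OF A approx_admissible F(1) grid_nonneg gT])
    from set_integral_add(2)[OF this Bs]
    show ?thesis unfolding increment_def AB_def contract_add_left by (simp add: add_ac)
  qed
  moreover note approx_step[OF n gh order_refl F(1), of x]
  moreover have "defect_const * D * \<delta> powr (1/2) * ?\<beta>
      = mod_const * D * \<delta> powr (1/2) * ?\<beta> + 2 * (real DIM('a)) ^ 4 * (2 * (real DIM('a))) powr (1/2) * D * \<delta> powr (1/2) * ?\<beta>"
    by (simp add: defect_const_def algebra_simps)
  ultimately show ?thesis using 1 2 3 by (rule arith)
qed

end


context kicked_evolution
begin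

lemma AB_eq: "AB s = (\<lambda>b c. A s b c + B s b c)"
  by (intro ext) (simp add: AB_def)

lemma grid_sum_bound:
  fixes h :: "nat \<Rightarrow> real"
  assumes "0 < n" "p \<le> q" "q \<le> n"
  shows "(\<Sum>k=p..<q. total (grid n k) (grid n (Suc k))) = total (grid n p) (grid n q)"
  unfolding total_def
  by (rule time_integral_sum_grid) (use assms in \<open>auto intro: grid_mono weight_integrable grid_nonneg grid_le_T\<close>)

lemma increment_split:
  assumes "integrable_coeff T M" "admissible T S" "jet F" "0 \<le> r" "r \<le> q" "q \<le> t" "t \<le> T"
  shows "increment M S F r t x = increment M S F r q x + increment M S F q t x"
  unfolding increment_def
  by (rule time_integral_split[OF assms(5,6) increment_integrable[OF assms(1,2,3,4,7)]])

lemma approx_defect: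
  assumes n: "0 < n" and pq: "p \<le> q" "q \<le> n"
    and \<delta>: "\<And>k. k < n \<Longrightarrow> total (grid n k) (grid n (Suc k)) \<le> \<delta>" "\<delta> \<le> 1"
    and F: "jet F" "jet_bound 4 D F" "jet_bound 4 D (\<lambda>bs. approx n (F bs))"
  shows "\<bar>approx n (F []) (grid n q) x - approx n (F []) (grid n p) x
      - increment AB (approx n) F (grid n p) (grid n q) x\<bar>
    \<le> defect_const * D * \<delta> powr (1/2) * total (grid n p) (grid n q)"
  using pq
proof (induction q rule: dec_induct)
  case base
  then show ?case by (simp add: increment_def total_def set_lebesgue_integral_def)
next
  case (step q)
  let ?U = "\<lambda>t. approx n (F []) t x" and ?I = "\<lambda>r t. increment AB (approx n) F r t x"
  let ?c = "defect_const * D * \<delta> powr (1/2)"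
  have arith: "\<bar>u'' - u - (i + i')\<bar> \<le> c * (b + b')"
    if "\<bar>u' - u - i\<bar> \<le> c * b" "\<bar>u'' - u' - i'\<bar> \<le> c * b'" for u u' u'' i i' b b' c :: real
    using that by (simp add: distrib_left abs_le_iff)
  have 1: "\<bar>?U (grid n q) - ?U (grid n p) - ?I (grid n p) (grid n q)\<bar> \<le> ?c * total (grid n p) (grid n q)"
    using step by simp
  have 2: "\<bar>?U (grid n (Suc q)) - ?U (grid n q) - ?I (grid n q) (grid n (Suc q))\<bar> \<le> ?c * total (grid n q) (grid n (Suc q))"
    by (rule approx_defect_cell[OF n _ \<delta>(1) \<delta>(2) F]) (use step in auto)
  have g: "grid n p \<le> grid n q" "grid n q \<le> grid n (Suc q)" "grid n (Suc q) \<le> T"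
    using step n by (auto intro: grid_mono grid_le_T)
  show ?case
    unfolding total_split[OF grid_nonneg g] increment_split[OF AB approx_admissible F(1) grid_nonneg g]
    by (rule arith[OF 1 2])
qed

text \<open>Seen on a coarser grid, the scheme is still an approximate Euler scheme with the frozen operator
  \<open>(A + B) : D^2\<close>; the fine mesh is bounded by \<open>\<delta>\<close> and the coarse one by \<open>\<delta>'\<close>.\<close>

lemma approx_expansion:
  assumes n: "0 < n" and pq: "p < q" "q \<le> n"
    and \<delta>: "\<And>k. k < n \<Longrightarrow> total (grid n k) (grid n (Suc k)) \<le> \<delta>" "\<delta> \<le> 1"
    and \<beta>: "total (grid n p) (grid n q) \<le> \<delta>'" "\<delta> \<le> \<delta>'" "\<delta>' \<le> 1"
    and F: "jet F" "jet_bound 4 D F" "jet_bound 4 D (\<lambda>bs. approx n (F bs))"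
  shows "\<bar>approx n (F []) (grid n q) x - approx n (F []) (grid n p) x
      - contract (\<lambda>b c. LINT s:{grid n p<..<grid n q}|lborel. AB s b c) (\<lambda>b c. approx n (F [b, c]) (grid n p) x)
      - (LINT s:{grid n p<..<grid n q}|lborel. F [] s x)\<bar>
    \<le> (defect_const + mod_const) * D * \<delta>' powr (1/2) * total (grid n p) (grid n q)"
proof -
  let ?U = "\<lambda>bs. approx n (F bs)" and ?g = "grid n p" and ?h = "grid n q"
  let ?\<beta> = "total ?g ?h"
  have U: "jet ?U" by (rule admissible_jet[OF approx_admissible F(1)])
  have D: "0 \<le> D" using jet_bound_nonneg[OF F(2)] .
  have dc: "0 \<le> defect_const" using mod_const_nonneg by (simp add: defect_const_def)
  have gT: "?h \<le> T" by (rule grid_le_T) (use n pq in auto)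
  have \<delta>0: "0 \<le> \<delta>" using \<delta>(1)[of 0] n total_nonneg[of "grid n 0" "grid n (Suc 0)"] by linarith
  have ABi: "set_integrable lborel {?g<..<?h} (\<lambda>s. AB s b c)" if "b \<in> Basis" "c \<in> Basis" for b c
    by (rule integrable_coeffD[OF AB grid_nonneg gT that])
  have 1: "\<bar>?U [] ?h x - ?U [] ?g x - increment AB (approx n) F ?g ?h x\<bar> \<le> defect_const * D * \<delta> powr (1/2) * ?\<beta>"
    by (rule approx_defect[OF n less_imp_le[OF pq(1)] pq(2) \<delta> F])
  have "\<delta> powr (1/2) \<le> \<delta>' powr (1/2)" using \<delta>0 \<beta>(2) by (intro powr_mono2) auto
  then have 2: "defect_const * D * \<delta> powr (1/2) * ?\<beta> \<le> defect_const * D * \<delta>' powr (1/2) * ?\<beta>"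
    using dc D by (intro mult_right_mono[OF mult_left_mono] total_nonneg) simp_all
  have Us: "set_integrable lborel {?g<..<?h} (\<lambda>s. contract (AB s) (\<lambda>b c. ?U [b, c] s x))"
    by (rule contract_jet_integrable[OF AB U grid_nonneg gT])
  have Ug: "set_integrable lborel {?g<..<?h} (\<lambda>s. contract (AB s) (\<lambda>b c. ?U [b, c] ?g x))"
    by (rule contract_integrable) (rule ABi)
  have fs: "set_integrable lborel {?g<..<?h} (\<lambda>s. F [] s x)" by (rule jet_time_integrable[OF F(1)])
  have osc: "\<bar>?U [b, c] s x - ?U [b, c] ?g x\<bar> \<le> mod_const * D * ?\<beta>"
    if "b \<in> Basis" "c \<in> Basis" "?g < s" "s < ?h" for b c s
  proof -
    have "jet (\<lambda>cs. F (cs @ [b, c]))" by (rule jet_append[OF F(1)])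
    moreover have "jet_bound 2 D (\<lambda>cs. F (cs @ [b, c]))"
      by (rule jet_bound_append[OF F(2)]) (use that in auto)
    moreover have "jet_bound 2 D (\<lambda>cs. ?U (cs @ [b, c]))"
      by (rule jet_bound_append[OF F(3)]) (use that in auto)
    ultimately show ?thesis
      using approx_modulus[where F = "\<lambda>cs. F (cs @ [b, c])" and t = s and D = D and x = x, OF n pq] that by simp
  qed
  let ?E = "mod_const * D * ?\<beta>"
  let ?I = "\<lambda>s. contract (AB s) (\<lambda>b c. ?U [b, c] s x) - contract (AB s) (\<lambda>b c. ?U [b, c] ?g x)"
  have E: "0 \<le> ?E" using mod_const_nonneg D total_nonneg[of ?g ?h] by simp
  have le: "\<bar>?I s\<bar> \<le> ?E * weight s" if s: "?g < s" "s < ?h" for s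
  proof -
    have "\<bar>?I s\<bar> = \<bar>contract (A s) (\<lambda>b c. ?U [b, c] s x - ?U [b, c] ?g x) + contract (B s) (\<lambda>b c. ?U [b, c] s x - ?U [b, c] ?g x)\<bar>"
      by (simp only: contract_diff_right AB_eq contract_add_left add_diff_add)
    also have "\<dots> \<le> mass (A s) * ?E + mass (B s) * ?E"
      by (rule order_trans[OF abs_triangle_ineq add_mono]; rule contract_mass_bound; rule osc[OF _ _ s])
    also have "\<dots> \<le> weight s * ?E"
      using E by (simp add: weight_def algebra_simps)
    finally show ?thesis by (simp only: mult.commute)
  qed
  have "\<bar>LINT s:{?g<..<?h}|lborel. ?I s\<bar> \<le> (LINT s:{?g<..<?h}|lborel. ?E * weight s)"
  proof (rule time_integral_bound[OF set_integral_diff(1)[OF Us Ug] _ le])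
    show "set_integrable lborel {?g<..<?h} (\<lambda>s. ?E * weight s)"
      using weight_integrable[OF grid_nonneg gT] by simp
  qed
  also have "(LINT s:{?g<..<?h}|lborel. ?E * weight s) = ?E * ?\<beta>" by (simp add: total_def)
  also have "(LINT s:{?g<..<?h}|lborel. ?I s) = (LINT s:{?g<..<?h}|lborel. contract (AB s) (\<lambda>b c. ?U [b, c] s x))
      - (LINT s:{?g<..<?h}|lborel. contract (AB s) (\<lambda>b c. ?U [b, c] ?g x))"
    by (rule set_integral_diff(2)[OF Us Ug])
  also have "(LINT s:{?g<..<?h}|lborel. contract (AB s) (\<lambda>b c. ?U [b, c] ?g x))
      = contract (\<lambda>b c. LINT s:{?g<..<?h}|lborel. AB s b c) (\<lambda>b c. ?U [b, c] ?g x)"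
    by (rule contract_integral[symmetric]) (rule ABi)
  finally have 3: "\<bar>(LINT s:{?g<..<?h}|lborel. contract (AB s) (\<lambda>b c. ?U [b, c] s x))
      - contract (\<lambda>b c. LINT s:{?g<..<?h}|lborel. AB s b c) (\<lambda>b c. ?U [b, c] ?g x)\<bar> \<le> ?E * ?\<beta>" .
  have 4: "?E * ?\<beta> \<le> mod_const * D * \<delta>' powr (1/2) * ?\<beta>"
  proof -
    have "?E \<le> mod_const * D * \<delta>' powr (1/2)"
      using sqrt_bounds(1)[OF total_nonneg \<beta>(1,3)] mod_const_nonneg D by (intro mult_left_mono) simp_all
    then show ?thesis by (rule mult_right_mono) (rule total_nonneg)
  qed
  have 5: "increment AB (approx n) F ?g ?h x = (LINT s:{?g<..<?h}|lborel. contract (AB s) (\<lambda>b c. ?U [b, c] s x)) + (LINT s:{?g<..<?h}|lborel. F [] s x)"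
    unfolding increment_def by (rule set_integral_add(2)[OF Us fs])
  have arith: "\<bar>h - g - k - f\<bar> \<le> e"
    if "i = c + f" "e = e1' + e2'" "\<bar>h - g - i\<bar> \<le> e1" "e1 \<le> e1'" "\<bar>c - k\<bar> \<le> e2" "e2 \<le> e2'" for h g i c k f e e1 e2 e1' e2' :: real
    using that by linarith
  have 6: "(defect_const + mod_const) * D * \<delta>' powr (1/2) * ?\<beta>
      = defect_const * D * \<delta>' powr (1/2) * ?\<beta> + mod_const * D * \<delta>' powr (1/2) * ?\<beta>"
    by (simp only: distrib_right)
  show ?thesis by (rule arith[OF 5 6 1 2 3 4])
qed

definition rate_const :: real where
  "rate_const = 2 * (defect_const + mod_const) + 4 * (real DIM('a)) ^ 4 * (2 * real DIM('a)) powr (1/2)"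

text \<open>At the nodes of the coarse grid both schemes satisfy the same Euler recursion up to small errors, so
  that \<open>walk_stability\<close> applies to their difference.\<close>

lemma approx_compare_grid:
  assumes n: "0 < n" and m: "0 < m" and k: "k \<le> n"
    and \<delta>: "\<And>k. k < n \<Longrightarrow> total (grid n k) (grid n (Suc k)) \<le> \<delta>" "\<delta> \<le> 1"
    and F: "jet F" "jet_bound 4 D F" "\<And>n. jet_bound 4 D (\<lambda>bs. approx n (F bs))"
  shows "\<bar>approx n (F []) (grid n k) x - approx (n * m) (F []) (grid n k) x\<bar> \<le> rate_const * D * \<delta> powr (1/2) * total 0 T"
proof -
  let ?N = "n * m"
  let ?\<beta> = "\<lambda>k. total (grid n k) (grid n (Suc k))"
  have D: "0 \<le> D" using jet_bound_nonneg[OF F(2)] .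
  have N: "0 < ?N" using n m by simp
  have \<delta>0: "0 \<le> \<delta>" using \<delta>(1)[of 0] n total_nonneg[of "grid n 0" "grid n (Suc 0)"] by linarith
  have U: "jet (\<lambda>bs. approx n (F bs))" for n by (rule admissible_jet[OF approx_admissible F(1)])
  have U3: "jet_bound 3 D (\<lambda>bs. approx n (F bs))" for n by (rule jet_bound_mono[OF F(3)]) auto
  have \<delta>N: "total (grid ?N j) (grid ?N (Suc j)) \<le> \<delta>" if j: "j < ?N" for j
  proof -
    let ?k = "j div m"
    have kn: "?k < n" using j by (simp add: less_mult_imp_div_less)
    have "?k * m \<le> j" by simp
    then have a: "grid n ?k \<le> grid ?N j" using grid_mono[of "?k * m" j ?N] grid_refine[OF m, of n ?k] by simp
    have "j < Suc ?k * m" using m by (metis dividend_less_div_times mult.commute mult_Suc_right mult_Suc)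
    then have "Suc j \<le> Suc ?k * m" by simp
    then have b: "grid ?N (Suc j) \<le> grid n (Suc ?k)" using grid_mono[of "Suc j" "Suc ?k * m" ?N] grid_refine[OF m, of n "Suc ?k"] by simp
    have "total (grid ?N j) (grid ?N (Suc j)) \<le> ?\<beta> ?k"
      by (rule total_mono[OF grid_nonneg a grid_mono b grid_le_T]) (use kn n in auto)
    then show ?thesis using \<delta>(1)[OF kn] by simp
  qed
  define Bk where "Bk k b c = (LINT s:{grid n k<..<grid n (Suc k)}|lborel. AB s b c)" for k b c
  define e where "e k = 2 * ((defect_const + mod_const) * D * \<delta> powr (1/2) * ?\<beta> k)" for k
  have "\<bar>approx n (F []) (grid n k) x - approx ?N (F []) (grid n k) x\<bar>
      \<le> (\<Sum>k<k. e k + (2 * (2 * real DIM('a) ^ 3 * D)) / 2 * (2 * DIM('a) * tr (Bk k)) powr (1 + 1 / 2))"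
  proof (rule walk_stability[where w = "\<lambda>k x. approx n (F []) (grid n k) x - approx ?N (F []) (grid n k) x"])
    fix j assume "j < k"
    then have j: "j < n" using k by simp
    show "psd (Bk j)" unfolding Bk_def by (rule AB_cell_psd[OF n j])
    show "has_hessian (\<lambda>x. approx n (F []) (grid n j) x - approx ?N (F []) (grid n j) x)
        (\<lambda>b x. approx n (F [b]) (grid n j) x - approx ?N (F [b]) (grid n j) x)
        (\<lambda>b c x. approx n (F [b, c]) (grid n j) x - approx ?N (F [b, c]) (grid n j) x)"
      by (intro has_hessian_diff jet_hessian[OF U])
    have "holder2 ((2 * real DIM('a) ^ 3 * D) + (2 * real DIM('a) ^ 3 * D)) 1 (\<lambda>b c x. approx n (F [b, c]) (grid n j) x - approx ?N (F [b, c]) (grid n j) x)"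
      by (intro holder2_diff jet_holder2[OF U U3]) auto
    then show "holder2 (2 * (2 * real DIM('a) ^ 3 * D)) 1 (\<lambda>b c x. approx n (F [b, c]) (grid n j) x - approx ?N (F [b, c]) (grid n j) x)"
      by (simp only: mult_2)
    fix x
    let ?f = "LINT s:{grid n j<..<grid n (Suc j)}|lborel. F [] s x"
    have 1: "\<bar>approx n (F []) (grid n (Suc j)) x - approx n (F []) (grid n j) x
        - contract (Bk j) (\<lambda>b c. approx n (F [b, c]) (grid n j) x) - ?f\<bar>
      \<le> (defect_const + mod_const) * D * \<delta> powr (1/2) * ?\<beta> j"
      unfolding Bk_def
      by (rule approx_expansion[OF n _ _ \<delta> \<delta>(1)[OF j] order_refl \<delta>(2) F]) (use j in auto)
    have g: "grid ?N (j * m) = grid n j" "grid ?N (Suc j * m) = grid n (Suc j)"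
      by (rule grid_refine[OF m])+
    have "\<bar>approx ?N (F []) (grid ?N (Suc j * m)) x - approx ?N (F []) (grid ?N (j * m)) x
        - contract (\<lambda>b c. LINT s:{grid ?N (j * m)<..<grid ?N (Suc j * m)}|lborel. AB s b c) (\<lambda>b c. approx ?N (F [b, c]) (grid ?N (j * m)) x)
        - (LINT s:{grid ?N (j * m)<..<grid ?N (Suc j * m)}|lborel. F [] s x)\<bar>
      \<le> (defect_const + mod_const) * D * \<delta> powr (1/2) * total (grid ?N (j * m)) (grid ?N (Suc j * m))"
    proof (rule approx_expansion[OF N _ _ \<delta>N \<delta>(2) _ order_refl \<delta>(2) F])
      show "j * m < Suc j * m" using m by simp
      show "Suc j * m \<le> ?N" using j by (intro mult_le_mono1) simp
      show "total (grid ?N (j * m)) (grid ?N (Suc j * m)) \<le> \<delta>" unfolding g by (rule \<delta>(1)[OF j])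
    qed
    then have 2: "\<bar>approx ?N (F []) (grid n (Suc j)) x - approx ?N (F []) (grid n j) x
        - contract (Bk j) (\<lambda>b c. approx ?N (F [b, c]) (grid n j) x) - ?f\<bar>
      \<le> (defect_const + mod_const) * D * \<delta> powr (1/2) * ?\<beta> j"
      unfolding g Bk_def .
    have arith: "\<bar>(h - h') - (g - g') - (k - k')\<bar> \<le> 2 * e"
      if "\<bar>h - g - k - f\<bar> \<le> e" "\<bar>h' - g' - k' - f\<bar> \<le> e" for h h' g g' k k' f e :: real
      using that by linarith
    show "\<bar>(approx n (F []) (grid n (Suc j)) x - approx ?N (F []) (grid n (Suc j)) x)
        - (approx n (F []) (grid n j) x - approx ?N (F []) (grid n j) x)
        - contract (Bk j) (\<lambda>b c. approx n (F [b, c]) (grid n j) x - approx ?N (F [b, c]) (grid n j) x)\<bar> \<le> e j"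
      unfolding contract_diff_right e_def by (rule arith[OF 1 2])
  next
    show "approx n (F []) (grid n 0) x - approx ?N (F []) (grid n 0) x = 0" for x
      using approx_0[OF n F(1)] approx_0[OF N F(1)] by simp
  qed (use D in auto)
  also have "\<dots> \<le> (\<Sum>k<k. rate_const * D * \<delta> powr (1/2) * ?\<beta> k)"
  proof (rule sum_mono)
    fix j assume "j \<in> {..<k}"
    then have j: "j < n" using k by simp
    have "tr (Bk j) \<le> ?\<beta> j" unfolding Bk_def
    proof (rule tr_integral_le_total[OF AB _ n j])
      have "tr (AB s) = tr (A s) + tr (B s)" for s by (simp add: tr_def AB_def sum.distrib)
      then show "tr (AB s) \<le> weight s" for s
        using tr_le_mass[of "A s"] tr_le_mass[of "B s"] by (simp add: weight_def)
    qed
    moreover have "0 \<le> tr (Bk j)"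
      unfolding Bk_def by (rule psd_tr_nonneg[OF AB_cell_psd[OF n j]])
    ultimately have "(2 * real DIM('a) * tr (Bk j)) powr (1 + 1 / 2)
        \<le> 2 * real DIM('a) * (2 * real DIM('a)) powr (1/2) * \<delta> powr (1/2) * ?\<beta> j"
      using sqrt_bounds(2)[OF total_nonneg \<delta>(1)[OF j] \<delta>(2)] by blast
    then have "(2 * (2 * real DIM('a) ^ 3 * D)) / 2 * (2 * real DIM('a) * tr (Bk j)) powr (1 + 1 / 2)
        \<le> (2 * (2 * real DIM('a) ^ 3 * D)) / 2 * (2 * real DIM('a) * (2 * real DIM('a)) powr (1/2) * \<delta> powr (1/2) * ?\<beta> j)"
      by (rule mult_left_mono) (use D in simp)
    also have "\<dots> = 4 * (real DIM('a)) ^ 4 * (2 * real DIM('a)) powr (1/2) * D * \<delta> powr (1/2) * ?\<beta> j"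
      by (simp add: power3_eq_cube power4_eq_xxxx)
    finally have "e j + (2 * (2 * real DIM('a) ^ 3 * D)) / 2 * (2 * real DIM('a) * tr (Bk j)) powr (1 + 1 / 2)
        \<le> e j + 4 * (real DIM('a)) ^ 4 * (2 * real DIM('a)) powr (1/2) * D * \<delta> powr (1/2) * ?\<beta> j"
      by simp
    also have "\<dots> = rate_const * D * \<delta> powr (1/2) * ?\<beta> j"
      unfolding e_def rate_const_def by (simp only: distrib_right mult.assoc)
    finally show "e j + (2 * (2 * real DIM('a) ^ 3 * D)) / 2 * (2 * DIM('a) * tr (Bk j)) powr (1 + 1 / 2)
        \<le> rate_const * D * \<delta> powr (1/2) * ?\<beta> j" by simp
  qed
  also have "\<dots> = rate_const * D * \<delta> powr (1/2) * total 0 (grid n k)"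
    using grid_sum_bound[OF n _ k, of 0] by (simp add: sum_distrib_left[symmetric] atLeast0LessThan)
  also have "\<dots> \<le> rate_const * D * \<delta> powr (1/2) * total 0 T"
  proof (rule mult_left_mono)
    show "total 0 (grid n k) \<le> total 0 T"
      by (rule total_mono) (use grid_nonneg[of n k] grid_le_T[OF n k] in auto)
    show "0 \<le> rate_const * D * \<delta> powr (1/2)"
      using D mod_const_nonneg by (simp add: rate_const_def defect_const_def)
  qed
  finally show ?thesis .
qed

lemma approx_compare:
  assumes n: "0 < n" and m: "0 < m" and t: "0 \<le> t" "t \<le> T"
    and \<delta>: "\<And>k. k < n \<Longrightarrow> total (grid n k) (grid n (Suc k)) \<le> \<delta>" "\<delta> \<le> 1"
    and F: "jet F" "jet_bound 4 D F" "\<And>n. jet_bound 4 D (\<lambda>bs. approx n (F bs))"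
  shows "\<bar>approx n (F []) t x - approx (n * m) (F []) t x\<bar> \<le> (rate_const * D * total 0 T + 2 * mod_const * D) * \<delta> powr (1/2)"
proof -
  let ?N = "n * m"
  obtain k where k: "k < n" "grid n k \<le> t" "t \<le> grid n (Suc k)" using grid_cell[OF n t] by blast
  have D: "0 \<le> D" using jet_bound_nonneg[OF F(2)] .
  have N: "0 < ?N" using n m by simp
  have b2: "jet_bound 2 D F" "\<And>n. jet_bound 2 D (\<lambda>bs. approx n (F bs))"
    using jet_bound_mono[OF F(2), of D 2] jet_bound_mono[OF F(3), of D 2] by auto
  have g: "grid ?N (k * m) = grid n k" "grid ?N (Suc k * m) = grid n (Suc k)" by (rule grid_refine[OF m])+
  have \<beta>: "mod_const * D * total (grid n k) (grid n (Suc k)) \<le> mod_const * D * \<delta> powr (1/2)"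
    using sqrt_bounds(1)[OF total_nonneg \<delta>(1)[OF k(1)] \<delta>(2)] mod_const_nonneg D by (intro mult_left_mono) simp_all
  have 1: "\<bar>approx n (F []) t x - approx n (F []) (grid n k) x\<bar> \<le> mod_const * D * total (grid n k) (grid n (Suc k))"
    by (rule approx_modulus_cell[OF n k F(1) b2])
  have "\<bar>approx ?N (F []) t x - approx ?N (F []) (grid ?N (k * m)) x\<bar> \<le> mod_const * D * total (grid ?N (k * m)) (grid ?N (Suc k * m))"
  proof (rule approx_modulus[OF N _ _ _ _ F(1) b2])
    show "k * m < Suc k * m" using m by simp
    show "Suc k * m \<le> ?N" using k(1) by (intro mult_le_mono1) simp
  qed (unfold g, use k in auto)
  then have 2: "\<bar>approx ?N (F []) t x - approx ?N (F []) (grid n k) x\<bar> \<le> mod_const * D * total (grid n k) (grid n (Suc k))"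
    unfolding g .
  have 3: "\<bar>approx n (F []) (grid n k) x - approx ?N (F []) (grid n k) x\<bar> \<le> rate_const * D * \<delta> powr (1/2) * total 0 T"
    by (rule approx_compare_grid[OF n m _ \<delta> F]) (use k in auto)
  have arith: "\<bar>a - b\<bar> \<le> r" if "\<bar>a - a'\<bar> \<le> e" "\<bar>b - b'\<bar> \<le> e" "\<bar>a' - b'\<bar> \<le> d" "e \<le> e'" "r = d + 2 * e'" for a a' b b' e e' d r :: real
    using that by linarith
  show ?thesis by (rule arith[OF 1 2 3 \<beta>]) (simp add: algebra_simps)
qed

lemma approx_equation_defect:
  assumes n: "0 < n" and t: "0 \<le> t" "t \<le> T"
    and \<delta>: "\<And>k. k < n \<Longrightarrow> total (grid n k) (grid n (Suc k)) \<le> \<delta>" "\<delta> \<le> 1"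
    and F: "jet F" "jet_bound 4 D F" "\<And>n. jet_bound 4 D (\<lambda>bs. approx n (F bs))"
  shows "\<bar>approx n (F []) t x - increment AB (approx n) F 0 t x\<bar> \<le> (defect_const * D * total 0 T + mod_const * D + D) * \<delta> powr (1/2)"
proof -
  obtain k where k: "k < n" "grid n k \<le> t" "t \<le> grid n (Suc k)" using grid_cell[OF n t] by blast
  have D: "0 \<le> D" using jet_bound_nonneg[OF F(2)] .
  have dc: "0 \<le> defect_const" using mod_const_nonneg by (simp add: defect_const_def)
  have b2: "jet_bound 2 D F" "\<And>n. jet_bound 2 D (\<lambda>bs. approx n (F bs))"
    using jet_bound_mono[OF F(2), of D 2] jet_bound_mono[OF F(3), of D 2] by auto
  have s: "total (grid n k) (grid n (Suc k)) \<le> \<delta> powr (1/2)"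
    by (rule sqrt_bounds(1)[OF total_nonneg \<delta>(1)[OF k(1)] \<delta>(2)])
  have "\<bar>approx n (F []) t x - approx n (F []) (grid n k) x\<bar> \<le> mod_const * D * total (grid n k) (grid n (Suc k))"
    by (rule approx_modulus_cell[OF n k F(1) b2])
  also have "\<dots> \<le> mod_const * D * \<delta> powr (1/2)"
    using s mod_const_nonneg D by (intro mult_left_mono) simp_all
  finally have 1: "\<bar>approx n (F []) t x - approx n (F []) (grid n k) x\<bar> \<le> mod_const * D * \<delta> powr (1/2)" .
  have "\<bar>approx n (F []) (grid n k) x - approx n (F []) (grid n 0) x - increment AB (approx n) F (grid n 0) (grid n k) x\<bar>
      \<le> defect_const * D * \<delta> powr (1/2) * total (grid n 0) (grid n k)"
    by (rule approx_defect[OF n _ _ \<delta> F]) (use k in auto)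
  also have "\<dots> \<le> defect_const * D * \<delta> powr (1/2) * total 0 T"
  proof (rule mult_left_mono)
    show "total (grid n 0) (grid n k) \<le> total 0 T"
      by (rule total_mono) (use grid_nonneg[of n k] grid_le_T[OF n, of k] k in auto)
  qed (use dc D in simp)
  finally have 2: "\<bar>approx n (F []) (grid n k) x - increment AB (approx n) F 0 (grid n k) x\<bar> \<le> defect_const * D * \<delta> powr (1/2) * total 0 T"
    using approx_0[OF n F(1), of x] by simp
  have "\<bar>increment AB (approx n) F (grid n k) t x\<bar> \<le> D * total (grid n k) t"
    by (rule increment_bound(2)[where S = "approx n" and F = F]) (use F b2 approx_admissible grid_nonneg t in auto)
  also have "\<dots> \<le> D * \<delta> powr (1/2)"
  proof (rule mult_left_mono[OF _ D])
    have "total (grid n k) t \<le> total (grid n k) (grid n (Suc k))"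
      by (rule total_mono) (use k n grid_nonneg grid_le_T in auto)
    then show "total (grid n k) t \<le> \<delta> powr (1/2)" using s by simp
  qed
  finally have 3: "\<bar>increment AB (approx n) F (grid n k) t x\<bar> \<le> D * \<delta> powr (1/2)" .
  have 4: "increment AB (approx n) F 0 t x = increment AB (approx n) F 0 (grid n k) x + increment AB (approx n) F (grid n k) t x"
    by (rule increment_split[OF AB approx_admissible F(1)]) (use k t grid_nonneg in auto)
  have arith: "\<bar>a - i\<bar> \<le> r" if "i = i1 + i2" "\<bar>a - b\<bar> \<le> e1" "\<bar>b - i1\<bar> \<le> e2" "\<bar>i2\<bar> \<le> e3" "r = e1 + e2 + e3" for a b i i1 i2 e1 e2 e3 r :: real
    using that by linarith
  show ?thesis by (rule arith[OF 4 1 2 3]) (simp add: algebra_simps)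
qed

lemma jet_bounds_uniform:
  assumes "jet F" shows "\<exists>D. jet_bound 4 D F \<and> (\<forall>n. jet_bound 4 D (\<lambda>bs. approx n (F bs)))"
proof -
  obtain C where C: "jet_bound 4 C F" using jet_has_bound[OF assms] by blast
  have c: "0 \<le> C" "0 \<le> T * C" using jet_bound_nonneg[OF C] T by auto
  have "jet_bound 4 (C + T * C) F" by (rule jet_bound_mono[OF C]) (use c in auto)
  moreover have "jet_bound 4 (C + T * C) (\<lambda>bs. approx n (F bs))" for n
    by (rule jet_bound_mono[OF admissible_jet_bound[OF approx_admissible assms C]]) (use c T in auto)
  ultimately show ?thesis by blast
qed

lemma dyadic_fine:
  assumes "0 < \<delta>"
  shows "\<exists>i0. \<forall>i\<ge>i0. \<forall>k<2^i. total (grid (2^i) k) (grid (2^i) (Suc k)) \<le> \<delta>"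
proof -
  obtain N where N: "\<forall>n\<ge>N. \<forall>k<n. (LINT s:{T * real k / real n<..<T * real (Suc k) / real n}|lborel. weight s) \<le> \<delta>"
    using fine_grid[OF less_imp_le[OF T] weight_integrable[OF order_refl order_refl] assms] by blast
  have "N \<le> 2^i" if "N \<le> i" for i by (rule order_trans[OF that less_imp_le[OF less_exp]])
  then show ?thesis using N unfolding total_def grid_def by blast
qed

text \<open>The form in which the rate \<open>\<delta>^(1/2)\<close> is used for passing to the limit.\<close>

lemma small_delta:
  assumes "0 < e" shows "\<exists>\<delta>>0. \<delta> \<le> 1 \<and> K * \<delta> powr (1/2) < (e :: real)"
proof -
  have "((\<lambda>\<delta>. K * \<delta> powr (1/2)) \<longlongrightarrow> K * 0 powr (1/2)) (at_right 0)"
    by (intro tendsto_intros) (auto intro!: eventually_at_right_less[THEN eventually_mono])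
  then have "eventually (\<lambda>\<delta>. K * \<delta> powr (1/2) < e) (at_right 0)"
    using assms by (intro order_tendstoD(2)) auto
  moreover have "eventually (\<lambda>\<delta>::real. \<delta> < 1) (at_right 0)" by (rule eventually_at_right_real[THEN eventually_mono]) auto
  ultimately have "eventually (\<lambda>\<delta>. 0 < \<delta> \<and> \<delta> \<le> 1 \<and> K * \<delta> powr (1/2) < e) (at_right (0 :: real))"
    using eventually_at_right_less[of "0 :: real"] by eventually_elim auto
  then show ?thesis using eventually_happens by force
qed

lemma approx_Cauchy:
  assumes F: "jet F" shows "Cauchy (\<lambda>i. approx (2^i) (F []) t x)"
proof (cases "t \<in> {0..T}")
  case False
  then show ?thesis using admissible_outside[OF approx_admissible smoothI[OF F]] by (simp add: Cauchy_def)
next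
  case True
  obtain D where D: "jet_bound 4 D F" "\<And>n. jet_bound 4 D (\<lambda>bs. approx n (F bs))" using jet_bounds_uniform[OF F] by blast
  show ?thesis unfolding Cauchy_altdef2
  proof (intro allI impI)
    fix e :: real assume "0 < e"
    then obtain \<delta> where \<delta>: "0 < \<delta>" "\<delta> \<le> 1" "(rate_const * D * total 0 T + 2 * mod_const * D) * \<delta> powr (1/2) < e"
      using small_delta by blast
    obtain i0 where i0: "\<forall>i\<ge>i0. \<forall>k<2^i. total (grid (2^i) k) (grid (2^i) (Suc k)) \<le> \<delta>" using dyadic_fine[OF \<delta>(1)] by blast
    have "dist (approx (2^i) (F []) t x) (approx (2^i0) (F []) t x) < e" if "i0 \<le> i" for i
    proof -
      have "\<bar>approx (2^i0) (F []) t x - approx (2^i0 * 2^(i - i0)) (F []) t x\<bar> \<le> (rate_const * D * total 0 T + 2 * mod_const * D) * \<delta> powr (1/2)"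
        by (rule approx_compare[OF _ _ _ _ _ \<delta>(2) F D]) (use i0 True in auto)
      then show ?thesis using \<delta>(3) that by (simp add: dist_real_def abs_minus_commute flip: power_add)
    qed
    then show "\<exists>N. \<forall>n\<ge>N. dist (approx (2^n) (F []) t x) (approx (2^N) (F []) t x) < e" by blast
  qed
qed

text \<open>Dyadic grids refine each other, so that \<open>approx_compare\<close> makes the sequence Cauchy at every point.\<close>

definition solution :: "(real \<Rightarrow> 'a \<Rightarrow> real) \<Rightarrow> (real \<Rightarrow> 'a \<Rightarrow> real)" where
  "solution f t x = lim (\<lambda>i. approx (2^i) f t x)"

lemma approx_tendsto: "smooth f \<Longrightarrow> (\<lambda>i. approx (2^i) f t x) \<longlonglongrightarrow> solution f t x"
  unfolding solution_def smooth_def using approx_Cauchy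
  by (auto simp: Cauchy_convergent_iff convergent_LIMSEQ_iff)

lemma solution_admissible: "admissible T solution"
  unfolding admissible_def
proof (intro conjI allI impI)
  fix f g :: "real \<Rightarrow> 'a \<Rightarrow> real" and k assume fg: "smooth f" "smooth g"
  have "solution (\<lambda>t x. f t x + k * g t x) t x = solution f t x + k * solution g t x" for t x
  proof (rule LIMSEQ_unique[OF approx_tendsto[OF smooth_lincomb[OF fg]]])
    show "(\<lambda>i. approx (2^i) (\<lambda>t x. f t x + k * g t x) t x) \<longlonglongrightarrow> solution f t x + k * solution g t x"
      unfolding admissible_linear[OF approx_admissible fg] by (intro tendsto_intros approx_tendsto fg)
  qed
  then show "solution (\<lambda>t x. f t x + k * g t x) = (\<lambda>t x. solution f t x + k * solution g t x)" by blast
next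
  fix f :: "real \<Rightarrow> 'a \<Rightarrow> real" and h assume f: "smooth f"
  show "solution (\<lambda>t x. f t (x + h)) = (\<lambda>t x. solution f t (x + h))"
    unfolding solution_def admissible_translate[OF approx_admissible f] by simp
next
  fix f :: "real \<Rightarrow> 'a \<Rightarrow> real" and C t x assume f: "smooth f" and C: "\<forall>t x. \<bar>f t x\<bar> \<le> C"
  have "\<bar>approx (2^i) f t x\<bar> \<le> T * C" for i
    by (rule admissible_bound[OF approx_admissible f]) (use C in blast)
  then show "\<bar>solution f t x\<bar> \<le> T * C"
    by (intro LIMSEQ_le_const2[OF tendsto_rabs[OF approx_tendsto[OF f]]]) auto
next
  fix f :: "real \<Rightarrow> 'a \<Rightarrow> real" assume f: "smooth f"
  show "(\<lambda>z. solution f (fst z) (snd z)) \<in> borel_measurable borel"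
    by (rule borel_measurable_LIMSEQ_real[OF approx_tendsto[OF f] admissible_measurable[OF approx_admissible f]])
next
  fix f g :: "real \<Rightarrow> 'a \<Rightarrow> real" and \<tau> t assume fg: "smooth f" "smooth g" "\<forall>s<\<tau>. f s = g s" "t \<le> \<tau>"
  have "approx (2^i) f t = approx (2^i) g t" for i
    by (rule admissible_causal[OF approx_admissible fg(1,2) _ fg(4)]) (use fg in blast)
  then show "solution f t = solution g t" unfolding solution_def by auto
next
  fix f :: "real \<Rightarrow> 'a \<Rightarrow> real" and t assume "smooth f" "t \<notin> {0..T}"
  then show "solution f t = (\<lambda>x. 0)" unfolding solution_def using admissible_outside[OF approx_admissible] by auto
qed

lemma increment_tendsto:
  assumes F: "jet F" and t: "0 \<le> t" "t \<le> T"
  shows "(\<lambda>i. increment AB (approx (2^i)) F 0 t x) \<longlonglongrightarrow> increment AB solution F 0 t x"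
proof -
  obtain D where D: "jet_bound 4 D F" "\<And>n. jet_bound 4 D (\<lambda>bs. approx n (F bs))" using jet_bounds_uniform[OF F] by blast
  have b2: "jet_bound 2 D F" "\<And>n. jet_bound 2 D (\<lambda>bs. approx n (F bs))"
    using jet_bound_mono[OF D(1), of D 2] jet_bound_mono[OF D(2), of D 2] by auto
  let ?i = "\<lambda>S s. contract (AB s) (\<lambda>b c. S (F [b, c]) s x) + F [] s x"
  have m: "(\<lambda>s. indicator {0<..<t} s *\<^sub>R ?i S s) \<in> borel_measurable lborel" if "admissible T S" for S
    using increment_integrable[OF AB that F order_refl t(2), of x] unfolding set_integrable_def by (rule borel_measurable_integrable)
  show ?thesis
    unfolding increment_def set_lebesgue_integral_def
  proof (rule integral_dominated_convergence[where w = "\<lambda>s. D * (indicator {0<..<t} s *\<^sub>R weight s)"])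
    show "(\<lambda>s. indicator {0<..<t} s *\<^sub>R ?i solution s) \<in> borel_measurable lborel"
      by (rule m[OF solution_admissible])
    show "(\<lambda>s. indicator {0<..<t} s *\<^sub>R ?i (approx (2^i)) s) \<in> borel_measurable lborel" for i
      by (rule m[OF approx_admissible])
    show "integrable lborel (\<lambda>s. D * (indicator {0<..<t} s *\<^sub>R weight s))"
      using weight_integrable[OF order_refl t(2)] unfolding set_integrable_def by (rule integrable_mult_right)
    show "AE s in lborel. (\<lambda>i. indicator {0<..<t} s *\<^sub>R ?i (approx (2^i)) s) \<longlonglongrightarrow> indicator {0<..<t} s *\<^sub>R ?i solution s"
      unfolding contract_def by (intro AE_I2 tendsto_intros approx_tendsto smoothI[OF F])
    show "AE s in lborel. norm (indicator {0<..<t} s *\<^sub>R ?i (approx (2^i)) s) \<le> D * (indicator {0<..<t} s *\<^sub>R weight s)" for i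
      using integrand_bound(2)[OF b2] by (intro AE_I2) (simp add: indicator_def)
  qed
qed

lemma solution_equation:
  assumes F: "jet F" and t: "0 \<le> t" "t \<le> T"
  shows "solution (F []) t x = increment AB solution F 0 t x"
proof -
  obtain D where D: "jet_bound 4 D F" "\<And>n. jet_bound 4 D (\<lambda>bs. approx n (F bs))" using jet_bounds_uniform[OF F] by blast
  let ?d = "\<lambda>i. approx (2^i) (F []) t x - increment AB (approx (2^i)) F 0 t x"
  have "?d \<longlonglongrightarrow> 0"
  proof (rule LIMSEQ_I)
    fix e :: real assume "0 < e"
    then obtain \<delta> where \<delta>: "0 < \<delta>" "\<delta> \<le> 1" "(defect_const * D * total 0 T + mod_const * D + D) * \<delta> powr (1/2) < e"
      using small_delta by blast
    obtain i0 where i0: "\<forall>i\<ge>i0. \<forall>k<2^i. total (grid (2^i) k) (grid (2^i) (Suc k)) \<le> \<delta>" using dyadic_fine[OF \<delta>(1)] by blast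
    have "norm (?d i - 0) < e" if "i0 \<le> i" for i
    proof -
      have "\<bar>?d i\<bar> \<le> (defect_const * D * total 0 T + mod_const * D + D) * \<delta> powr (1/2)"
        by (rule approx_equation_defect[OF _ t _ \<delta>(2) F D]) (use i0 that in auto)
      then show ?thesis using \<delta>(3) by simp
    qed
    then show "\<exists>N. \<forall>n\<ge>N. norm (?d n - 0) < e" by blast
  qed
  moreover have "?d \<longlonglongrightarrow> solution (F []) t x - increment AB solution F 0 t x"
    by (intro tendsto_diff approx_tendsto smoothI[OF F] increment_tendsto[OF F t])
  ultimately show ?thesis using LIMSEQ_unique by fastforce
qed

lemma solution_solves: "solves T AB solution"
  unfolding solves_def
proof (intro allI impI conjI)
  fix F :: "'a list \<Rightarrow> real \<Rightarrow> 'a \<Rightarrow> real" and x assume F: "jet F"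
  show "solution (F []) 0 x = 0"
    using solution_equation[OF F order_refl less_imp_le[OF T]] by (simp add: increment_def set_lebesgue_integral_def)
  fix r t assume rt: "0 \<le> r" "r \<le> t" "t \<le> T"
  show "solution (F []) t x = solution (F []) r x + increment AB solution F r t x"
    using solution_equation[OF F, of t x] solution_equation[OF F, of r x]
      increment_split[OF AB solution_admissible F order_refl rt, of x] rt by simp
qed

end

text \<open>The evolutions that arise from \<open>S0\<close> by finitely many jumps. Whatever is preserved by a single jump
  holds for all of them.\<close>

inductive kicked :: "((real \<Rightarrow> 'a::euclidean_space \<Rightarrow> real) \<Rightarrow> (real \<Rightarrow> 'a \<Rightarrow> real)) \<Rightarrow>
    ((real \<Rightarrow> 'a \<Rightarrow> real) \<Rightarrow> (real \<Rightarrow> 'a \<Rightarrow> real)) \<Rightarrow> bool" for S0 where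
  base: "kicked S0 S0"
| kick: "kicked S0 S \<Longrightarrow> kicked S0 (jump \<tau> v S)"

lemma kicked_scheme: "kicked S0 (scheme \<tau> v S0 m)"
  by (induction m) (auto intro: kicked.intros)

text \<open>The form in which the construction is used: the coefficients \<open>B\<close> can be added to an equation, and
  the new solution operator is a pointwise limit of kicked versions of the old one.\<close>

theorem perturbed_solution_operator:
  fixes A B :: "real \<Rightarrow> 'a::euclidean_space \<Rightarrow> 'a \<Rightarrow> real"
  assumes "0 < T" "admissible T S0" "solves T A S0" "integrable_coeff T A" "integrable_coeff T B"
    and "\<And>s. 0 < s \<Longrightarrow> s < T \<Longrightarrow> psd (A s)" "\<And>s. 0 < s \<Longrightarrow> s < T \<Longrightarrow> psd (B s)"
  obtains S Sn where "admissible T S" "solves T (\<lambda>s b c. A s b c + B s b c) S"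
    "\<And>n :: nat. kicked S0 (Sn n)" "\<And>f t x. smooth f \<Longrightarrow> (\<lambda>n. Sn n f t x) \<longlonglongrightarrow> S f t x"
proof -
  interpret kicked_evolution T A B S0
    using assms by unfold_locales auto
  have "AB = (\<lambda>s b c. A s b c + B s b c)" by (intro ext) (simp add: AB_def)
  then have "solves T (\<lambda>s b c. A s b c + B s b c) solution" using solution_solves by simp
  moreover have "kicked S0 (approx (2^n))" for n unfolding approx_def by (rule kicked_scheme)
  ultimately show ?thesis using that[of solution "\<lambda>n. approx (2^n)"] solution_admissible approx_tendsto by blast
qed


section \<open>The evolution without diffusion\<close>

definition pure_source :: "real \<Rightarrow> (real \<Rightarrow> 'a::euclidean_space \<Rightarrow> real) \<Rightarrow> (real \<Rightarrow> 'a \<Rightarrow> real)" where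
  "pure_source T f t x = (if t \<in> {0..T} then LINT s:{0<..<t}|lborel. f s x else 0)"

lemma smooth_time_integrable:
  assumes "smooth f" shows "set_integrable lborel {r<..<t} (\<lambda>s. f s x)"
  using assms jet_time_integrable[of _ r t "[]" x] unfolding smooth_def by blast

lemma smooth_measurable:
  assumes "smooth f" shows "(\<lambda>z. f (fst z) (snd z)) \<in> borel_measurable borel"
  using assms jet_measurable[of _ "[]"] unfolding smooth_def by blast

lemma pure_source_measurable:
  fixes f :: "real \<Rightarrow> 'a::euclidean_space \<Rightarrow> real"
  assumes f: "smooth f"
  shows "(\<lambda>z. pure_source T f (fst z) (snd z)) \<in> borel_measurable borel"
proof -
  have m: "(\<lambda>z. f (fst z) (snd z)) \<in> borel_measurable (borel \<Otimes>\<^sub>M borel)"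
    using smooth_measurable[OF f] by (simp add: borel_prod)
  have "(\<lambda>w :: (real \<times> 'a) \<times> real. f (snd w) (snd (fst w))) \<in> borel_measurable (borel \<Otimes>\<^sub>M lborel)"
    unfolding borel_prod[symmetric]
    by (rule measurable_compose[OF _ m, of "\<lambda>w. (snd w, snd (fst w))", simplified]) measurable
  moreover have "{w :: (real \<times> 'a) \<times> real. 0 < snd w \<and> snd w < fst (fst w)} \<in> sets (borel \<Otimes>\<^sub>M lborel)"
  proof -
    have "open {w :: (real \<times> 'a) \<times> real. 0 < snd w \<and> snd w < fst (fst w)}"
      by (intro open_Collect_conj open_Collect_less continuous_intros)
    moreover have "sets (borel \<Otimes>\<^sub>M lborel :: ((real \<times> 'a) \<times> real) measure) = sets (borel \<Otimes>\<^sub>M borel)"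
      by (intro sets_pair_measure_cong) auto
    ultimately show ?thesis unfolding borel_prod by (simp only: borel_open)
  qed
  ultimately have "(\<lambda>w :: (real \<times> 'a) \<times> real. indicator {w. 0 < snd w \<and> snd w < fst (fst w)} w *\<^sub>R f (snd w) (snd (fst w)))
      \<in> borel_measurable (borel \<Otimes>\<^sub>M lborel)"
    by (intro borel_measurable_scaleR borel_measurable_indicator)
  then have "(\<lambda>(z :: real \<times> 'a, s). indicator {0<..<fst z} s *\<^sub>R f s (snd z)) \<in> borel_measurable (borel \<Otimes>\<^sub>M lborel)"
    by (rule measurable_cong[THEN iffD1, rotated]) (auto simp: indicator_def split: prod.splits)
  then have "(\<lambda>z :: real \<times> 'a. LINT s|lborel. indicator {0<..<fst z} s *\<^sub>R f s (snd z)) \<in> borel_measurable borel"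
    by (rule lborel.borel_measurable_lebesgue_integral)
  moreover have "{z :: real \<times> 'a. fst z \<in> {0..T}} \<in> sets borel"
  proof -
    have "closed {z :: real \<times> 'a. 0 \<le> fst z \<and> fst z \<le> T}"
      by (intro closed_Collect_conj closed_Collect_le continuous_intros)
    then show ?thesis by (simp add: borel_closed)
  qed
  ultimately show ?thesis
    unfolding pure_source_def set_lebesgue_integral_def
    by (intro measurable_If) auto
qed

lemma pure_source_admissible: "0 < T \<Longrightarrow> admissible T (pure_source T)"
  unfolding admissible_def
proof (intro conjI allI impI)
  fix f g :: "real \<Rightarrow> 'a \<Rightarrow> real" and k assume fg: "smooth f" "smooth g"
  have "set_integrable lborel {0<..<t} (\<lambda>s. k * g s x)" for t x
    using smooth_time_integrable[OF fg(2)] by simp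
  then show "pure_source T (\<lambda>t x. f t x + k * g t x) = (\<lambda>t x. pure_source T f t x + k * pure_source T g t x)"
    unfolding pure_source_def by (intro ext) (simp add: set_integral_add(2)[OF smooth_time_integrable[OF fg(1)]])
next
  fix f :: "real \<Rightarrow> 'a \<Rightarrow> real" and C t x assume T: "0 < T" and f: "smooth f" and C: "\<forall>t x. \<bar>f t x\<bar> \<le> C"
  have C0: "0 \<le> C" using C[rule_format, of 0 0] by linarith
  show "\<bar>pure_source T f t x\<bar> \<le> T * C"
  proof (cases "t \<in> {0..T}")
    case True
    have "\<bar>LINT s:{0<..<t}|lborel. f s x\<bar> \<le> (LINT s:{0<..<t}|lborel. C)"
      by (rule time_integral_bound[OF smooth_time_integrable[OF f]])
        (use C C0 in \<open>auto intro!: set_integrable_bounded\<close>)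
    also have "\<dots> = t * C" using True by (simp add: set_lebesgue_integral_def)
    also have "\<dots> \<le> T * C" using True C0 by (intro mult_right_mono) auto
    finally show ?thesis using True by (simp add: pure_source_def)
  next
    case False
    then show ?thesis using T C0 by (auto simp: pure_source_def)
  qed
next
  fix f g :: "real \<Rightarrow> 'a \<Rightarrow> real" and \<tau> t assume fg: "\<forall>s<\<tau>. f s = g s" "t \<le> \<tau>"
  have "(LINT s:{0<..<t}|lborel. f s x) = (LINT s:{0<..<t}|lborel. g s x)" for x
    by (rule set_lebesgue_integral_cong) (use fg in auto)
  then show "pure_source T f t = pure_source T g t" by (auto simp: pure_source_def)
next
  fix f :: "real \<Rightarrow> 'a \<Rightarrow> real" assume "smooth f"
  then show "(\<lambda>z. pure_source T f (fst z) (snd z)) \<in> borel_measurable borel" by (rule pure_source_measurable)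
qed (auto simp: pure_source_def intro!: ext)

lemma pure_source_solves: "0 < T \<Longrightarrow> solves T (\<lambda>s b c. 0) (pure_source T)"
  unfolding solves_def
proof (intro allI impI conjI)
  fix F :: "'a list \<Rightarrow> real \<Rightarrow> 'a \<Rightarrow> real" and x assume F: "jet F"
  show "pure_source T (F []) 0 x = 0" by (simp add: pure_source_def set_lebesgue_integral_def)
  fix r t assume rt: "0 \<le> r" "r \<le> t" "t \<le> T"
  show "pure_source T (F []) t x = pure_source T (F []) r x + increment (\<lambda>s b c. 0) (pure_source T) F r t x"
    using time_integral_split[OF rt(1,2) jet_time_integrable[OF F]] rt
    by (simp add: pure_source_def increment_def contract_def)
qed

section \<open>Estimates inherited by averaging\<close>

definition bounded_support :: "(real \<Rightarrow> 'a::euclidean_space \<Rightarrow> real) \<Rightarrow> bool" where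
  "bounded_support f \<longleftrightarrow> (\<exists>R. \<forall>t x. R < norm x \<longrightarrow> f t x = 0)"

text \<open>A bound for the Hoelder seminorms of \<open>g t\<close> on all lines parallel to \<open>l\<close>. A real bound \<open>c\<close> in place of a
  supremum makes the property visibly stable under averages and limits.\<close>

definition line_holder :: "real \<Rightarrow> 'a::euclidean_space \<Rightarrow> real \<Rightarrow> (real \<Rightarrow> 'a \<Rightarrow> real) \<Rightarrow> bool" where
  "line_holder \<alpha> l c g \<longleftrightarrow> (\<forall>t x \<mu> \<nu>. \<bar>g t (x + \<mu> *\<^sub>R l) - g t (x + \<nu> *\<^sub>R l)\<bar> \<le> c * \<bar>\<mu> - \<nu>\<bar> powr \<alpha>)"

text \<open>\<open>D\<^sub>l\<^sup>2 u\<close> for \<open>u = S (F [])\<close>; by \<open>admissible_jet\<close> the derivatives of \<open>u\<close> are the solutions for the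
  differentiated data.\<close>

definition line_hessian ::
    "'a::euclidean_space \<Rightarrow> ((real \<Rightarrow> 'a \<Rightarrow> real) \<Rightarrow> (real \<Rightarrow> 'a \<Rightarrow> real)) \<Rightarrow> ('a list \<Rightarrow> real \<Rightarrow> 'a \<Rightarrow> real) \<Rightarrow> real \<Rightarrow> 'a \<Rightarrow> real" where
  "line_hessian l S F t x = quad (\<lambda>b c. S (F [b, c]) t x) l"

text \<open>The two estimates as properties of a solution operator. They are required for all data of bounded
  support, because a jump replaces the data by shifted ones.\<close>

definition holder_estimate ::
    "real \<Rightarrow> 'a::euclidean_space \<Rightarrow> real \<Rightarrow> ((real \<Rightarrow> 'a \<Rightarrow> real) \<Rightarrow> (real \<Rightarrow> 'a \<Rightarrow> real)) \<Rightarrow> bool" where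
  "holder_estimate \<alpha> l N S \<longleftrightarrow> (\<forall>F c. jet F \<longrightarrow> bounded_support (F []) \<longrightarrow> 0 \<le> c \<longrightarrow> line_holder \<alpha> l c (F []) \<longrightarrow>
     line_holder \<alpha> l (N * c) (line_hessian l S F))"

definition Lp_estimate ::
    "real \<Rightarrow> real \<Rightarrow> 'a::euclidean_space \<Rightarrow> ennreal \<Rightarrow> ((real \<Rightarrow> 'a \<Rightarrow> real) \<Rightarrow> (real \<Rightarrow> 'a \<Rightarrow> real)) \<Rightarrow> bool" where
  "Lp_estimate T p l N S \<longleftrightarrow> (\<forall>F. jet F \<longrightarrow> bounded_support (F []) \<longrightarrow>
     Lp_norm_pow T p (line_hessian l S F) \<le> N * Lp_norm_pow T p (F []))"

lemma admissible_kicked: "kicked S0 S \<Longrightarrow> admissible T S0 \<Longrightarrow> admissible T S"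
  by (induction rule: kicked.induct) (auto intro: admissible_jump)

lemma line_hessian_tendsto:
  assumes "jet F" "\<And>f t x. smooth f \<Longrightarrow> (\<lambda>n. Sn n f t x) \<longlonglongrightarrow> S f t x"
  shows "(\<lambda>n. line_hessian l (Sn n) F t x) \<longlonglongrightarrow> line_hessian l S F t x"
  unfolding line_hessian_def quad_def contract_def by (intro tendsto_intros assms(2) smoothI[OF assms(1)])

definition kicked_jet ::
    "real \<Rightarrow> 'a::euclidean_space \<Rightarrow> ('a list \<Rightarrow> real \<Rightarrow> 'a \<Rightarrow> real) \<Rightarrow> ('a list \<Rightarrow> real \<Rightarrow> 'a \<Rightarrow> real)" where
  "kicked_jet \<tau> w F bs s y = F bs s (y + kick \<tau> (- w) s)"

lemma kicked_jet: "jet F \<Longrightarrow> jet (kicked_jet \<tau> w F)"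
  unfolding kicked_jet_def by (rule jet_shift) measurable

lemma line_hessian_jump:
  fixes F :: "'a::euclidean_space list \<Rightarrow> real \<Rightarrow> 'a \<Rightarrow> real"
  shows "line_hessian l (jump \<tau> v S) F t x
    = (\<Sum>j\<in>signs. line_hessian l S (kicked_jet \<tau> (walk_step v j) F) t (x + kick \<tau> (walk_step v j) t)) / (2 * DIM('a))"
  unfolding line_hessian_def jump_def kicked_jet_def quad_def quad_def
  using contract_scale_right[of "outer l" "1 / (2 * DIM('a))"]
  by (simp add: contract_sum_right)

lemma bounded_support_kicked:
  assumes "bounded_support (F [])" shows "bounded_support (kicked_jet \<tau> w F [])"
proof -
  obtain R where R: "\<And>t x. R < norm x \<Longrightarrow> F [] t x = 0" using assms unfolding bounded_support_def by blast
  have "kicked_jet \<tau> w F [] t x = 0" if "R + norm w < norm x" for t x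
  proof -
    have "norm x - norm w \<le> norm (x + kick \<tau> (- w) t)"
      using norm_triangle_ineq2[of x w] by (auto simp: kick_def)
    then show ?thesis unfolding kicked_jet_def using that by (intro R) simp
  qed
  then show ?thesis unfolding bounded_support_def by blast
qed

lemma line_holder_shift:
  assumes "line_holder \<alpha> l c g" shows "line_holder \<alpha> l c (\<lambda>t x. g t (x + y t))"
  unfolding line_holder_def
proof (intro allI)
  fix t x \<mu> \<nu>
  show "\<bar>g t (x + \<mu> *\<^sub>R l + y t) - g t (x + \<nu> *\<^sub>R l + y t)\<bar> \<le> c * \<bar>\<mu> - \<nu>\<bar> powr \<alpha>"
    using assms[unfolded line_holder_def, rule_format, of t "x + y t" \<mu> \<nu>] by (simp add: add_ac)
qed

lemma holder_estimate_jump: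
  fixes S :: "(real \<Rightarrow> 'a::euclidean_space \<Rightarrow> real) \<Rightarrow> (real \<Rightarrow> 'a \<Rightarrow> real)"
  assumes S: "holder_estimate \<alpha> l N S"
  shows "holder_estimate \<alpha> l N (jump \<tau> v S)"
  unfolding holder_estimate_def
proof (intro allI impI)
  fix F :: "'a list \<Rightarrow> real \<Rightarrow> 'a \<Rightarrow> real" and c :: real
  assume F: "jet F" "bounded_support (F [])" "0 \<le> c" "line_holder \<alpha> l c (F [])"
  let ?w = "walk_step v"
  have "line_holder \<alpha> l c (kicked_jet \<tau> (?w j) F [])" for j
    unfolding kicked_jet_def by (rule line_holder_shift[OF F(4)])
  then have "line_holder \<alpha> l (N * c) (line_hessian l S (kicked_jet \<tau> (?w j) F))" for j
    using S F kicked_jet[OF F(1)] bounded_support_kicked[where F = F, OF F(2)] unfolding holder_estimate_def by blast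
  then have h: "line_holder \<alpha> l (N * c) (\<lambda>t x. line_hessian l S (kicked_jet \<tau> (?w j) F) t (x + kick \<tau> (?w j) t))" for j
    by (rule line_holder_shift)
  show "line_holder \<alpha> l (N * c) (line_hessian l (jump \<tau> v S) F)"
    unfolding line_holder_def line_hessian_jump diff_divide_distrib[symmetric] sum_subtractf[symmetric]
    by (intro allI average_mono) (use h in \<open>auto simp: line_holder_def\<close>)
qed

lemma holder_estimate_kicked: "kicked S0 S \<Longrightarrow> holder_estimate \<alpha> l N S0 \<Longrightarrow> holder_estimate \<alpha> l N S"
  by (induction rule: kicked.induct) (auto intro: holder_estimate_jump)

lemma holder_estimate_limit:
  assumes "\<And>n. holder_estimate \<alpha> l N (Sn n)" "\<And>f t x. smooth f \<Longrightarrow> (\<lambda>n. Sn n f t x) \<longlonglongrightarrow> S f t x"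
  shows "holder_estimate \<alpha> l N S"
  unfolding holder_estimate_def line_holder_def
proof (intro allI impI)
  fix F :: "'a list \<Rightarrow> real \<Rightarrow> 'a \<Rightarrow> real" and c t x \<mu> \<nu>
  assume F: "jet F" "bounded_support (F [])" "0 \<le> c" "\<forall>t x \<mu> \<nu>. \<bar>F [] t (x + \<mu> *\<^sub>R l) - F [] t (x + \<nu> *\<^sub>R l)\<bar> \<le> c * \<bar>\<mu> - \<nu>\<bar> powr \<alpha>"
  have "\<bar>line_hessian l (Sn n) F t (x + \<mu> *\<^sub>R l) - line_hessian l (Sn n) F t (x + \<nu> *\<^sub>R l)\<bar> \<le> N * c * \<bar>\<mu> - \<nu>\<bar> powr \<alpha>" for n
    using assms(1)[of n] F unfolding holder_estimate_def line_holder_def by blast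
  moreover have "(\<lambda>n. \<bar>line_hessian l (Sn n) F t (x + \<mu> *\<^sub>R l) - line_hessian l (Sn n) F t (x + \<nu> *\<^sub>R l)\<bar>)
      \<longlonglongrightarrow> \<bar>line_hessian l S F t (x + \<mu> *\<^sub>R l) - line_hessian l S F t (x + \<nu> *\<^sub>R l)\<bar>"
    by (intro tendsto_intros line_hessian_tendsto[OF F(1) assms(2)])
  ultimately show "\<bar>line_hessian l S F t (x + \<mu> *\<^sub>R l) - line_hessian l S F t (x + \<nu> *\<^sub>R l)\<bar> \<le> N * c * \<bar>\<mu> - \<nu>\<bar> powr \<alpha>"
    by (intro LIMSEQ_le_const2) auto
qed

lemma line_hessian_measurable:
  assumes "admissible T S" "jet F"
  shows "(\<lambda>z. line_hessian l S F (fst z) (snd z)) \<in> borel_measurable borel"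
  unfolding line_hessian_def quad_def contract_def
  by (intro borel_measurable_sum borel_measurable_times borel_measurable_const admissible_measurable[OF assms(1) smoothI[OF assms(2)]])

lemma Lp_norm_pow_iterated:
  fixes g :: "real \<Rightarrow> 'a::euclidean_space \<Rightarrow> real"
  assumes g: "(\<lambda>z. g (fst z) (snd z)) \<in> borel_measurable borel"
  shows "Lp_norm_pow T p g = (\<integral>\<^sup>+t. indicator {0<..<T} t * (\<integral>\<^sup>+x. ennreal (\<bar>g t x\<bar> powr p) \<partial>lborel) \<partial>lborel)"
proof -
  have m: "(\<lambda>z. ennreal (\<bar>g (fst z) (snd z)\<bar> powr p)) \<in> borel_measurable (borel :: (real \<times> 'a) measure)"
    using g by measurable
  have S: "{0<..<T} \<times> (UNIV :: 'a set) \<in> sets borel"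
    unfolding borel_prod[symmetric] by (rule pair_measureI) auto
  have "Lp_norm_pow T p g = (\<integral>\<^sup>+z. indicator ({0<..<T} \<times> UNIV) z * ennreal (\<bar>g (fst z) (snd z)\<bar> powr p) \<partial>(lborel \<Otimes>\<^sub>M lborel))"
    unfolding Lp_norm_pow_def lborel_prod by (simp add: mult.commute)
  also have "\<dots> = (\<integral>\<^sup>+t. \<integral>\<^sup>+x. indicator ({0<..<T} \<times> UNIV) (t, x) * ennreal (\<bar>g t x\<bar> powr p) \<partial>lborel \<partial>lborel)"
  proof (subst lborel.nn_integral_fst[symmetric])
    show "(\<lambda>z. indicator ({0<..<T} \<times> UNIV) z * ennreal (\<bar>g (fst z) (snd z)\<bar> powr p)) \<in> borel_measurable (lborel \<Otimes>\<^sub>M lborel :: (real \<times> 'a) measure)"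
      unfolding lborel_prod using m S by (intro borel_measurable_times_ennreal borel_measurable_indicator) auto
  qed simp
  also have "\<dots> = (\<integral>\<^sup>+t. indicator {0<..<T} t * (\<integral>\<^sup>+x. ennreal (\<bar>g t x\<bar> powr p) \<partial>lborel) \<partial>lborel)"
    by (intro nn_integral_cong) (simp add: indicator_def)
  finally show ?thesis .
qed

lemma nn_integral_lborel_shift:
  fixes h :: "'a::euclidean_space \<Rightarrow> ennreal"
  assumes "h \<in> borel_measurable borel"
  shows "(\<integral>\<^sup>+x. h (x + y) \<partial>lborel) = (\<integral>\<^sup>+x. h x \<partial>lborel)"
proof -
  have "(\<integral>\<^sup>+x. h x \<partial>lborel) = (\<integral>\<^sup>+x. h x \<partial>(distr lborel borel ((+) y)))"
    by (simp add: lborel_distr_plus)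
  also have "\<dots> = (\<integral>\<^sup>+x. h (y + x) \<partial>lborel)"
    using assms by (intro nn_integral_distr) auto
  finally show ?thesis by (simp add: add.commute)
qed

lemma shifted_measurable:
  fixes g :: "real \<Rightarrow> 'a::euclidean_space \<Rightarrow> real"
  assumes g: "(\<lambda>z. g (fst z) (snd z)) \<in> borel_measurable borel" and y: "y \<in> borel_measurable borel"
  shows "(\<lambda>z. g (fst z) (snd z + y (fst z))) \<in> borel_measurable borel"
proof -
  have "(\<lambda>z :: real \<times> 'a. (fst z, snd z + y (fst z))) \<in> borel_measurable borel"
    using measurable_compose[OF measurable_fst'' y] y
    by (intro borel_measurable_Pair borel_measurable_add) (auto simp: borel_prod[symmetric])
  from measurable_compose[OF this g] show ?thesis by simp
qed

lemma section_measurable: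
  fixes g :: "real \<Rightarrow> 'a::euclidean_space \<Rightarrow> real"
  assumes "(\<lambda>z. g (fst z) (snd z)) \<in> borel_measurable borel"
  shows "g t \<in> borel_measurable borel"
proof -
  have "(\<lambda>x :: 'a. (t, x)) \<in> borel_measurable borel" by (intro borel_measurable_continuous_onI continuous_intros)
  from measurable_compose[OF this assms] show ?thesis by simp
qed

text \<open>Translation invariance of Lebesgue measure, at each time separately.\<close>

lemma Lp_norm_pow_shift:
  fixes g :: "real \<Rightarrow> 'a::euclidean_space \<Rightarrow> real"
  assumes g: "(\<lambda>z. g (fst z) (snd z)) \<in> borel_measurable borel" and y: "y \<in> borel_measurable borel"
  shows "Lp_norm_pow T p (\<lambda>t x. g t (x + y t)) = Lp_norm_pow T p g"
proof -
  have "(\<lambda>x. ennreal (\<bar>g t x\<bar> powr p)) \<in> borel_measurable borel" for t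
    using section_measurable[OF g, of t] by measurable
  then show ?thesis
    unfolding Lp_norm_pow_iterated[OF g] Lp_norm_pow_iterated[OF shifted_measurable[OF g y]]
    using nn_integral_lborel_shift[of "\<lambda>x. ennreal (\<bar>g _ x\<bar> powr p)"] by (intro nn_integral_cong) simp
qed

text \<open>Convexity of the power function; the point \<open>0\<close> has to be added by hand to its convexity on the
  positive half-line.\<close>

lemma powr_average_le:
  fixes g :: "'a::euclidean_space \<times> real \<Rightarrow> real"
  assumes p: "1 < p"
  shows "\<bar>sum g signs / (2 * DIM('a))\<bar> powr p \<le> (\<Sum>j\<in>signs. \<bar>g j\<bar> powr p) / (2 * DIM('a))"
proof -
  let ?n = "2 * real DIM('a)"
  have n: "0 < ?n" by simp
  have conv: "convex_on {0..} (\<lambda>x. x powr p)"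
  proof (rule convex_onI)
    fix t x y :: real assume t: "0 < t" "t < 1" and xy: "x \<in> {0..}" "y \<in> {0..}"
    show "((1 - t) *\<^sub>R x + t *\<^sub>R y) powr p \<le> (1 - t) * x powr p + t * y powr p"
    proof (cases "x = 0 \<or> y = 0")
      case False
      then show ?thesis using convex_onD[OF powr_convex[of p], of t x y] t xy p by auto
    next
      case True
      have le: "s powr p \<le> s" if "0 < s" "s < 1" for s :: real
        using powr_mono'[of 1 p s] that p by simp
      show ?thesis
        using True xy le[OF t] le[of "1 - t"] t p
        by (auto simp: powr_mult intro!: mult_right_mono)
    qed
  qed simp
  have "(\<Sum>j\<in>signs. (1 / ?n) *\<^sub>R \<bar>g j\<bar>) powr p \<le> (\<Sum>j\<in>signs. (1 / ?n) * \<bar>g j\<bar> powr p)"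
    by (rule convex_on_sum[OF finite_signs _ conv]) (auto simp: card_signs signs_def)
  then have J: "(\<Sum>j\<in>signs. \<bar>g j\<bar> / ?n) powr p \<le> (\<Sum>j\<in>signs. \<bar>g j\<bar> powr p / ?n)" by simp
  have "\<bar>sum g signs / ?n\<bar> \<le> (\<Sum>j\<in>signs. \<bar>g j\<bar> / ?n)"
    unfolding sum_divide_distrib[symmetric] abs_divide using n by (simp add: divide_right_mono)
  then have "\<bar>sum g signs / ?n\<bar> powr p \<le> (\<Sum>j\<in>signs. \<bar>g j\<bar> / ?n) powr p"
    using p by (intro powr_mono2) auto
  then show ?thesis using J by (simp add: sum_divide_distrib)
qed

lemma Lp_norm_pow_average:
  fixes g :: "'a::euclidean_space \<times> real \<Rightarrow> real \<Rightarrow> 'a \<Rightarrow> real"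
  assumes p: "1 < p" and g: "\<And>j. (\<lambda>z. g j (fst z) (snd z)) \<in> borel_measurable borel"
    and K: "\<And>j. j \<in> signs \<Longrightarrow> Lp_norm_pow T p (g j) \<le> K"
  shows "Lp_norm_pow T p (\<lambda>t x. (\<Sum>j\<in>signs. g j t x) / (2 * DIM('a))) \<le> K"
proof -
  let ?n = "2 * real DIM('a)" and ?I = "indicator ({0<..<T} \<times> UNIV) :: real \<times> 'a \<Rightarrow> ennreal"
  have S: "{0<..<T} \<times> (UNIV :: 'a set) \<in> sets borel"
    unfolding borel_prod[symmetric] by (rule pair_measureI) auto
  have m: "(\<lambda>z. ennreal (\<bar>g j (fst z) (snd z)\<bar> powr p) * ?I z) \<in> borel_measurable lborel" for j
    using g[of j] S by (intro borel_measurable_times_ennreal borel_measurable_indicator) (auto intro: measurable_compose)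
  have "Lp_norm_pow T p (\<lambda>t x. (\<Sum>j\<in>signs. g j t x) / ?n)
      \<le> (\<integral>\<^sup>+z. ennreal (1 / ?n) * (\<Sum>j\<in>signs. ennreal (\<bar>g j (fst z) (snd z)\<bar> powr p) * ?I z) \<partial>lborel)"
    unfolding Lp_norm_pow_def
  proof (rule nn_integral_mono)
    fix z :: "real \<times> 'a"
    have "ennreal (\<bar>(\<Sum>j\<in>signs. g j (fst z) (snd z)) / ?n\<bar> powr p) \<le> ennreal ((\<Sum>j\<in>signs. \<bar>g j (fst z) (snd z)\<bar> powr p) / ?n)"
      using powr_average_le[OF p, of "\<lambda>j. g j (fst z) (snd z)"] by (intro ennreal_leI) simp
    also have "\<dots> = ennreal (1 / ?n) * (\<Sum>j\<in>signs. ennreal (\<bar>g j (fst z) (snd z)\<bar> powr p))"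
      by (simp add: sum_ennreal flip: ennreal_mult')
    finally show "ennreal (\<bar>(\<Sum>j\<in>signs. g j (fst z) (snd z)) / ?n\<bar> powr p) * ?I z
        \<le> ennreal (1 / ?n) * (\<Sum>j\<in>signs. ennreal (\<bar>g j (fst z) (snd z)\<bar> powr p) * ?I z)"
      unfolding sum_distrib_right[symmetric] mult.assoc[symmetric] by (rule mult_right_mono) simp
  qed
  also have "\<dots> = ennreal (1 / ?n) * (\<Sum>j\<in>signs. Lp_norm_pow T p (g j))"
    unfolding Lp_norm_pow_def nn_integral_sum[OF m, symmetric]
    by (rule nn_integral_cmult) (rule borel_measurable_sum, rule m)
  also have "\<dots> \<le> ennreal (1 / ?n) * (\<Sum>j\<in>(signs :: ('a \<times> real) set). K)"
    using K by (intro mult_left_mono sum_mono) auto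
  also have "\<dots> = ennreal (1 / ?n) * (ennreal ?n * K)"
    by (simp add: card_signs ennreal_of_nat_eq_real_of_nat ennreal_mult)
  also have "\<dots> = K"
    by (simp add: mult.assoc[symmetric] ennreal_mult'[symmetric])
  finally show ?thesis by simp
qed

lemma Lp_estimate_jump:
  fixes S :: "(real \<Rightarrow> 'a::euclidean_space \<Rightarrow> real) \<Rightarrow> (real \<Rightarrow> 'a \<Rightarrow> real)"
  assumes p: "1 < p" and adm: "admissible T S" and S: "Lp_estimate T p l N S"
  shows "Lp_estimate T p l N (jump \<tau> v S)"
  unfolding Lp_estimate_def
proof (intro allI impI)
  fix F :: "'a list \<Rightarrow> real \<Rightarrow> 'a \<Rightarrow> real"
  assume F: "jet F" "bounded_support (F [])"
  let ?w = "walk_step v"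
  have hm: "(\<lambda>z. line_hessian l S (kicked_jet \<tau> (?w j) F) (fst z) (snd z)) \<in> borel_measurable borel" for j
    by (rule line_hessian_measurable[OF adm kicked_jet[OF F(1)]])
  have "Lp_norm_pow T p (\<lambda>t x. (\<Sum>j\<in>signs. line_hessian l S (kicked_jet \<tau> (?w j) F) t (x + kick \<tau> (?w j) t)) / (2 * DIM('a)))
      \<le> N * Lp_norm_pow T p (F [])"
  proof (rule Lp_norm_pow_average[OF p])
    fix j
    show "(\<lambda>z. line_hessian l S (kicked_jet \<tau> (?w j) F) (fst z) (snd z + kick \<tau> (?w j) (fst z))) \<in> borel_measurable borel"
      by (rule shifted_measurable[OF hm kick_measurable])
    have "Lp_norm_pow T p (\<lambda>t x. line_hessian l S (kicked_jet \<tau> (?w j) F) t (x + kick \<tau> (?w j) t))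
        = Lp_norm_pow T p (line_hessian l S (kicked_jet \<tau> (?w j) F))"
      by (rule Lp_norm_pow_shift[OF hm kick_measurable])
    also have "\<dots> \<le> N * Lp_norm_pow T p (kicked_jet \<tau> (?w j) F [])"
      using S kicked_jet[OF F(1)] bounded_support_kicked[where F = F, OF F(2)] unfolding Lp_estimate_def by blast
    also have "Lp_norm_pow T p (kicked_jet \<tau> (?w j) F []) = Lp_norm_pow T p (F [])"
      unfolding kicked_jet_def by (rule Lp_norm_pow_shift[OF jet_measurable[OF F(1)] kick_measurable])
    finally show "Lp_norm_pow T p (\<lambda>t x. line_hessian l S (kicked_jet \<tau> (?w j) F) t (x + kick \<tau> (?w j) t)) \<le> N * Lp_norm_pow T p (F [])" .
  qed
  then show "Lp_norm_pow T p (line_hessian l (jump \<tau> v S) F) \<le> N * Lp_norm_pow T p (F [])"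
    by (simp only: line_hessian_jump[abs_def])
qed

lemma Lp_estimate_kicked:
  assumes "1 < p" "admissible T S0" "Lp_estimate T p l N S0"
  shows "kicked S0 S \<Longrightarrow> Lp_estimate T p l N S"
proof (induction rule: kicked.induct)
  case (kick S \<tau> v)
  then show ?case by (intro Lp_estimate_jump[OF assms(1) admissible_kicked[OF kick.hyps assms(2)]])
qed (rule assms)

text \<open>Fatou's lemma.\<close>

lemma Lp_estimate_limit:
  assumes p: "1 < p" and adm: "\<And>n :: nat. admissible T (Sn n)" and S: "\<And>n. Lp_estimate T p l N (Sn n)"
    and lim: "\<And>f t x. smooth f \<Longrightarrow> (\<lambda>n. Sn n f t x) \<longlonglongrightarrow> S f t x"
  shows "Lp_estimate T p l N S"
  unfolding Lp_estimate_def
proof (intro allI impI)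
  fix F :: "'a list \<Rightarrow> real \<Rightarrow> 'a \<Rightarrow> real"
  assume F: "jet F" "bounded_support (F [])"
  let ?I = "indicator ({0<..<T} \<times> UNIV) :: real \<times> 'a \<Rightarrow> ennreal"
  let ?g = "\<lambda>S z. ennreal (\<bar>line_hessian l S F (fst z) (snd z)\<bar> powr p) * ?I z"
  have Sb: "{0<..<T} \<times> (UNIV :: 'a set) \<in> sets borel"
    unfolding borel_prod[symmetric] by (rule pair_measureI) auto
  have m: "?g (Sn n) \<in> borel_measurable lborel" for n
    using line_hessian_measurable[OF adm[of n] F(1), of l] Sb
    by (intro borel_measurable_times_ennreal borel_measurable_indicator) (auto intro: measurable_compose)
  have g: "(\<lambda>n. ?g (Sn n) z) \<longlonglongrightarrow> ?g S z" for z
  proof (cases "z \<in> {0<..<T} \<times> UNIV")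
    case True
    have "(\<lambda>n. \<bar>line_hessian l (Sn n) F (fst z) (snd z)\<bar> powr p) \<longlonglongrightarrow> \<bar>line_hessian l S F (fst z) (snd z)\<bar> powr p"
      using p by (intro tendsto_powr2 tendsto_intros line_hessian_tendsto[OF F(1) lim]) auto
    then show ?thesis using True by (auto intro!: tendsto_ennrealI)
  qed simp
  have "Lp_norm_pow T p (line_hessian l S F) = (\<integral>\<^sup>+z. liminf (\<lambda>n. ?g (Sn n) z) \<partial>lborel)"
    unfolding Lp_norm_pow_def
    by (intro nn_integral_cong) (rule lim_imp_Liminf[OF sequentially_bot g, symmetric])
  also have "\<dots> \<le> liminf (\<lambda>n. \<integral>\<^sup>+z. ?g (Sn n) z \<partial>lborel)"
    by (rule nn_integral_liminf[OF m])
  also have "\<dots> \<le> N * Lp_norm_pow T p (F [])"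
  proof (rule Liminf_le)
    show "eventually (\<lambda>n. (\<integral>\<^sup>+z. ?g (Sn n) z \<partial>lborel) \<le> N * Lp_norm_pow T p (F [])) sequentially"
      using S F unfolding Lp_estimate_def Lp_norm_pow_def by (intro always_eventually) blast
  qed simp
  finally show "Lp_norm_pow T p (line_hessian l S F) \<le> N * Lp_norm_pow T p (F [])" .
qed


section \<open>Jets and classical function spaces\<close>

lemma jet_partials:
  fixes F :: "'a::euclidean_space list \<Rightarrow> real \<Rightarrow> 'a \<Rightarrow> real"
  assumes "jet F" "set bs \<subseteq> Basis"
  shows "partials bs (F cs t) = F (bs @ cs) t"
  using assms(2)
proof (induction bs)
  case (Cons b bs)
  then have b: "b \<in> Basis" and IH: "partials bs (F cs t) = F (bs @ cs) t" by auto
  show ?case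
  proof (rule ext)
    fix x
    have "frechet_derivative (F (bs @ cs) t) (at x) b = (\<Sum>c\<in>Basis. (b \<bullet> c) * F (c # bs @ cs) t x)"
      by (simp add: frechet_derivative_at[OF jet_derivative[OF assms(1)], symmetric])
    also have "\<dots> = (\<Sum>c\<in>Basis. if c = b then F (b # bs @ cs) t x else 0)"
      using b by (intro sum.cong) (auto simp: inner_Basis)
    also have "\<dots> = F (b # bs @ cs) t x" using b by simp
    finally show "partials (b # bs) (F cs t) x = F ((b # bs) @ cs) t x" by (simp add: IH)
  qed
qed simp

lemma jet_C_k:
  fixes F :: "'a::euclidean_space list \<Rightarrow> real \<Rightarrow> 'a \<Rightarrow> real"
  assumes F: "jet F" shows "C_k n (F [] t)"
  unfolding C_k_def
proof (intro allI impI conjI)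
  fix bs :: "'a list" and x assume bs: "set bs \<subseteq> Basis"
  show "partials bs (F [] t) differentiable (at x)"
    unfolding jet_partials[OF F bs] using jet_derivative[OF F] by (rule differentiableI)
  show "continuous_on UNIV (partials bs (F [] t))"
    unfolding jet_partials[OF F bs]
    using jet_derivative[OF F] has_derivative_continuous by (intro continuous_at_imp_continuous_on) blast
qed

lemma finite_tensor_index [simp]: "finite (tensor_index k)"
  unfolding tensor_index_def by (rule finite_lists_length_eq) simp

lemma abs_le_L2_set:
  assumes "finite A" "i \<in> A" shows "\<bar>f i\<bar> \<le> L2_set f A"
proof -
  have "(f i)\<^sup>2 \<le> (\<Sum>i\<in>A. (f i)\<^sup>2)" using assms by (intro member_le_sum) auto
  then show ?thesis unfolding L2_set_def by (metis real_sqrt_abs real_sqrt_le_iff)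
qed

lemma L2_set_tensor_le:
  fixes G :: "'a::euclidean_space list \<Rightarrow> real" and C :: real
  assumes "\<And>bs. set bs \<subseteq> Basis \<Longrightarrow> length bs = k \<Longrightarrow> \<bar>G bs\<bar> \<le> C"
  shows "L2_set G (tensor_index k) \<le> card (tensor_index k :: 'a list set) * C"
proof -
  have "L2_set G (tensor_index k) \<le> (\<Sum>bs\<in>tensor_index k. \<bar>G bs\<bar>)" by (rule L2_set_le_sum_abs)
  also have "\<dots> \<le> (\<Sum>bs\<in>(tensor_index k :: 'a list set). C)"
    using assms by (intro sum_mono) (auto simp: tensor_index_def)
  finally show ?thesis by simp
qed

lemma jet_C_k_norm:
  fixes F :: "'a::euclidean_space list \<Rightarrow> real \<Rightarrow> 'a \<Rightarrow> real"
  assumes F: "jet F" shows "\<exists>K. \<forall>t. C_k_norm n (F [] t) \<le> ennreal K"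
proof -
  obtain C where C: "jet_bound n C F" using jet_has_bound[OF F] by blast
  have "C_k_norm n (F [] t) \<le> ennreal (\<Sum>k\<le>n. card (tensor_index k :: 'a list set) * C)" for t
    unfolding C_k_norm_def
  proof (intro SUP_least ennreal_leI sum_mono L2_set_tensor_le)
    fix x k and bs :: "'a list" assume "k \<in> {..n}" "set bs \<subseteq> Basis" "length bs = k"
    then show "\<bar>partials bs (F [] t) x\<bar> \<le> C"
      using jet_boundD[OF C, of bs t x] jet_partials[OF F, of bs "[]" t] by simp
  qed
  then show ?thesis by blast
qed

lemma jet_C_2_holder_norm:
  fixes F :: "'a::euclidean_space list \<Rightarrow> real \<Rightarrow> 'a \<Rightarrow> real"
  assumes F: "jet F" and \<alpha>: "0 \<le> \<alpha>" "\<alpha> \<le> 1"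
  shows "\<exists>K. \<forall>t. C_2_holder_norm \<alpha> (F [] t) \<le> ennreal K"
proof -
  obtain K where K: "\<And>t. C_k_norm 2 (F [] t) \<le> ennreal K" using jet_C_k_norm[OF F] by blast
  obtain C where C: "jet_bound 3 C F" using jet_has_bound[OF F] by blast
  let ?c = "real (card (tensor_index 2 :: 'a list set))"
  have "holder_seminorm_D2 \<alpha> (F [] t) \<le> ennreal (?c * (2 * DIM('a) * C))" for t
    unfolding holder_seminorm_D2_def
  proof (intro SUP_least, clarify)
    fix x y :: 'a assume xy: "x \<noteq> y"
    have "L2_set (\<lambda>bs. partials bs (F [] t) x - partials bs (F [] t) y) (tensor_index 2) \<le> ?c * (2 * DIM('a) * C * norm (x - y) powr \<alpha>)"
    proof (rule L2_set_tensor_le)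
      fix bs :: "'a list" assume bs: "set bs \<subseteq> Basis" "length bs = 2"
      show "\<bar>partials bs (F [] t) x - partials bs (F [] t) y\<bar> \<le> 2 * DIM('a) * C * norm (x - y) powr \<alpha>"
        unfolding jet_partials[OF F bs(1)] append_Nil2
        by (rule jet_lipschitz[OF F C bs(1) _ \<alpha>]) (simp add: bs)
    qed
    then show "ennreal (L2_set (\<lambda>bs. partials bs (F [] t) x - partials bs (F [] t) y) (tensor_index 2) / norm (x - y) powr \<alpha>)
        \<le> ennreal (?c * (2 * DIM('a) * C))"
      using xy by (intro ennreal_leI) (simp add: divide_le_eq mult.assoc)
  qed
  then have "C_2_holder_norm \<alpha> (F [] t) \<le> ennreal K + ennreal (?c * (2 * DIM('a) * C))" for t
    unfolding C_2_holder_norm_def using K by (intro add_mono)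
  moreover have "ennreal K + ennreal (?c * (2 * DIM('a) * C)) \<le> ennreal (max 0 K + max 0 (?c * (2 * DIM('a) * C)))"
    by (simp add: ennreal_plus[symmetric] ennreal_leI add_mono del: ennreal_plus) (metis add_mono ennreal_leI ennreal_plus max.cobounded1 max.cobounded2)
  ultimately show ?thesis by (meson order_trans)
qed

lemma jet_C_2_holder:
  assumes "jet F" "0 \<le> \<alpha>" "\<alpha> \<le> 1" shows "F [] t \<in> C_2_holder \<alpha>"
  unfolding C_2_holder_def
  using jet_C_k[OF assms(1)] jet_C_2_holder_norm[OF assms] by (auto intro: le_less_trans ennreal_less_top)

text \<open>This and \<open>B_c_jet\<close> identify the data class with jets of bounded support.\<close>

lemma jet_B_c:
  fixes F :: "'a::euclidean_space list \<Rightarrow> real \<Rightarrow> 'a \<Rightarrow> real"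
  assumes F: "jet F" and s: "bounded_support (F [])"
  shows "F [] \<in> B_c T"
proof -
  obtain R where R: "\<And>t x. R < norm x \<Longrightarrow> F [] t x = 0" using s unfolding bounded_support_def by blast
  have sup: "closure (support_on UNIV (F [] t)) \<subseteq> cball 0 R" for t
  proof (rule closure_minimal)
    show "support_on UNIV (F [] t) \<subseteq> cball 0 R"
      unfolding support_on_def using R[of _ t] by (auto simp: not_less[symmetric])
  qed simp
  have "(\<lambda>(t, x). F [] t x) \<in> borel_measurable borel"
    using jet_measurable[OF F, of "[]"] by (simp add: case_prod_beta')
  then have m: "(\<lambda>(t, x). F [] t x) \<in> borel_measurable (restrict_space borel ({0<..<T} \<times> UNIV))"
    by (rule measurable_restrict_space1)
  obtain C where C: "\<And>t x. \<bar>F [] t x\<bar> \<le> C" using jet_bounded[OF F] by blast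
  have b: "bounded ((\<lambda>(t, x). F [] t x) ` ({0<..<T} \<times> UNIV))"
    unfolding bounded_iff using C by auto
  have "compact (closure (support_on UNIV (F [] t)))" for t
    using bounded_subset[OF bounded_cball sup] by (simp add: compact_eq_bounded_closed)
  then have c: "F [] t \<in> C0_infinity" for t
    unfolding C0_infinity_def using jet_C_k[OF F] by blast
  have n: "(SUP t\<in>{0<..<T}. C_k_norm n (F [] t)) < \<infinity>" for n
  proof -
    obtain K where K: "\<And>t. C_k_norm n (F [] t) \<le> ennreal K" using jet_C_k_norm[OF F] by blast
    have "(SUP t\<in>{0<..<T}. C_k_norm n (F [] t)) \<le> ennreal K" by (intro SUP_least K)
    then show ?thesis by (rule le_less_trans) simp
  qed
  show ?thesis unfolding B_c_def using m b c n sup by blast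
qed

text \<open>Measurability of derivatives in \<open>(t, x)\<close> comes from writing them as limits of difference quotients.\<close>

lemma directional_limit:
  fixes g :: "'a::euclidean_space \<Rightarrow> real"
  assumes g: "(g has_derivative (\<lambda>h. \<Sum>c\<in>Basis. (h \<bullet> c) * g1 c)) (at x)" and b: "b \<in> Basis"
  shows "(\<lambda>n. (g (x + (1 / real (Suc n)) *\<^sub>R b) - g x) / (1 / real (Suc n))) \<longlonglongrightarrow> g1 b"
proof -
  have "DERIV (\<lambda>r. g (x + r *\<^sub>R b)) 0 :> (\<Sum>c\<in>Basis. (b \<bullet> c) * g1 c)"
    by (rule DERIV_along_line) (use g in simp)
  also have "(\<Sum>c\<in>Basis. (b \<bullet> c) * g1 c) = (\<Sum>c\<in>Basis. if c = b then g1 b else 0)"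
    using b by (intro sum.cong) (auto simp: inner_Basis)
  also have "\<dots> = g1 b" using b by simp
  finally have "((\<lambda>h. (g (x + h *\<^sub>R b) - g x) / h) \<longlongrightarrow> g1 b) (at 0)"
    by (simp add: DERIV_def)
  moreover have "filterlim (\<lambda>n. 1 / real (Suc n)) (at 0) sequentially"
    unfolding filterlim_at using LIMSEQ_inverse_real_of_nat by (simp add: inverse_eq_divide)
  ultimately show ?thesis by (rule filterlim_compose)
qed

lemma has_derivative_partials:
  assumes "g differentiable (at x)"
  shows "(g has_derivative (\<lambda>h. \<Sum>b\<in>Basis. (h \<bullet> b) * frechet_derivative g (at x) b)) (at x)"
proof -
  have h: "(g has_derivative frechet_derivative g (at x)) (at x)"
    using assms by (simp add: frechet_derivative_works)
  interpret bl: bounded_linear "frechet_derivative g (at x)"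
    using h by (rule has_derivative_bounded_linear)
  have "frechet_derivative g (at x) h = (\<Sum>b\<in>Basis. (h \<bullet> b) * frechet_derivative g (at x) b)" for h
  proof -
    have "frechet_derivative g (at x) (\<Sum>b\<in>Basis. (h \<bullet> b) *\<^sub>R b) = (\<Sum>b\<in>Basis. (h \<bullet> b) * frechet_derivative g (at x) b)"
      unfolding bl.sum bl.scaleR by simp
    then show ?thesis by (simp add: euclidean_representation)
  qed
  then have "frechet_derivative g (at x) = (\<lambda>h. \<Sum>b\<in>Basis. (h \<bullet> b) * frechet_derivative g (at x) b)" by blast
  with h show ?thesis by simp
qed

lemma C_k_hessian:
  assumes "C_k 2 g"
  shows "has_hessian g (\<lambda>b. partials [b] g) (\<lambda>b c. partials [b, c] g)"
proof -
  have d: "partials bs g differentiable (at x)" if "set bs \<subseteq> Basis" "length bs < 2" for bs x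
    using assms that unfolding C_k_def by blast
  have "(g has_derivative (\<lambda>h. \<Sum>b\<in>Basis. (h \<bullet> b) * partials [b] g x)) (at x)" for x
    using has_derivative_partials[OF d[of "[]" x]] by simp
  moreover have "(partials [c] g has_derivative (\<lambda>h. \<Sum>b\<in>Basis. (h \<bullet> b) * partials [b, c] g x)) (at x)" if "c \<in> Basis" for c x
    using has_derivative_partials[OF d[of "[c]" x]] that by simp
  ultimately show ?thesis unfolding has_hessian_def by blast
qed

lemma B_c_jet:
  fixes f :: "real \<Rightarrow> 'a::euclidean_space \<Rightarrow> real"
  assumes f: "f \<in> B_c T"
  obtains F where "jet F" "bounded_support (F [])" "\<And>t. t \<in> {0<..<T} \<Longrightarrow> F [] t = f t" "\<And>t. t \<notin> {0<..<T} \<Longrightarrow> F [] t = (\<lambda>x. 0)"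
proof -
  \<comment> \<open>Lists that contain other vectors than basis vectors get the zero function, for which the jet conditions hold trivially.\<close>
  define F where "F bs t x = (if t \<in> {0<..<T} \<and> set bs \<subseteq> Basis then partials bs (f t) x else 0)" for bs t x
  have ck: "C_k n (f t)" if "t \<in> {0<..<T}" for n t
    using f that unfolding B_c_def C0_infinity_def by blast
  have d: "(F bs t has_derivative (\<lambda>h. \<Sum>b\<in>Basis. (h \<bullet> b) * F (b # bs) t x)) (at x)" for bs t x
  proof (cases "t \<in> {0<..<T} \<and> set bs \<subseteq> Basis")
    case True
    then have e: "F bs t = partials bs (f t)" by (simp add: F_def[abs_def])
    have "partials bs (f t) differentiable (at x)"
      using ck[of t "Suc (length bs)"] True unfolding C_k_def by auto
    then show ?thesis
      using has_derivative_partials True unfolding e by (simp add: F_def cong: sum.cong)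
  next
    case False
    then have "F bs t = (\<lambda>x. 0)" "\<And>b. F (b # bs) t = (\<lambda>x. 0)"
      by (intro ext; use False in \<open>auto simp: F_def\<close>)+
    then show ?thesis by simp
  qed
  have bd: "\<exists>C. \<forall>t x. \<bar>F bs t x\<bar> \<le> C" for bs
  proof -
    let ?M = "SUP t\<in>{0<..<T}. C_k_norm (length bs) (f t)"
    have M: "?M < \<infinity>" using f unfolding B_c_def by blast
    have "\<bar>F bs t x\<bar> \<le> enn2real ?M" for t x
    proof (cases "t \<in> {0<..<T} \<and> set bs \<subseteq> Basis")
      case True
      have "\<bar>partials bs (f t) x\<bar> \<le> L2_set (\<lambda>bs. partials bs (f t) x) (tensor_index (length bs))"
        by (rule abs_le_L2_set[OF finite_tensor_index]) (use True in \<open>simp add: tensor_index_def\<close>)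
      also have "\<dots> \<le> (\<Sum>k\<le>length bs. L2_set (\<lambda>bs. partials bs (f t) x) (tensor_index k))"
        by (rule member_le_sum) auto
      finally have "ennreal \<bar>F bs t x\<bar> \<le> ennreal (\<Sum>k\<le>length bs. L2_set (\<lambda>bs. partials bs (f t) x) (tensor_index k))"
        using True by (intro ennreal_leI) (simp add: F_def)
      also have "\<dots> \<le> C_k_norm (length bs) (f t)" unfolding C_k_norm_def by (rule SUP_upper) simp
      also have "\<dots> \<le> ?M" using True by (intro SUP_upper) simp
      finally have "ennreal \<bar>F bs t x\<bar> \<le> ?M" .
      then have "enn2real (ennreal \<bar>F bs t x\<bar>) \<le> enn2real ?M" using M by (intro enn2real_mono) simp_all
      then show ?thesis by simp
    qed (auto simp: F_def)
    then show ?thesis by blast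
  qed
  have m: "(\<lambda>z. F bs (fst z) (snd z)) \<in> borel_measurable borel" for bs
  proof (induction bs)
    case Nil
    have "(\<lambda>(t, x). f t x) \<in> borel_measurable (restrict_space borel ({0<..<T} \<times> UNIV))"
      using f unfolding B_c_def by blast
    moreover have "{0<..<T} \<times> (UNIV :: 'a set) \<inter> space borel \<in> sets borel"
      unfolding borel_prod[symmetric] by (auto intro: pair_measureI)
    ultimately have "(\<lambda>z. indicator ({0<..<T} \<times> UNIV) z *\<^sub>R (case z of (t, x) \<Rightarrow> f t x)) \<in> borel_measurable borel"
      by (subst (asm) borel_measurable_restrict_space_iff) auto
    also have "(\<lambda>z. indicator ({0<..<T} \<times> UNIV) z *\<^sub>R (case z of (t, x) \<Rightarrow> f t x)) = (\<lambda>z. F [] (fst z) (snd z))"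
      by (auto simp: F_def indicator_def)
    finally show ?case .
  next
    case (Cons b bs)
    show ?case
    proof (cases "b \<in> Basis")
      case False
      then show ?thesis by (simp add: F_def)
    next
      case True
      have "(\<lambda>z. F bs (fst z) (snd z + (1 / real (Suc n)) *\<^sub>R b)) \<in> borel_measurable borel" for n
        using shifted_measurable[OF Cons, of "\<lambda>_. (1 / real (Suc n)) *\<^sub>R b"] by simp
      then show ?thesis
        by (intro borel_measurable_LIMSEQ_real[OF directional_limit[OF d True]])
          (intro borel_measurable_divide borel_measurable_diff Cons borel_measurable_const)
    qed
  qed
  have j: "jet F" unfolding jet_def using d bd m by blast
  obtain R where R: "\<And>t. t \<in> {0<..<T} \<Longrightarrow> closure (support_on UNIV (f t)) \<subseteq> cball 0 R"
    using f unfolding B_c_def by blast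
  have "F [] t x = 0" if "R < norm x" for t x
  proof (cases "t \<in> {0<..<T}")
    case True
    have "x \<notin> support_on UNIV (f t)" using R[OF True] closure_subset[of "support_on UNIV (f t)"] that by auto
    then show ?thesis by (simp add: support_on_def F_def)
  next
    case False
    then show ?thesis by (auto simp: F_def)
  qed
  then have "bounded_support (F [])" unfolding bounded_support_def by blast
  moreover have "F [] t = f t" if "t \<in> {0<..<T}" for t
    by (rule ext) (use that in \<open>simp add: F_def\<close>)
  moreover have "F [] t = (\<lambda>x. 0)" if "t \<notin> {0<..<T}" for t
    by (rule ext) (use that in \<open>simp only: F_def simp_thms if_False\<close>)
  ultimately show ?thesis using that[of F] j by blast
qed

lemma holder_seminorm_le_iff:
  assumes "0 \<le> c"
  shows "holder_seminorm \<alpha> f \<le> ennreal c \<longleftrightarrow> (\<forall>x y. \<bar>f x - f y\<bar> \<le> c * norm (x - y) powr \<alpha>)"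
proof -
  have "ennreal (\<bar>f x - f y\<bar> / norm (x - y) powr \<alpha>) \<le> ennreal c \<longleftrightarrow> \<bar>f x - f y\<bar> \<le> c * norm (x - y) powr \<alpha>" if "x \<noteq> y" for x y
    using that assms by (simp add: ennreal_le_iff divide_le_eq)
  moreover have "\<bar>f x - f x\<bar> \<le> c * norm (x - x) powr \<alpha>" for x by simp
  moreover have "holder_seminorm \<alpha> f \<le> ennreal c \<longleftrightarrow>
      (\<forall>x y. x \<noteq> y \<longrightarrow> ennreal (\<bar>f x - f y\<bar> / norm (x - y) powr \<alpha>) \<le> ennreal c)"
    unfolding holder_seminorm_def SUP_le_iff by auto
  ultimately show ?thesis by metis
qed

section \<open>The heat equation along a line\<close>

lemma jet_sum:
  "finite B \<Longrightarrow> (\<And>b. b \<in> B \<Longrightarrow> jet (F b)) \<Longrightarrow> jet (\<lambda>cs t x. \<Sum>b\<in>B. k b * F b cs t x)"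
proof (induction B rule: finite_induct)
  case (insert b B)
  then show ?case
    using jet_lincomb[of "\<lambda>cs t x. \<Sum>b\<in>B. k b * F b cs t x" "F b" "k b"] by (simp add: add.commute)
qed (simp add: jet_zero)

text \<open>The jet of the directional derivative \<open>D\<^sub>l f\<close>. The new derivative is appended at the end of the
  list, that is, taken first.\<close>

definition dir_jet :: "'a::euclidean_space \<Rightarrow> ('a list \<Rightarrow> real \<Rightarrow> 'a \<Rightarrow> real) \<Rightarrow> ('a list \<Rightarrow> real \<Rightarrow> 'a \<Rightarrow> real)" where
  "dir_jet l F cs t x = (\<Sum>b\<in>Basis. (l \<bullet> b) * F (cs @ [b]) t x)"

lemma jet_dir_jet: "jet F \<Longrightarrow> jet (dir_jet l F)"
  unfolding dir_jet_def by (intro jet_sum jet_append) auto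

text \<open>The restriction to the line \<open>x + \<real> l\<close>. In one dimension the list \<open>bs\<close> only matters through its length.\<close>

definition line_jet ::
    "'a::euclidean_space \<Rightarrow> 'a \<Rightarrow> ('a list \<Rightarrow> real \<Rightarrow> 'a \<Rightarrow> real) \<Rightarrow> (real list \<Rightarrow> real \<Rightarrow> real \<Rightarrow> real)" where
  "line_jet l x F bs t \<mu> = (dir_jet l ^^ length bs) F [] t (x + \<mu> *\<^sub>R l)"

lemma jet_line_jet:
  assumes F: "jet F" shows "jet (line_jet l x F)"
proof -
  have j: "jet ((dir_jet l ^^ n) F)" for n
    by (induction n) (auto intro: F jet_dir_jet)
  show ?thesis
    unfolding jet_def
  proof (intro conjI allI)
    fix bs :: "real list" and t \<mu> :: real
    let ?H = "(dir_jet l ^^ length bs) F"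
    have "DERIV (\<lambda>\<mu>. ?H [] t (x + \<mu> *\<^sub>R l)) \<mu> :> (\<Sum>b\<in>Basis. (l \<bullet> b) * ?H [b] t (x + \<mu> *\<^sub>R l))"
      by (rule DERIV_along_line[OF jet_derivative[OF j]])
    also have "(\<Sum>b\<in>Basis. (l \<bullet> b) * ?H [b] t (x + \<mu> *\<^sub>R l)) = line_jet l x F (1 # bs) t \<mu>"
      by (simp add: line_jet_def dir_jet_def)
    finally show "(line_jet l x F bs t has_derivative (\<lambda>h. \<Sum>b\<in>Basis. (h \<bullet> b) * line_jet l x F (b # bs) t \<mu>)) (at \<mu>)"
      by (simp add: has_field_derivative_def line_jet_def[abs_def] mult_commute_abs)
  next
    fix bs show "\<exists>C. \<forall>t \<mu>. \<bar>line_jet l x F bs t \<mu>\<bar> \<le> C"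
      unfolding line_jet_def using jet_bounded[OF j] by blast
  next
    fix bs :: "real list"
    have "(\<lambda>z :: real \<times> real. (fst z, x + snd z *\<^sub>R l)) \<in> borel_measurable borel"
      by (intro borel_measurable_continuous_onI continuous_intros)
    from measurable_compose[OF this jet_measurable[OF j]]
    show "(\<lambda>z. line_jet l x F bs (fst z) (snd z)) \<in> borel_measurable borel"
      unfolding line_jet_def by simp
  qed
qed

lemma line_jet_Nil: "line_jet l x F [] t \<mu> = F [] t (x + \<mu> *\<^sub>R l)"
  by (simp add: line_jet_def)

lemma line_jet_second: "line_jet l x F [1, 1] t \<mu> = quad (\<lambda>b c. F [b, c] t (x + \<mu> *\<^sub>R l)) l"
  by (simp add: line_jet_def dir_jet_def quad_def contract_def outer_def sum_distrib_left mult.assoc)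

lemma bounded_support_line:
  assumes "bounded_support (F [])" "norm l = 1" shows "bounded_support (line_jet l x F [])"
proof -
  obtain R where R: "\<And>t x. R < norm x \<Longrightarrow> F [] t x = 0" using assms unfolding bounded_support_def by blast
  have "line_jet l x F [] t \<mu> = 0" if "R + norm x < norm \<mu>" for t \<mu>
  proof -
    have "norm (\<mu> *\<^sub>R l) - norm x \<le> norm (x + \<mu> *\<^sub>R l)"
      using norm_triangle_ineq2[of "\<mu> *\<^sub>R l" "- x"] by (simp add: add.commute)
    then show ?thesis unfolding line_jet_Nil using that assms(2) by (intro R) simp
  qed
  then show ?thesis unfolding bounded_support_def by blast
qed

text \<open>Continuity in time for fixed \<open>x\<close> comes from the integral equation, and the Lipschitz constants in
  space are uniform in time.\<close>

lemma solution_continuous: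
  fixes S :: "(real \<Rightarrow> 'a::euclidean_space \<Rightarrow> real) \<Rightarrow> (real \<Rightarrow> 'a \<Rightarrow> real)"
  assumes S: "admissible T S" "solves T A S" and A: "integrable_coeff T A" and F: "jet F"
  shows "continuous_on ({0..T} \<times> UNIV) (\<lambda>(t, x). S (F []) t x)"
proof (cases "0 \<le> T")
  case True
  let ?U = "\<lambda>bs. S (F bs)"
  have U: "jet ?U" by (rule admissible_jet[OF S(1) F])
  obtain C where C: "jet_bound 1 C ?U" using jet_has_bound[OF U] by blast
  define L where "L = 2 * real DIM('a) * C"
  have lip: "\<bar>S (F []) t x - S (F []) t y\<bar> \<le> L * norm (x - y)" for t x y
    using jet_lipschitz[OF U C, of "[]" 1 t x y] by (simp add: L_def)
  have time: "continuous_on {0..T} (\<lambda>t. S (F []) t x)" for x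
  proof -
    let ?g = "\<lambda>s. contract (A s) (\<lambda>b c. S (F [b, c]) s x) + F [] s x"
    have g: "set_integrable lborel {0<..<T} ?g" by (rule increment_integrable[OF A S(1) F]) auto
    then have gi: "?g integrable_on {0..T}"
      using set_borel_integral_eq_integral(1)[OF g] by (simp add: integrable_on_Icc_iff_Ioo)
    have c: "continuous_on {0..T} (\<lambda>t. integral {0..t} ?g)"
      by (rule indefinite_integral_continuous_1[OF gi])
    have e: "S (F []) t x = integral {0..t} ?g" if "t \<in> {0..T}" for t
    proof -
      have "S (F []) t x = S (F []) 0 x + increment A S F 0 t x"
        by (rule solves_increment[OF S(2) F]) (use that in auto)
      also have "\<dots> = (LINT s:{0<..<t}|lborel. ?g s)" by (simp add: solves_initial[OF S(2) F] increment_def)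
      also have "\<dots> = integral {0..t} ?g"
        using set_borel_integral_eq_integral(2)[OF set_integrable_subinterval[OF g order_refl, of t]] that
        by (simp add: integral_open_interval_real)
      finally show ?thesis .
    qed
    show ?thesis by (rule continuous_on_eq[OF c]) (simp only: e)
  qed
  show ?thesis
    unfolding continuous_on_iff
  proof (intro ballI allI impI)
    fix z0 :: "real \<times> 'a" and e :: real assume z0: "z0 \<in> {0..T} \<times> UNIV" and e: "0 < e"
    obtain t0 x0 where z: "z0 = (t0, x0)" "t0 \<in> {0..T}" using z0 by auto
    obtain d where d: "0 < d" "\<And>t. t \<in> {0..T} \<Longrightarrow> dist t t0 < d \<Longrightarrow> dist (S (F []) t x0) (S (F []) t0 x0) < e / 2"
      using time[of x0] z(2) e unfolding continuous_on_iff by (metis half_gt_zero)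
    define \<eta> where "\<eta> = min d (e / (2 * (\<bar>L\<bar> + 1)))"
    have \<eta>: "0 < \<eta>" using d e by (simp add: \<eta>_def)
    have "dist (case z of (t, x) \<Rightarrow> S (F []) t x) (S (F []) t0 x0) < e" if zz: "z \<in> {0..T} \<times> UNIV" "dist z z0 < \<eta>" for z
    proof -
      obtain t x where tx: "z = (t, x)" "t \<in> {0..T}" using zz(1) by (cases z) auto
      have "dist t t0 < d" "dist x x0 < e / (2 * (\<bar>L\<bar> + 1))"
        using zz(2) dist_fst_le[of z z0] dist_snd_le[of z z0] unfolding \<eta>_def tx z by auto
      have "L * norm (x - x0) \<le> (\<bar>L\<bar> + 1) * norm (x - x0)" by (intro mult_right_mono) auto
      also have "\<dots> < (\<bar>L\<bar> + 1) * (e / (2 * (\<bar>L\<bar> + 1)))"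
        using \<open>dist x x0 < _\<close> by (intro mult_strict_left_mono) (auto simp: dist_norm)
      also have "\<dots> = e / 2" by (simp add: field_simps add_eq_0_iff)
      finally have "\<bar>S (F []) t x - S (F []) t x0\<bar> < e / 2" using lip[of t x x0] by simp
      moreover have "\<bar>S (F []) t x0 - S (F []) t0 x0\<bar> < e / 2" using d(2)[OF tx(2) \<open>dist t t0 < d\<close>] by (simp add: dist_real_def)
      ultimately show ?thesis unfolding tx prod.case dist_real_def by linarith
    qed
    then show "\<exists>d>0. \<forall>z\<in>{0..T} \<times> UNIV. dist z z0 < d \<longrightarrow> dist (case z of (t, x) \<Rightarrow> S (F []) t x) (case z0 of (t, x) \<Rightarrow> S (F []) t x) < e"
      using \<eta> unfolding z by auto
  qed
qed auto

lemma solution_time_integral: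
  assumes S: "admissible T S" "solves T A S" and A: "integrable_coeff T A" and F: "jet F"
  shows "is_time_integral T (\<lambda>s x. contract (A s) (\<lambda>b c. S (F [b, c]) s x) + F [] s x) (S (F []))"
  unfolding is_time_integral_def
proof (intro ballI allI conjI)
  fix t x assume t: "t \<in> {0..T}"
  show "set_integrable lborel {0<..<t} (\<lambda>s. contract (A s) (\<lambda>b c. S (F [b, c]) s x) + F [] s x)"
    by (rule increment_integrable[OF A S(1) F]) (use t in auto)
  have "S (F []) t x = S (F []) 0 x + increment A S F 0 t x"
    by (rule solves_increment[OF S(2) F]) (use t in auto)
  then show "S (F []) t x = (LINT s:{0<..<t}|lborel. contract (A s) (\<lambda>b c. S (F [b, c]) s x) + F [] s x)"
    by (simp add: solves_initial[OF S(2) F] increment_def)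
qed

lemma outer_integrable: "integrable_coeff T (\<lambda>s. outer l)"
  unfolding integrable_coeff_def by (auto intro!: set_integrable_bounded[where C = "\<bar>outer l _ _\<bar>"])

text \<open>For the coefficients \<open>l l^T\<close> the second order operator is \<open>D\<^sub>l\<^sup>2\<close>, which is the second derivative of the
  restriction to a line.\<close>

lemma line_heat_solution:
  fixes l :: "'a::euclidean_space"
  assumes \<alpha>: "0 \<le> \<alpha>" "\<alpha> \<le> 1" and S: "admissible T S" "solves T (\<lambda>s. outer l) S" and F: "jet F"
  shows "heat_solution_1d T \<alpha> (line_jet l x F []) (line_jet l x (\<lambda>bs. S (F bs)) [])"
proof -
  let ?V = "line_jet l x (\<lambda>bs. S (F bs))"
  have V: "jet ?V" by (rule jet_line_jet[OF admissible_jet[OF S(1) F]])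
  have "continuous_on ({0..T} \<times> UNIV) ((\<lambda>(t, x). S (F []) t x) \<circ> (\<lambda>z. (fst z, x + snd z *\<^sub>R l)))"
    by (rule continuous_on_compose[OF _ continuous_on_subset[OF solution_continuous[OF S outer_integrable F]]])
      (auto intro!: continuous_intros)
  then have 1: "continuous_on ({0..T} \<times> UNIV) (\<lambda>(t, \<mu>). ?V [] t \<mu>)"
    by (simp add: line_jet_Nil o_def case_prod_beta')
  have p: "partials [1, 1] (?V [] s) \<mu> = quad (\<lambda>b c. S (F [b, c]) s (x + \<mu> *\<^sub>R l)) l" for s \<mu>
    using jet_partials[OF V, of "[1, 1]" "[]" s] by (simp add: line_jet_second)
  have 2: "is_time_integral T (\<lambda>s \<mu>. partials [1, 1] (?V [] s) \<mu> + line_jet l x F [] s \<mu>) (?V [])"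
    using solution_time_integral[OF S outer_integrable F]
    unfolding is_time_integral_def p line_jet_Nil quad_def by blast
  obtain K where K: "\<And>t. C_2_holder_norm \<alpha> (?V [] t) \<le> ennreal K" using jet_C_2_holder_norm[OF V \<alpha>] by blast
  have "(SUP t\<in>{0..T}. C_2_holder_norm \<alpha> (?V [] t)) \<le> ennreal K" by (intro SUP_least K)
  then have "(SUP t\<in>{0..T}. C_2_holder_norm \<alpha> (?V [] t)) < \<infinity>" by (rule le_less_trans) simp
  then show ?thesis
    unfolding heat_solution_1d_def using 1 2 jet_C_2_holder[OF V \<alpha>] by blast
qed

text \<open>Apply the defining property of \<open>N\<^sub>0(\<alpha>)\<close> on every line. As \<open>ennreal N\<close> truncates negative numbers to
  zero, the real constant is \<open>max 0 N\<close>.\<close>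

lemma holder_estimate_heat:
  fixes l :: "'a::euclidean_space"
  assumes T: "0 < T" and \<alpha>: "0 \<le> \<alpha>" "\<alpha> \<le> 1" and S: "admissible T S" "solves T (\<lambda>s. outer l) S" and l: "norm l = 1"
    and N: "heat_holder_constant T \<alpha> N"
  shows "holder_estimate \<alpha> l (max 0 N) S"
  unfolding holder_estimate_def line_holder_def
proof (intro allI impI)
  fix F :: "'a list \<Rightarrow> real \<Rightarrow> 'a \<Rightarrow> real" and c t x \<mu> \<nu>
  assume F: "jet F" "bounded_support (F [])" and c: "0 \<le> c"
    and h: "\<forall>t x \<mu> \<nu>. \<bar>F [] t (x + \<mu> *\<^sub>R l) - F [] t (x + \<nu> *\<^sub>R l)\<bar> \<le> c * \<bar>\<mu> - \<nu>\<bar> powr \<alpha>"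
  let ?V = "line_jet l x (\<lambda>bs. S (F bs))"
  show "\<bar>line_hessian l S F t (x + \<mu> *\<^sub>R l) - line_hessian l S F t (x + \<nu> *\<^sub>R l)\<bar> \<le> max 0 N * c * \<bar>\<mu> - \<nu>\<bar> powr \<alpha>"
  proof (cases "t \<in> {0..T}")
    case True
    have V: "jet ?V" by (rule jet_line_jet[OF admissible_jet[OF S(1) F(1)]])
    have p: "partials [1, 1] (?V [] t) \<mu> = line_hessian l S F t (x + \<mu> *\<^sub>R l)" for \<mu>
      using jet_partials[OF V, of "[1, 1]" "[]" t] by (simp add: line_jet_second line_hessian_def)
    have "holder_seminorm \<alpha> (partials [1, 1] (?V [] t)) \<le> (SUP t\<in>{0..T}. holder_seminorm \<alpha> (partials [1, 1] (?V [] t)))"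
      using True by (intro SUP_upper)
    also have "\<dots> \<le> ennreal N * (SUP t\<in>{0<..<T}. holder_seminorm \<alpha> (line_jet l x F [] t))"
      using N jet_B_c[OF jet_line_jet[OF F(1)] bounded_support_line[where F = F, OF F(2) l]] line_heat_solution[OF \<alpha> S F(1)]
      unfolding heat_holder_constant_def by blast
    also have "\<dots> \<le> ennreal N * ennreal c"
    proof (intro mult_left_mono SUP_least)
      fix t show "holder_seminorm \<alpha> (line_jet l x F [] t) \<le> ennreal c"
        unfolding holder_seminorm_le_iff[OF c] line_jet_Nil using h by simp
    qed simp
    also have "\<dots> = ennreal (max 0 N * c)"
      using c by (cases "0 \<le> N") (auto simp: ennreal_mult ennreal_neg max_def)
    finally have "\<bar>partials [1, 1] (?V [] t) \<mu> - partials [1, 1] (?V [] t) \<nu>\<bar> \<le> max 0 N * c * norm (\<mu> - \<nu>) powr \<alpha>"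
      using c by (subst (asm) holder_seminorm_le_iff) auto
    then show ?thesis unfolding p by simp
  next
    case False
    have "line_hessian l S F t y = 0" for y
      unfolding line_hessian_def using admissible_outside[OF S(1) smoothI[OF F(1)] False]
      by (simp add: quad_def contract_def)
    then show ?thesis using c by simp
  qed
qed

lemma measurable_borel_lborel:
  "(f \<in> borel_measurable (borel \<Otimes>\<^sub>M lborel)) \<longleftrightarrow> f \<in> borel_measurable (borel :: ('a::euclidean_space \<times> 'b::euclidean_space) measure)"
proof -
  have "sets (borel \<Otimes>\<^sub>M lborel :: ('a \<times> 'b) measure) = sets (borel \<Otimes>\<^sub>M borel)"
    by (intro sets_pair_measure_cong) auto
  then have "borel_measurable (borel \<Otimes>\<^sub>M lborel :: ('a \<times> 'b) measure) = (borel_measurable (borel \<Otimes>\<^sub>M borel) :: ('a \<times> 'b \<Rightarrow> 'c) set)"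
    by (rule measurable_cong_sets) simp
  then show ?thesis by (simp only: borel_prod)
qed

lemma nn_integral_swap:
  fixes f :: "'a::euclidean_space \<Rightarrow> 'b::euclidean_space \<Rightarrow> ennreal"
  assumes "(\<lambda>z. f (fst z) (snd z)) \<in> borel_measurable borel"
  shows "(\<integral>\<^sup>+x. \<integral>\<^sup>+y. f x y \<partial>lborel \<partial>lborel) = (\<integral>\<^sup>+y. \<integral>\<^sup>+x. f x y \<partial>lborel \<partial>lborel)"
proof (rule lborel_pair.Fubini'[symmetric])
  show "case_prod f \<in> borel_measurable (lborel \<Otimes>\<^sub>M lborel)"
    unfolding lborel_prod using assms by (simp add: case_prod_beta')
qed

text \<open>A set that meets every line of direction \<open>l\<close> in a segment of length \<open>1\<close>, so that integrating over
  lines through its points counts each point of the space exactly once. This replaces a rotation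
  that would take \<open>l\<close> to a coordinate vector.\<close>

definition slab :: "'a::euclidean_space \<Rightarrow> 'a set" where
  "slab l = {x. 0 \<le> x \<bullet> l \<and> x \<bullet> l < 1}"

lemma slab_borel: "slab l \<in> sets borel"
proof -
  have "slab l = {x. 0 \<le> x \<bullet> l} \<inter> {x. x \<bullet> l < 1}" by (auto simp: slab_def)
  moreover have "closed {x. 0 \<le> x \<bullet> l}" "open {x. x \<bullet> l < 1}"
    by (intro closed_Collect_le open_Collect_less continuous_intros)+
  ultimately show ?thesis by auto
qed

text \<open>Substitute \<open>y = x + \<mu> l\<close> for fixed \<open>\<mu>\<close>; the indicator then says that \<open>\<mu>\<close> lies in a half-open
  interval of length \<open>1\<close>.\<close>

lemma slab_integral:
  fixes h :: "'a::euclidean_space \<Rightarrow> ennreal"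
  assumes h: "h \<in> borel_measurable borel" and l: "norm l = 1"
  shows "(\<integral>\<^sup>+x. indicator (slab l) x * (\<integral>\<^sup>+\<mu>. h (x + \<mu> *\<^sub>R l) \<partial>lborel) \<partial>lborel) = (\<integral>\<^sup>+x. h x \<partial>lborel)"
proof -
  have ll: "l \<bullet> l = 1" using l by (simp add: dot_square_norm)
  have c1: "(\<lambda>z :: 'a \<times> real. fst z + snd z *\<^sub>R l) \<in> borel_measurable borel"
    and c2: "(\<lambda>z :: real \<times> 'a. snd z - fst z *\<^sub>R l) \<in> borel_measurable borel"
    by (intro borel_measurable_continuous_onI continuous_intros)+
  have i: "(indicator (slab l) :: 'a \<Rightarrow> ennreal) \<in> borel_measurable borel"
    by (rule borel_measurable_indicator[OF slab_borel])
  have m1: "(\<lambda>z :: 'a \<times> real. indicator (slab l) (fst z) * h (fst z + snd z *\<^sub>R l)) \<in> borel_measurable borel"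
    by (intro borel_measurable_times_ennreal measurable_compose[OF _ i] measurable_compose[OF c1 h])
      (intro borel_measurable_continuous_onI continuous_intros)
  have m2: "(\<lambda>z :: real \<times> 'a. indicator (slab l) (snd z - fst z *\<^sub>R l) * h (snd z)) \<in> borel_measurable borel"
    by (intro borel_measurable_times_ennreal measurable_compose[OF c2 i] measurable_compose[OF _ h])
      (intro borel_measurable_continuous_onI continuous_intros)
  have "(\<integral>\<^sup>+x. indicator (slab l) x * (\<integral>\<^sup>+\<mu>. h (x + \<mu> *\<^sub>R l) \<partial>lborel) \<partial>lborel)
      = (\<integral>\<^sup>+x. \<integral>\<^sup>+\<mu>. indicator (slab l) x * h (x + \<mu> *\<^sub>R l) \<partial>lborel \<partial>lborel)"
  proof (intro nn_integral_cong nn_integral_cmult[symmetric])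
    fix x :: 'a
    have "(\<lambda>\<mu> :: real. x + \<mu> *\<^sub>R l) \<in> borel_measurable borel"
      by (intro borel_measurable_continuous_onI continuous_intros)
    from measurable_compose[OF this h] show "(\<lambda>\<mu>. h (x + \<mu> *\<^sub>R l)) \<in> borel_measurable lborel" by simp
  qed
  also have "\<dots> = (\<integral>\<^sup>+\<mu>. \<integral>\<^sup>+x. indicator (slab l) x * h (x + \<mu> *\<^sub>R l) \<partial>lborel \<partial>lborel)"
    by (rule nn_integral_swap[OF m1])
  also have "\<dots> = (\<integral>\<^sup>+\<mu>. \<integral>\<^sup>+y. indicator (slab l) (y - \<mu> *\<^sub>R l) * h y \<partial>lborel \<partial>lborel)"
  proof (rule nn_integral_cong)
    fix \<mu> :: real
    have "(\<lambda>y. indicator (slab l) (y - \<mu> *\<^sub>R l) * h y) \<in> borel_measurable borel"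
      by (intro borel_measurable_times_ennreal measurable_compose[OF _ i] h)
        (intro borel_measurable_continuous_onI continuous_intros)
    from nn_integral_lborel_shift[OF this, of "\<mu> *\<^sub>R l"]
    show "(\<integral>\<^sup>+x. indicator (slab l) x * h (x + \<mu> *\<^sub>R l) \<partial>lborel) = (\<integral>\<^sup>+y. indicator (slab l) (y - \<mu> *\<^sub>R l) * h y \<partial>lborel)"
      by simp
  qed
  also have "\<dots> = (\<integral>\<^sup>+y. \<integral>\<^sup>+\<mu>. indicator (slab l) (y - \<mu> *\<^sub>R l) * h y \<partial>lborel \<partial>lborel)"
    by (rule nn_integral_swap[OF m2])
  also have "\<dots> = (\<integral>\<^sup>+y. h y \<partial>lborel)"
  proof (rule nn_integral_cong)
    fix y :: 'a
    have "indicator (slab l) (y - \<mu> *\<^sub>R l) = (indicator {y \<bullet> l - 1<..y \<bullet> l} \<mu> :: ennreal)" for \<mu> :: real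
      by (auto simp: slab_def indicator_def inner_diff_left ll)
    then have "(\<integral>\<^sup>+\<mu>. indicator (slab l) (y - \<mu> *\<^sub>R l) * h y \<partial>lborel) = (\<integral>\<^sup>+\<mu>. h y * indicator {y \<bullet> l - 1<..y \<bullet> l} \<mu> \<partial>lborel)"
      by (simp add: mult.commute)
    also have "\<dots> = h y" by (simp add: nn_integral_cmult_indicator)
    finally show "(\<integral>\<^sup>+\<mu>. indicator (slab l) (y - \<mu> *\<^sub>R l) * h y \<partial>lborel) = h y" .
  qed
  finally show ?thesis .
qed

lemma line_measurable:
  fixes g :: "real \<Rightarrow> 'a::euclidean_space \<Rightarrow> real"
  assumes g: "(\<lambda>z. g (fst z) (snd z)) \<in> borel_measurable borel"
  shows "(\<lambda>z. g (fst z) (x + snd z *\<^sub>R l)) \<in> borel_measurable borel"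
proof -
  have "(\<lambda>z :: real \<times> real. (fst z, x + snd z *\<^sub>R l)) \<in> borel_measurable borel"
    by (intro borel_measurable_continuous_onI continuous_intros)
  from measurable_compose[OF this g] show ?thesis by simp
qed

lemma Lp_norm_pow_lines:
  fixes g :: "real \<Rightarrow> 'a::euclidean_space \<Rightarrow> real"
  assumes g: "(\<lambda>z. g (fst z) (snd z)) \<in> borel_measurable borel" and l: "norm l = 1"
  shows "(\<lambda>x. indicator (slab l) x * Lp_norm_pow T p (\<lambda>t \<mu> :: real. g t (x + \<mu> *\<^sub>R l))) \<in> borel_measurable borel"
    and "(\<integral>\<^sup>+x. indicator (slab l) x * Lp_norm_pow T p (\<lambda>t \<mu> :: real. g t (x + \<mu> *\<^sub>R l)) \<partial>lborel) = Lp_norm_pow T p g"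
proof -
  let ?h = "\<lambda>t x. ennreal (\<bar>g t x\<bar> powr p)" and ?I = "indicator {0<..<T} :: real \<Rightarrow> ennreal"
  let ?J = "\<lambda>x t. \<integral>\<^sup>+\<mu>. ?h t (x + \<mu> *\<^sub>R l) \<partial>(lborel :: real measure)"
  have "(\<lambda>w :: ('a \<times> real) \<times> real. (snd (fst w), fst (fst w) + snd w *\<^sub>R l)) \<in> borel_measurable borel"
    by (intro borel_measurable_continuous_onI continuous_intros)
  from measurable_compose[OF this g]
  have "(\<lambda>w :: ('a \<times> real) \<times> real. g (snd (fst w)) (fst (fst w) + snd w *\<^sub>R l)) \<in> borel_measurable borel" by simp
  then have "(\<lambda>w :: ('a \<times> real) \<times> real. ?h (snd (fst w)) (fst (fst w) + snd w *\<^sub>R l)) \<in> borel_measurable borel"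
    by measurable
  then have "(\<lambda>(z, \<mu>). ?h (snd z) (fst z + \<mu> *\<^sub>R l)) \<in> borel_measurable (borel \<Otimes>\<^sub>M lborel)"
    unfolding measurable_borel_lborel by (simp add: case_prod_beta')
  then have J: "(\<lambda>z. ?J (fst z) (snd z)) \<in> borel_measurable borel"
    by (rule lborel.borel_measurable_nn_integral)
  have fm: "fst \<in> borel_measurable (borel :: ('a \<times> real) measure)" "snd \<in> borel_measurable (borel :: ('a \<times> real) measure)"
    by (intro borel_measurable_continuous_onI continuous_intros)+
  have s: "(indicator (slab l) :: 'a \<Rightarrow> ennreal) \<in> borel_measurable borel"
    by (rule borel_measurable_indicator[OF slab_borel])
  have It: "?I \<in> borel_measurable borel" by simp
  have K: "(\<lambda>z. ?I (snd z) * ?J (fst z) (snd z)) \<in> borel_measurable borel"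
    by (intro borel_measurable_times_ennreal J measurable_compose[OF fm(2) It])
  then have "(\<lambda>(x, t). ?I t * ?J x t) \<in> borel_measurable (borel \<Otimes>\<^sub>M lborel)"
    unfolding measurable_borel_lborel by (simp add: case_prod_beta')
  then have K': "(\<lambda>x. \<integral>\<^sup>+t. ?I t * ?J x t \<partial>lborel) \<in> borel_measurable borel"
    by (rule lborel.borel_measurable_nn_integral)
  have it: "Lp_norm_pow T p (\<lambda>t \<mu> :: real. g t (x + \<mu> *\<^sub>R l)) = (\<integral>\<^sup>+t. ?I t * ?J x t \<partial>lborel)" for x
    by (rule Lp_norm_pow_iterated[OF line_measurable[OF g]])
  show "(\<lambda>x. indicator (slab l) x * Lp_norm_pow T p (\<lambda>t \<mu> :: real. g t (x + \<mu> *\<^sub>R l))) \<in> borel_measurable borel"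
    unfolding it by (intro borel_measurable_times_ennreal s K')
  have h: "?h t \<in> borel_measurable borel" for t
    using section_measurable[OF g, of t] by measurable
  have Jx: "(\<lambda>x. ?J x t) \<in> borel_measurable borel" for t
  proof -
    have "(\<lambda>x :: 'a. (x, t)) \<in> borel_measurable borel" by (intro borel_measurable_continuous_onI continuous_intros)
    from measurable_compose[OF this J] show ?thesis by simp
  qed
  have Jt: "(\<lambda>t. ?I t * ?J x t) \<in> borel_measurable lborel" for x
  proof -
    have "(\<lambda>t :: real. (x, t)) \<in> borel_measurable borel" by (intro borel_measurable_continuous_onI continuous_intros)
    from measurable_compose[OF this K] show ?thesis by simp
  qed
  have "(\<integral>\<^sup>+x. indicator (slab l) x * Lp_norm_pow T p (\<lambda>t \<mu> :: real. g t (x + \<mu> *\<^sub>R l)) \<partial>lborel)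
      = (\<integral>\<^sup>+x. \<integral>\<^sup>+t. indicator (slab l) x * (?I t * ?J x t) \<partial>lborel \<partial>lborel)"
    unfolding it by (intro nn_integral_cong nn_integral_cmult[symmetric] Jt)
  also have "\<dots> = (\<integral>\<^sup>+t. \<integral>\<^sup>+x. indicator (slab l) x * (?I t * ?J x t) \<partial>lborel \<partial>lborel)"
    by (rule nn_integral_swap) (intro borel_measurable_times_ennreal K measurable_compose[OF fm(1) s])
  also have "\<dots> = (\<integral>\<^sup>+t. ?I t * (\<integral>\<^sup>+x. ?h t x \<partial>lborel) \<partial>lborel)"
  proof (rule nn_integral_cong)
    fix t :: real
    have "(\<integral>\<^sup>+x. indicator (slab l) x * (?I t * ?J x t) \<partial>lborel) = (\<integral>\<^sup>+x. ?I t * (indicator (slab l) x * ?J x t) \<partial>lborel)"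
      by (simp add: mult_ac)
    also have "\<dots> = ?I t * (\<integral>\<^sup>+x. indicator (slab l) x * ?J x t \<partial>lborel)"
      using s Jx by (intro nn_integral_cmult borel_measurable_times_ennreal) simp_all
    finally show "(\<integral>\<^sup>+x. indicator (slab l) x * (?I t * ?J x t) \<partial>lborel) = ?I t * (\<integral>\<^sup>+x. ?h t x \<partial>lborel)"
      by (simp only: slab_integral[OF h l])
  qed
  also have "\<dots> = Lp_norm_pow T p g" by (rule Lp_norm_pow_iterated[OF g, symmetric])
  finally show "(\<integral>\<^sup>+x. indicator (slab l) x * Lp_norm_pow T p (\<lambda>t \<mu> :: real. g t (x + \<mu> *\<^sub>R l)) \<partial>lborel) = Lp_norm_pow T p g" .
qed

lemma Lp_estimate_heat:
  fixes l :: "'a::euclidean_space"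
  assumes T: "0 < T" and \<alpha>: "0 \<le> \<alpha>" "\<alpha> \<le> 1" and S: "admissible T S" "solves T (\<lambda>s. outer l) S" and l: "norm l = 1"
    and N: "heat_Lp_constant T \<alpha> p N"
  shows "Lp_estimate T p l (ennreal N) S"
  unfolding Lp_estimate_def
proof (intro allI impI)
  fix F :: "'a list \<Rightarrow> real \<Rightarrow> 'a \<Rightarrow> real" assume F: "jet F" "bounded_support (F [])"
  have le: "Lp_norm_pow T p (\<lambda>t \<mu>. line_hessian l S F t (x + \<mu> *\<^sub>R l)) \<le> ennreal N * Lp_norm_pow T p (\<lambda>t \<mu>. F [] t (x + \<mu> *\<^sub>R l))" for x
  proof -
    let ?V = "line_jet l x (\<lambda>bs. S (F bs))"
    have V: "jet ?V" by (rule jet_line_jet[OF admissible_jet[OF S(1) F(1)]])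
    have p: "partials [1, 1] (?V [] t) = (\<lambda>\<mu>. line_hessian l S F t (x + \<mu> *\<^sub>R l))" for t
      using jet_partials[OF V, of "[1, 1]" "[]" t] by (auto simp: line_jet_second line_hessian_def)
    have "Lp_norm_pow T p (\<lambda>t. partials [1, 1] (?V [] t)) \<le> ennreal N * Lp_norm_pow T p (line_jet l x F [])"
      using N jet_B_c[OF jet_line_jet[OF F(1)] bounded_support_line[where F = F, OF F(2) l]] line_heat_solution[OF \<alpha> S F(1)]
      unfolding heat_Lp_constant_def by blast
    moreover have "line_jet l x F [] = (\<lambda>t \<mu>. F [] t (x + \<mu> *\<^sub>R l))"
      by (intro ext) (simp add: line_jet_Nil)
    ultimately show ?thesis by (simp only: p)
  qed
  have hm: "(\<lambda>z. line_hessian l S F (fst z) (snd z)) \<in> borel_measurable borel"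
    by (rule line_hessian_measurable[OF S(1) F(1)])
  have "Lp_norm_pow T p (line_hessian l S F)
      = (\<integral>\<^sup>+x. indicator (slab l) x * Lp_norm_pow T p (\<lambda>t \<mu>. line_hessian l S F t (x + \<mu> *\<^sub>R l)) \<partial>lborel)"
    by (rule Lp_norm_pow_lines(2)[OF hm l, symmetric])
  also have "\<dots> \<le> (\<integral>\<^sup>+x. ennreal N * (indicator (slab l) x * Lp_norm_pow T p (\<lambda>t \<mu>. F [] t (x + \<mu> *\<^sub>R l))) \<partial>lborel)"
  proof (rule nn_integral_mono)
    fix x
    have "indicator (slab l) x * Lp_norm_pow T p (\<lambda>t \<mu>. line_hessian l S F t (x + \<mu> *\<^sub>R l))
        \<le> indicator (slab l) x * (ennreal N * Lp_norm_pow T p (\<lambda>t \<mu>. F [] t (x + \<mu> *\<^sub>R l)))"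
      by (rule mult_left_mono[OF le]) simp
    then show "indicator (slab l) x * Lp_norm_pow T p (\<lambda>t \<mu>. line_hessian l S F t (x + \<mu> *\<^sub>R l))
        \<le> ennreal N * (indicator (slab l) x * Lp_norm_pow T p (\<lambda>t \<mu>. F [] t (x + \<mu> *\<^sub>R l)))"
      by (simp only: mult.left_commute)
  qed
  also have "\<dots> = ennreal N * Lp_norm_pow T p (F [])"
    using Lp_norm_pow_lines[OF jet_measurable[OF F(1)] l] by (simp add: nn_integral_cmult)
  finally show "Lp_norm_pow T p (line_hessian l S F) \<le> ennreal N * Lp_norm_pow T p (F [])" .
qed


section \<open>Uniqueness of solution operators\<close>

text \<open>The difference of two solutions is bounded, has a Lipschitz Hessian, and solves the homogeneous
  equation.\<close>

lemma solution_operator_unique: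
  fixes A :: "real \<Rightarrow> 'a::euclidean_space \<Rightarrow> 'a \<Rightarrow> real"
  assumes A: "integrable_coeff T A" "\<And>s. 0 < s \<Longrightarrow> s < T \<Longrightarrow> psd (A s)"
    and S: "admissible T S" "solves T A S" and R: "admissible T R" "solves T A R"
    and F: "jet F" and T: "0 \<le> T" and t: "t \<in> {0..T}"
  shows "S (F []) t x = R (F []) t x"
proof -
  have Uj: "jet (\<lambda>bs. S (F bs))" and Vj: "jet (\<lambda>bs. R (F bs))"
    by (rule admissible_jet[OF S(1) F], rule admissible_jet[OF R(1) F])
  obtain C where C: "jet_bound 3 C F" using jet_has_bound[OF F] by blast
  have UB: "jet_bound 3 (T * C) (\<lambda>bs. S (F bs))" and VB: "jet_bound 3 (T * C) (\<lambda>bs. R (F bs))"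
    by (rule admissible_jet_bound[OF S(1) F C T], rule admissible_jet_bound[OF R(1) F C T])
  have C0: "0 \<le> T * C" using jet_bound_nonneg[OF UB] .
  define K where "K = 2 * real DIM('a) ^ 3 * (T * C)"
  have K0: "0 \<le> K" using C0 by (simp add: K_def)
  have ci: "set_integrable lborel {0<..<t} (\<lambda>s. contract (A s) (\<lambda>b c. S (F [b, c]) s x))"
    "set_integrable lborel {0<..<t} (\<lambda>s. contract (A s) (\<lambda>b c. R (F [b, c]) s x))" if "t \<in> {0..T}" for t x
    using contract_jet_integrable[OF A(1) Uj, of 0 t x] contract_jet_integrable[OF A(1) Vj, of 0 t x] that by auto
  have fi: "set_integrable lborel {0<..<t} (\<lambda>s. F [] s x)" for t x by (rule jet_time_integrable[OF F])
  have "S (F []) t x - R (F []) t x = 0"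
  proof (rule homogeneous_solution_zero[where ?w = "\<lambda>t x. S (F []) t x - R (F []) t x"
        and ?w2.0 = "\<lambda>t b c x. S (F [b, c]) t x - R (F [b, c]) t x" and ?T = T and ?A = A and ?K = "K + K" and ?\<alpha> = 1])
    show "psd (A s)" if "s \<in> {0<..<T}" for s using A(2) that by simp
    show "set_integrable lborel {0<..<T} (\<lambda>s. A s b c)" if "b \<in> Basis" "c \<in> Basis" for b c
      using A(1) that unfolding integrable_coeff_def by blast
    show "has_hessian (\<lambda>x. S (F []) t x - R (F []) t x) (\<lambda>b x. S (F [b]) t x - R (F [b]) t x)
        (\<lambda>b c x. S (F [b, c]) t x - R (F [b, c]) t x)" for t
      by (intro has_hessian_diff jet_hessian[OF Uj] jet_hessian[OF Vj])
    show "holder2 (K + K) 1 (\<lambda>b c x. S (F [b, c]) t x - R (F [b, c]) t x)" for t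
      unfolding K_def by (intro holder2_diff jet_holder2[OF Uj UB] jet_holder2[OF Vj VB]) auto
    show "\<bar>S (F []) t x - R (F []) t x\<bar> \<le> 2 * (T * C)" for t x
      using jet_boundD[OF UB, of "[]" t x] jet_boundD[OF VB, of "[]" t x] by simp
    fix t x assume t: "t \<in> {0..T}"
    show "set_integrable lborel {0<..<t} (\<lambda>s. contract (A s) (\<lambda>b c. S (F [b, c]) s x - R (F [b, c]) s x))"
      unfolding contract_diff_right by (rule set_integral_diff(1)[OF ci[OF t]])
    have "S (F []) t x = increment A S F 0 t x" "R (F []) t x = increment A R F 0 t x"
      using solves_increment[OF S(2) F order_refl, of t x] solves_initial[OF S(2) F]
        solves_increment[OF R(2) F order_refl, of t x] solves_initial[OF R(2) F] t by auto
    then show "S (F []) t x - R (F []) t x = (LINT s:{0<..<t}|lborel. contract (A s) (\<lambda>b c. S (F [b, c]) s x - R (F [b, c]) s x))"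
      unfolding contract_diff_right increment_def set_integral_diff(2)[OF ci[OF t]]
        set_integral_add(2)[OF ci(1)[OF t] fi] set_integral_add(2)[OF ci(2)[OF t] fi] by simp
  qed (use K0 t in auto)
  then show ?thesis by simp
qed

section \<open>Matrix coefficients\<close>

lemma sum_Basis_axis: "(\<Sum>b\<in>(Basis :: (real^'n) set). g b) = (\<Sum>i\<in>UNIV. g (axis i 1))"
proof -
  have B: "(Basis :: (real^'n) set) = (\<lambda>i. axis i 1) ` UNIV" by (auto simp: Basis_vec_def)
  have inj: "inj (\<lambda>i :: 'n. axis i (1 :: real))" by (auto simp: inj_on_def axis_eq_axis)
  show ?thesis unfolding B sum.reindex[OF inj] o_def ..
qed

lemma axis_Basis: "axis i (1 :: real) \<in> Basis"
  by (simp add: axis_in_Basis_iff)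

lemma Basis_axisE:
  assumes "b \<in> (Basis :: (real^'n) set)" obtains i where "b = axis i 1"
  using assms by (auto simp: Basis_vec_def)

definition entries :: "real^'n^'n \<Rightarrow> real^'n \<Rightarrow> real^'n \<Rightarrow> real" where
  "entries M b c = b \<bullet> (M *v c)"

lemma entries_axis [simp]: "entries M (axis i 1) (axis j 1) = M $ i $ j"
  by (simp add: entries_def matrix_vector_mult_basis inner_axis' column_def)

lemma contract_entries: "contract (entries M) H = (\<Sum>i\<in>UNIV. \<Sum>j\<in>UNIV. M $ i $ j * H (axis i 1) (axis j 1))"
  by (simp add: contract_def sum_Basis_axis)

lemma inner_axis_nth [simp]: "x \<bullet> axis i (1 :: real) = x $ i"
  by (simp add: inner_axis)

lemma quad_axis: "quad H l = (\<Sum>i\<in>UNIV. \<Sum>j\<in>UNIV. l $ i * l $ j * H (axis i 1) (axis j 1))"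
  by (simp add: quad_def contract_def sum_Basis_axis outer_def)

lemma elliptic_psd:
  fixes M :: "real^'n^'n"
  assumes sym: "transpose M = M" and ell: "\<And>\<xi>. (\<Sum>i\<in>UNIV. \<Sum>j\<in>UNIV. M $ i $ j * \<xi> $ i * \<xi> $ j) \<ge> (norm \<xi>)\<^sup>2"
  shows "psd (entries M)" and "norm l = 1 \<Longrightarrow> psd (\<lambda>b c. entries M b c - outer l b c)"
proof -
  have s: "M $ i $ j = M $ j $ i" for i j
    using arg_cong[OF sym, of "\<lambda>A. A $ j $ i"] by (simp add: transpose_def)
  have es: "entries M b c = entries M c b" if "b \<in> Basis" "c \<in> Basis" for b c
    using that s by (auto elim!: Basis_axisE)
  have e: "(norm \<xi>)\<^sup>2 \<le> contract (entries M) (outer \<xi>)" for \<xi>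
    using ell[of \<xi>] by (simp add: contract_entries outer_def mult.assoc)
  then show "psd (entries M)" unfolding psd_def using es order_trans[OF zero_le_power2] by blast
  assume l: "norm l = 1"
  have "0 \<le> contract (\<lambda>b c. entries M b c - outer l b c) (outer \<xi>)" for \<xi>
  proof -
    have "contract (outer l) (outer \<xi>) \<le> (norm \<xi>)\<^sup>2"
      unfolding contract_outer_outer
      using Cauchy_Schwarz_ineq2[of l \<xi>] l by (simp add: abs_le_square_iff[symmetric])
    then show ?thesis using e[of \<xi>] by (simp add: contract_diff_left)
  qed
  then show "psd (\<lambda>b c. entries M b c - outer l b c)"
    unfolding psd_def using es by (auto simp: outer_def mult.commute)
qed

lemma tr_entries: "tr (entries M) = trace M"
  by (simp add: tr_def sum_Basis_axis trace_def)

text \<open>The trace of a positive semidefinite matrix bounds all its entries.\<close>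

lemma entries_integrable:
  fixes a :: "real \<Rightarrow> real^'n^'n"
  assumes m: "a \<in> borel_measurable (restrict_space borel {0<..<T})"
    and psd: "\<And>s. 0 < s \<Longrightarrow> s < T \<Longrightarrow> psd (entries (a s))"
    and tr: "set_integrable lborel {0<..<T} (\<lambda>t. trace (a t))"
  shows "integrable_coeff T (\<lambda>s. entries (a s))"
  unfolding integrable_coeff_def
proof (intro ballI)
  fix b c :: "real^'n" assume bc: "b \<in> Basis" "c \<in> Basis"
  show "set_integrable lborel {0<..<T} (\<lambda>s. entries (a s) b c)"
  proof (rule set_integrable_bound[OF tr])
    obtain i j where ij: "b = axis i 1" "c = axis j 1" using bc by (auto elim!: Basis_axisE)
    have "(\<lambda>M :: real^'n^'n. M $ i $ j) \<in> borel_measurable borel"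
      by (intro borel_measurable_continuous_onI continuous_intros)
    from measurable_compose[OF m this] have "(\<lambda>s. entries (a s) b c) \<in> borel_measurable (restrict_space borel {0<..<T})"
      unfolding ij by simp
    then show "set_borel_measurable lborel {0<..<T} (\<lambda>s. entries (a s) b c)"
      unfolding set_borel_measurable_def by (subst (asm) borel_measurable_restrict_space_iff) auto
    show "AE s in lborel. s \<in> {0<..<T} \<longrightarrow> norm (entries (a s) b c) \<le> norm (trace (a s))"
      using psd_entry_bound[OF psd bc] psd_tr_nonneg[OF psd] by (auto simp: tr_entries)
  qed
qed

lemma is_time_integral_cong:
  assumes "\<And>s x. 0 < s \<Longrightarrow> s < T \<Longrightarrow> G s x = H s x" "\<And>t x. t \<in> {0..T} \<Longrightarrow> u t x = v t x"
  shows "is_time_integral T G u \<longleftrightarrow> is_time_integral T H v"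
proof -
  have 1: "set_integrable lborel {0<..<t} (\<lambda>s. G s x) \<longleftrightarrow> set_integrable lborel {0<..<t} (\<lambda>s. H s x)" if "t \<in> {0..T}" for t x
    by (rule set_integrable_cong) (use that assms(1) in auto)
  have 2: "(LINT s:{0<..<t}|lborel. G s x) = (LINT s:{0<..<t}|lborel. H s x)" if "t \<in> {0..T}" for t x
    by (rule set_lebesgue_integral_cong) (use that assms(1) in auto)
  from 1 2 show ?thesis unfolding is_time_integral_def using assms(2) by simp
qed

lemma Lp_norm_pow_cong:
  assumes "\<And>t x. 0 < t \<Longrightarrow> t < T \<Longrightarrow> g t x = h t x" shows "Lp_norm_pow T p g = Lp_norm_pow T p h"
  unfolding Lp_norm_pow_def by (intro nn_integral_cong) (auto simp: indicator_def assms)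

text \<open>Bounded solutions whose second derivatives are Hoelder continuous uniformly in time form a
  uniqueness class: the difference of two of them solves the homogeneous equation. In the theorem
  the supremum bound and the estimate of \<open>D\<^sub>i D\<^sub>j u\<close> put every candidate into this class.\<close>

lemma matrix_solution_unique:
  fixes a :: "real \<Rightarrow> real^'n^'n" and u v :: "real \<Rightarrow> real^'n \<Rightarrow> real"
  assumes A: "integrable_coeff T (\<lambda>s. entries (a s))" "\<And>s. 0 < s \<Longrightarrow> s < T \<Longrightarrow> psd (entries (a s))" and \<alpha>: "0 < \<alpha>"
    and eq: "is_time_integral T (\<lambda>s x. (\<Sum>i\<in>UNIV. \<Sum>j\<in>UNIV. a s $ i $ j * D2 i j (u s) x) + f s x) u"
      "is_time_integral T (\<lambda>s x. (\<Sum>i\<in>UNIV. \<Sum>j\<in>UNIV. a s $ i $ j * D2 i j (v s) x) + f s x) v"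
    and c2: "\<And>t. t \<in> {0..T} \<Longrightarrow> C_k 2 (u t)" "\<And>t. t \<in> {0..T} \<Longrightarrow> C_k 2 (v t)"
    and bd: "\<And>t x. t \<in> {0..T} \<Longrightarrow> \<bar>u t x\<bar> \<le> C" "\<And>t x. t \<in> {0..T} \<Longrightarrow> \<bar>v t x\<bar> \<le> C"
    and hd: "\<And>i j t. t \<in> {0..T} \<Longrightarrow> holder_seminorm \<alpha> (D2 i j (u t)) \<le> ennreal k"
      "\<And>i j t. t \<in> {0..T} \<Longrightarrow> holder_seminorm \<alpha> (D2 i j (v t)) \<le> ennreal k" and k: "0 \<le> k"
    and t: "t \<in> {0..T}"
  shows "u t x = v t x"
proof -
  define K where "K = k * (real DIM(real^'n))\<^sup>2"
  have K0: "0 \<le> K" using k by (simp add: K_def)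
  have hol: "holder2 K \<alpha> (\<lambda>b c. partials [b, c] g)" if "\<And>i j. holder_seminorm \<alpha> (D2 i j g) \<le> ennreal k" for g :: "real^'n \<Rightarrow> real"
    unfolding holder2_def
  proof (intro allI)
    fix x y w :: "real^'n"
    have "\<bar>quad (\<lambda>b c. partials [b, c] g x - partials [b, c] g y) w\<bar> \<le> (k * norm (x - y) powr \<alpha>) * (real DIM(real^'n))\<^sup>2 * (norm w)\<^sup>2"
    proof (rule quad_entries_bound)
      fix b c :: "real^'n" assume "b \<in> Basis" "c \<in> Basis"
      then obtain i j where ij: "b = axis i 1" "c = axis j 1" by (auto elim!: Basis_axisE)
      show "\<bar>partials [b, c] g x - partials [b, c] g y\<bar> \<le> k * norm (x - y) powr \<alpha>"
        using that[of i j] unfolding holder_seminorm_le_iff[OF k] D2_def ij by blast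
    qed
    then show "\<bar>quad (\<lambda>b c. partials [b, c] g x) w - quad (\<lambda>b c. partials [b, c] g y) w\<bar> \<le> K * norm (x - y) powr \<alpha> * (norm w)\<^sup>2"
      by (simp only: quad_diff K_def mult_ac)
  qed
  let ?L = "\<lambda>g s x. contract (entries (a s)) (\<lambda>b c. partials [b, c] (g s) x)"
  have L: "?L g s x = (\<Sum>i\<in>UNIV. \<Sum>j\<in>UNIV. a s $ i $ j * D2 i j (g s) x)" for g s x
    by (simp add: contract_entries D2_def del: partials.simps)
  have ui: "set_integrable lborel {0<..<t} (\<lambda>s. ?L u s x + f s x)" "u t x = (LINT s:{0<..<t}|lborel. ?L u s x + f s x)"
    and vi: "set_integrable lborel {0<..<t} (\<lambda>s. ?L v s x + f s x)" "v t x = (LINT s:{0<..<t}|lborel. ?L v s x + f s x)"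
    if "t \<in> {0..T}" for t x
    using eq that unfolding is_time_integral_def L by blast+
  have "u t x - v t x = 0"
  proof (rule homogeneous_solution_zero[where ?w = "\<lambda>t x. u t x - v t x"
        and ?w2.0 = "\<lambda>t b c x. partials [b, c] (u t) x - partials [b, c] (v t) x" and ?T = T and ?A = "\<lambda>s. entries (a s)"
        and ?K = "K + K" and ?\<alpha> = \<alpha> and ?C = "2 * C"])
    show "psd (entries (a s))" if "s \<in> {0<..<T}" for s using A(2) that by simp
    show "set_integrable lborel {0<..<T} (\<lambda>s. entries (a s) b c)" if "b \<in> Basis" "c \<in> Basis" for b c
      using A(1) that unfolding integrable_coeff_def by blast
    fix t assume t: "t \<in> {0..T}"
    show "has_hessian (\<lambda>x. u t x - v t x) (\<lambda>b x. partials [b] (u t) x - partials [b] (v t) x)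
        (\<lambda>b c x. partials [b, c] (u t) x - partials [b, c] (v t) x)"
      by (intro has_hessian_diff C_k_hessian c2 t)
    show "holder2 (K + K) \<alpha> (\<lambda>b c x. partials [b, c] (u t) x - partials [b, c] (v t) x)"
      by (intro holder2_diff hol hd t)
    fix x
    show "\<bar>u t x - v t x\<bar> \<le> 2 * C"
      using bd(1)[OF t, of x] bd(2)[OF t, of x] by linarith
    have e: "contract (entries (a s)) (\<lambda>b c. partials [b, c] (u s) x - partials [b, c] (v s) x) = (?L u s x + f s x) - (?L v s x + f s x)" for s
      unfolding contract_diff_right by simp
    show "set_integrable lborel {0<..<t} (\<lambda>s. contract (entries (a s)) (\<lambda>b c. partials [b, c] (u s) x - partials [b, c] (v s) x))"
      unfolding e by (rule set_integral_diff(1)[OF ui(1)[OF t] vi(1)[OF t]])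
    show "u t x - v t x = (LINT s:{0<..<t}|lborel. contract (entries (a s)) (\<lambda>b c. partials [b, c] (u s) x - partials [b, c] (v s) x))"
      unfolding e set_integral_diff(2)[OF ui(1)[OF t] vi(1)[OF t]] using ui(2)[OF t, of x] vi(2)[OF t, of x] by simp
  qed (use K0 t \<alpha> in auto)
  then show ?thesis by simp
qed

text \<open>Divide by \<open>\<kappa>\<close> to reach the normalization in the definition of \<open>N'\<close>.\<close>

theorem directional_to_full_holder:
  fixes U :: "(real^'n) list \<Rightarrow> real \<Rightarrow> real^'n \<Rightarrow> real"
  assumes N: "directional_holder_constant TYPE('n) \<alpha> N" and \<alpha>: "0 \<le> \<alpha>" "\<alpha> \<le> 1" and U: "jet U" and K: "0 \<le> K"
    and dir: "\<And>l x \<mu> \<nu>. norm l = 1 \<Longrightarrow>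
      \<bar>quad (\<lambda>b c. U [b, c] t (x + \<mu> *\<^sub>R l)) l - quad (\<lambda>b c. U [b, c] t (x + \<nu> *\<^sub>R l)) l\<bar> \<le> K * \<bar>\<mu> - \<nu>\<bar> powr \<alpha>"
  shows "holder_seminorm \<alpha> (D2 i j (U [] t)) \<le> ennreal (max 0 N * K)"
proof -
  have D2U: "D2 i j (V [] t) = V [axis i 1, axis j 1] t" if "jet V" for V :: "(real^'n) list \<Rightarrow> real \<Rightarrow> real^'n \<Rightarrow> real" and i j
    unfolding D2_def using jet_partials[OF that, of "[axis i 1, axis j 1]" "[]" t] axis_Basis by simp
  \<comment> \<open>The bound \<open>K\<close> may be zero, so one divides by larger numbers \<open>\<kappa>\<close> and lets them tend to \<open>K\<close>.\<close>
  have scaled: "\<bar>D2 i j (U [] t) x - D2 i j (U [] t) y\<bar> \<le> max 0 N * \<kappa> * norm (x - y) powr \<alpha>" if \<kappa>: "K < \<kappa>" for \<kappa> x y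
  proof -
    have \<kappa>0: "0 < \<kappa>" using \<kappa> K by simp
    define V where "V bs t x = 0 + (1 / \<kappa>) * U bs t x" for bs t x
    have V: "jet V" unfolding V_def by (rule jet_lincomb[OF jet_zero U])
    have d: "D2_dir l (V [] t) x = (1 / \<kappa>) * quad (\<lambda>b c. U [b, c] t x) l" for l x
      unfolding D2_dir_def D2U[OF V] quad_axis V_def by (simp add: sum_distrib_left mult_ac)
    have "(SUP x. holder_seminorm \<alpha> (\<lambda>\<mu>::real. D2_dir l (V [] t) (x + \<mu> *\<^sub>R l))) \<le> 1" if l: "norm l = 1" for l
    proof (rule SUP_least)
      fix x
      have "\<bar>(1 / \<kappa>) * quad (\<lambda>b c. U [b, c] t (x + \<mu> *\<^sub>R l)) l - (1 / \<kappa>) * quad (\<lambda>b c. U [b, c] t (x + \<nu> *\<^sub>R l)) l\<bar>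
          \<le> 1 * norm (\<mu> - \<nu>) powr \<alpha>" for \<mu> \<nu>
      proof -
        have "K * \<bar>\<mu> - \<nu>\<bar> powr \<alpha> \<le> \<kappa> * \<bar>\<mu> - \<nu>\<bar> powr \<alpha>" using \<kappa> by (intro mult_right_mono) auto
        with dir[OF l, of x \<mu> \<nu>]
        have "\<bar>quad (\<lambda>b c. U [b, c] t (x + \<mu> *\<^sub>R l)) l - quad (\<lambda>b c. U [b, c] t (x + \<nu> *\<^sub>R l)) l\<bar> \<le> \<kappa> * \<bar>\<mu> - \<nu>\<bar> powr \<alpha>" by linarith
        then show ?thesis
          using \<kappa>0 unfolding right_diff_distrib[symmetric] abs_mult by (simp add: field_simps)
      qed
      then have "holder_seminorm \<alpha> (\<lambda>\<mu>::real. D2_dir l (V [] t) (x + \<mu> *\<^sub>R l)) \<le> ennreal 1"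
        unfolding d by (subst holder_seminorm_le_iff) auto
      then show "holder_seminorm \<alpha> (\<lambda>\<mu>::real. D2_dir l (V [] t) (x + \<mu> *\<^sub>R l)) \<le> 1" by simp
    qed
    then have "holder_seminorm \<alpha> (D2 i j (V [] t)) \<le> ennreal N"
      using N jet_C_2_holder[OF V \<alpha>] unfolding directional_holder_constant_def by blast
    also have "ennreal N \<le> ennreal (max 0 N)" by (intro ennreal_leI) simp
    finally have "\<bar>V [axis i 1, axis j 1] t x - V [axis i 1, axis j 1] t y\<bar> \<le> max 0 N * norm (x - y) powr \<alpha>"
      unfolding D2U[OF V] by (subst (asm) holder_seminorm_le_iff) auto
    then have "\<kappa> * \<bar>(1 / \<kappa>) * (U [axis i 1, axis j 1] t x - U [axis i 1, axis j 1] t y)\<bar> \<le> \<kappa> * (max 0 N * norm (x - y) powr \<alpha>)"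
      using \<kappa>0 unfolding V_def by (intro mult_left_mono) (simp_all add: right_diff_distrib)
    then show ?thesis
      unfolding D2U[OF U] abs_mult using \<kappa>0 by (simp add: mult_ac)
  qed
  have "\<bar>D2 i j (U [] t) x - D2 i j (U [] t) y\<bar> \<le> max 0 N * K * norm (x - y) powr \<alpha>" for x y
  proof (rule tendsto_lowerbound)
    show "((\<lambda>\<kappa>. max 0 N * \<kappa> * norm (x - y) powr \<alpha>) \<longlongrightarrow> max 0 N * K * norm (x - y) powr \<alpha>) (at_right K)"
      by (intro tendsto_intros)
    show "eventually (\<lambda>\<kappa>. \<bar>D2 i j (U [] t) x - D2 i j (U [] t) y\<bar> \<le> max 0 N * \<kappa> * norm (x - y) powr \<alpha>) (at_right K)"
      using eventually_at_right_less by (rule eventually_mono) (rule scaled)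
  qed simp
  then show ?thesis using K by (subst holder_seminorm_le_iff) auto
qed

section \<open>Estimates for the full equation\<close>

text \<open>The operator \<open>R\<close> of the proof is built from the heat equation along \<open>l\<close> and inherits its estimates.
  By uniqueness it agrees with \<open>S\<close>, for whatever way \<open>S\<close> has been constructed.\<close>

theorem elliptic_line_estimates:
  fixes A :: "real \<Rightarrow> 'a::euclidean_space \<Rightarrow> 'a \<Rightarrow> real"
  assumes T: "0 < T" and \<alpha>: "0 \<le> \<alpha>" "\<alpha> \<le> 1" and p: "1 < p" and l: "norm l = 1"
    and A: "integrable_coeff T A" "\<And>s. 0 < s \<Longrightarrow> s < T \<Longrightarrow> psd (A s)"
    and ell: "\<And>s. 0 < s \<Longrightarrow> s < T \<Longrightarrow> psd (\<lambda>b c. A s b c - outer l b c)"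
    and N: "heat_holder_constant T \<alpha> N\<^sub>0" "heat_Lp_constant T \<alpha> p N\<^sub>p"
    and S: "admissible T S" "solves T A S"
  shows "holder_estimate \<alpha> l (max 0 N\<^sub>0) S" and "Lp_estimate T p l (ennreal N\<^sub>p) S"
proof -
  obtain Sl where "admissible T Sl" "solves T (\<lambda>s b c. 0 + outer l b c) Sl"
    by (rule perturbed_solution_operator[OF T pure_source_admissible[OF T] pure_source_solves[OF T] _ outer_integrable[of T l]])
      (auto simp: integrable_coeff_def psd_def contract_def set_integrable_def psd_outer[unfolded psd_def contract_def])
  then have Sl: "admissible T Sl" "solves T (\<lambda>s. outer l) Sl" by simp_all
  have Bi: "integrable_coeff T (\<lambda>s b c. A s b c - outer l b c)"
    using A(1) outer_integrable[of T l] unfolding integrable_coeff_def by (auto intro!: set_integral_diff(1))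
  obtain R Rn where R: "admissible T R" "solves T (\<lambda>s b c. outer l b c + (A s b c - outer l b c)) R"
    and Rn: "\<And>n :: nat. kicked Sl (Rn n)" "\<And>f t x. smooth f \<Longrightarrow> (\<lambda>n. Rn n f t x) \<longlonglongrightarrow> R f t x"
    using perturbed_solution_operator[OF T Sl outer_integrable Bi psd_outer ell] by blast
  have R2: "solves T A R" using R(2) by simp
  have hR: "holder_estimate \<alpha> l (max 0 N\<^sub>0) R"
    by (rule holder_estimate_limit[OF holder_estimate_kicked[OF Rn(1) holder_estimate_heat[OF T \<alpha> Sl l N(1)]] Rn(2)])
  have pR: "Lp_estimate T p l (ennreal N\<^sub>p) R"
    by (rule Lp_estimate_limit[OF p admissible_kicked[OF Rn(1) Sl(1)]
          Lp_estimate_kicked[OF p Sl(1) Lp_estimate_heat[OF T \<alpha> Sl l N(2)] Rn(1)] Rn(2)])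
  have e: "line_hessian l R F = line_hessian l S F" if F: "jet F" for F
  proof (intro ext)
    fix t x
    have "R (F [b, c]) t x = S (F [b, c]) t x" for b c
    proof (cases "t \<in> {0..T}")
      case True
      show ?thesis
        using solution_operator_unique[OF A R(1) R2 S jet_append[OF F, of "[b, c]"] less_imp_le[OF T] True] by simp
    next
      case False
      then show ?thesis using admissible_outside[OF R(1) smoothI[OF F]] admissible_outside[OF S(1) smoothI[OF F]] by simp
    qed
    then show "line_hessian l R F t x = line_hessian l S F t x" by (simp add: line_hessian_def)
  qed
  show "holder_estimate \<alpha> l (max 0 N\<^sub>0) S" using hR e unfolding holder_estimate_def by simp
  show "Lp_estimate T p l (ennreal N\<^sub>p) S" using pR e unfolding Lp_estimate_def by simp
qed

lemma jet_holder_finite: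
  assumes "jet F" "0 \<le> \<alpha>" "\<alpha> \<le> 1"
  shows "\<exists>c\<ge>0. \<forall>t x y. \<bar>F [] t x - F [] t y\<bar> \<le> c * norm (x - y) powr \<alpha>"
proof -
  obtain C where C: "jet_bound 1 C F" using jet_has_bound[OF assms(1)] by blast
  then show ?thesis
    using jet_lipschitz[OF assms(1) C, of "[]" \<alpha>] assms jet_bound_nonneg[OF C] by (intro exI[of _ "2 * real DIM('a) * C"]) auto
qed

lemma below_ennreal:
  assumes "x \<le> ennreal c" obtains k where "0 \<le> k" "x = ennreal k"
  using assms by (cases x) (auto simp: top_unique)

lemma ennreal_times_max: "0 \<le> c \<Longrightarrow> ennreal N * ennreal c = ennreal (max 0 N * c)"
  by (cases "0 \<le> N") (auto simp: ennreal_mult ennreal_neg max_def)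

theorem theorem3p1:
  fixes T \<alpha> p N\<^sub>0 N\<^sub>p N' :: real
    and a :: "real \<Rightarrow> real^'n^'n"
    and f :: "real \<Rightarrow> real^'n \<Rightarrow> real"
  assumes "0 < T" and "0 < \<alpha>" and "\<alpha> < 1" and "1 < p"
    and "heat_holder_constant T \<alpha> N\<^sub>0"
    and "heat_Lp_constant T \<alpha> p N\<^sub>p"
    and "directional_holder_constant TYPE('n) \<alpha> N'"
    and "a \<in> borel_measurable (restrict_space borel {0<..<T})"
    and "\<And>t. t \<in> {0<..<T} \<Longrightarrow> transpose (a t) = a t"
    and "\<And>t \<xi>. t \<in> {0<..<T} \<Longrightarrow>
           (\<Sum>i\<in>UNIV. \<Sum>j\<in>UNIV. a t $ i $ j * \<xi> $ i * \<xi> $ j) \<ge> (norm \<xi>)\<^sup>2"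
    and "set_integrable lborel {0<..<T} (\<lambda>t. trace (a t))"
    and "f \<in> B_c T"
  shows "\<exists>!u :: real \<Rightarrow> real^'n \<Rightarrow> real.
    u \<in> extensional {0..T} \<and>
    continuous_on ({0..T} \<times> UNIV) (\<lambda>(t, x). u t x) \<and>
    is_time_integral T
      (\<lambda>s x. (\<Sum>i\<in>UNIV. \<Sum>j\<in>UNIV. a s $ i $ j * D2 i j (u s) x) + f s x) u \<and>
    (\<forall>t\<in>{0..T}. u t \<in> C_2_holder \<alpha>) \<and>
    (SUP (t, x)\<in>{0..T} \<times> UNIV. ennreal \<bar>u t x\<bar>)
      \<le> ennreal T * (SUP (t, x)\<in>{0<..<T} \<times> UNIV. ennreal \<bar>f t x\<bar>) \<and>
    (\<forall>i j. (SUP t\<in>{0..T}. holder_seminorm \<alpha> (D2 i j (u t)))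
      \<le> ennreal N' * ennreal N\<^sub>0 * (SUP t\<in>{0<..<T}. holder_seminorm \<alpha> (f t))) \<and>
    (\<forall>l. norm l = 1 \<longrightarrow>
      (SUP (t, x)\<in>{0..T} \<times> UNIV. holder_seminorm \<alpha> (\<lambda>\<mu>::real. D2_dir l (u t) (x + \<mu> *\<^sub>R l)))
        \<le> ennreal N\<^sub>0 *
           (SUP (t, x)\<in>{0<..<T} \<times> UNIV. holder_seminorm \<alpha> (\<lambda>\<mu>::real. f t (x + \<mu> *\<^sub>R l))) \<and>
      Lp_norm_pow T p (\<lambda>t. D2_dir l (u t)) \<le> ennreal N\<^sub>p * Lp_norm_pow T p f)"
    (is "\<exists>!u. ?P u")
proof -
  note T = \<open>0 < T\<close> and p = \<open>1 < p\<close>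
  have \<alpha>: "0 \<le> \<alpha>" "\<alpha> \<le> 1" using assms(2,3) by auto
  let ?A = "\<lambda>s. entries (a s)"
  have psd: "psd (?A s)" if "0 < s" "s < T" for s
    using elliptic_psd(1)[OF assms(9,10)] that by simp
  have ell: "psd (\<lambda>b c. ?A s b c - outer l b c)" if "0 < s" "s < T" "norm l = 1" for s l
    using elliptic_psd(2)[OF assms(9,10)] that by simp
  have A: "integrable_coeff T ?A" by (rule entries_integrable[OF assms(8) psd assms(11)])
  obtain F where F: "jet F" "bounded_support (F [])" and Fin: "\<And>t. t \<in> {0<..<T} \<Longrightarrow> F [] t = f t"
    and Fout: "\<And>t. t \<notin> {0<..<T} \<Longrightarrow> F [] t = (\<lambda>x. 0)"
    using B_c_jet[OF assms(12)] by blast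
  obtain S where "admissible T S" "solves T (\<lambda>s b c. 0 + ?A s b c) S"
    by (rule perturbed_solution_operator[OF T pure_source_admissible[OF T] pure_source_solves[OF T] _ A])
      (use psd in \<open>auto simp: integrable_coeff_def psd_def contract_def set_integrable_def\<close>)
  then have S: "admissible T S" "solves T ?A S" by simp_all
  define U where "U bs = S (F bs)" for bs
  have U: "jet U" unfolding U_def by (rule admissible_jet[OF S(1) F(1)])
  define u where "u = restrict (U []) {0..T}"
  have u: "u t = U [] t" if "t \<in> {0..T}" for t using that by (simp add: u_def)
  have D2u: "D2 i j (u t) = U [axis i 1, axis j 1] t" if "t \<in> {0..T}" for i j t
    unfolding D2_def u[OF that] using jet_partials[OF U, of "[axis i 1, axis j 1]" "[]" t] axis_Basis by simp
  have dir: "D2_dir l (u t) x = line_hessian l S F t x" if "t \<in> {0..T}" for l t x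
    unfolding D2_dir_def D2u[OF that] line_hessian_def quad_axis U_def ..
  have hol: "holder_estimate \<alpha> l (max 0 N\<^sub>0) S" and Lp: "Lp_estimate T p l (ennreal N\<^sub>p) S" if "norm l = 1" for l
    using elliptic_line_estimates[OF T \<alpha> p that A psd ell[OF _ _ that] assms(5,6) S] by blast+

  have cont: "continuous_on ({0..T} \<times> UNIV) (\<lambda>(t, x). u t x)"
    by (rule continuous_on_eq[OF solution_continuous[OF S A F(1)]]) (auto simp: u U_def)
  have eqn: "is_time_integral T (\<lambda>s x. (\<Sum>i\<in>UNIV. \<Sum>j\<in>UNIV. a s $ i $ j * D2 i j (u s) x) + f s x) u"
  proof (rule is_time_integral_cong[THEN iffD1, OF _ _ solution_time_integral[OF S A F(1)]])
    show "contract (?A s) (\<lambda>b c. S (F [b, c]) s x) + F [] s x = (\<Sum>i\<in>UNIV. \<Sum>j\<in>UNIV. a s $ i $ j * D2 i j (u s) x) + f s x"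
      if "0 < s" "s < T" for s x
      using that by (simp add: contract_entries D2u U_def Fin)
    show "S (F []) t x = u t x" if "t \<in> {0..T}" for t x using that by (simp add: u U_def)
  qed
  have c2: "\<forall>t\<in>{0..T}. u t \<in> C_2_holder \<alpha>"
    using jet_C_2_holder[OF U \<alpha>] u by simp

  \<comment> \<open>The data have finite sup norm and Hoelder seminorms, so each estimate may be read in the reals.\<close>
  obtain C where C: "\<And>t x. \<bar>F [] t x\<bar> \<le> C" using jet_bounded[OF F(1)] by blast
  obtain c where c: "0 \<le> c" "\<And>t x y. \<bar>F [] t x - F [] t y\<bar> \<le> c * norm (x - y) powr \<alpha>"
    using jet_holder_finite[OF F(1) \<alpha>] by blast
  let ?sup = "SUP (t, x)\<in>{0<..<T} \<times> UNIV. ennreal \<bar>f t x\<bar>"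
  let ?hol = "SUP t\<in>{0<..<T}. holder_seminorm \<alpha> (f t)"
  let ?lhol = "\<lambda>l. SUP (t, x)\<in>{0<..<T} \<times> UNIV. holder_seminorm \<alpha> (\<lambda>\<mu>::real. f t (x + \<mu> *\<^sub>R l))"
  have sup_le: "?sup \<le> ennreal C"
  proof (rule SUP_least, clarify)
    fix t and x :: "real^'n" assume t: "t \<in> {0<..<T}"
    show "ennreal \<bar>f t x\<bar> \<le> ennreal C" using C[of t x] unfolding Fin[OF t] by (rule ennreal_leI)
  qed
  have hol_le: "?hol \<le> ennreal c"
  proof (rule SUP_least)
    fix t assume t: "t \<in> {0<..<T}"
    show "holder_seminorm \<alpha> (f t) \<le> ennreal c"
      using c(2)[of t] unfolding Fin[OF t] holder_seminorm_le_iff[OF c(1)] by blast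
  qed
  have lhol_le: "?lhol l \<le> ?hol" if l: "norm l = 1" for l
  proof (rule SUP_least, clarify)
    fix t and x :: "real^'n" assume t: "t \<in> {0<..<T}"
    have "holder_seminorm \<alpha> (f t) \<le> ?hol" using t by (rule SUP_upper)
    moreover obtain k where k: "0 \<le> k" "?hol = ennreal k"
      using hol_le by (rule below_ennreal)
    ultimately have h: "\<bar>f t y - f t z\<bar> \<le> k * norm (y - z) powr \<alpha>" for y z
      by (simp add: holder_seminorm_le_iff)
    have "\<bar>f t (x + \<mu> *\<^sub>R l) - f t (x + \<nu> *\<^sub>R l)\<bar> \<le> k * norm (\<mu> - \<nu>) powr \<alpha>" for \<mu> \<nu>
      using h[of "x + \<mu> *\<^sub>R l" "x + \<nu> *\<^sub>R l"] l by (simp flip: scaleR_left_diff_distrib)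
    then show "holder_seminorm \<alpha> (\<lambda>\<mu>::real. f t (x + \<mu> *\<^sub>R l)) \<le> ?hol"
      unfolding k(2) holder_seminorm_le_iff[OF k(1)] by blast
  qed

  have sup: "(SUP (t, x)\<in>{0..T} \<times> UNIV. ennreal \<bar>u t x\<bar>) \<le> ennreal T * ?sup"
  proof (rule SUP_least, clarify)
    fix t and x :: "real^'n" assume t: "t \<in> {0..T}"
    obtain m where m: "0 \<le> m" "?sup = ennreal m"
      using sup_le by (rule below_ennreal)
    have "\<bar>F [] s y\<bar> \<le> m" for s y
    proof (cases "s \<in> {0<..<T}")
      case True
      have "ennreal \<bar>f s y\<bar> \<le> ?sup" using True by (intro SUP_upper2[of "(s, y)"]) auto
      then show ?thesis using True m by (simp add: Fin)
    qed (simp add: Fout m)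
    then have "\<bar>S (F []) t x\<bar> \<le> T * m" by (rule admissible_bound[OF S(1) smoothI[OF F(1)]])
    then show "ennreal \<bar>u t x\<bar> \<le> ennreal T * ?sup"
      using t T m by (simp add: u U_def flip: ennreal_mult)
  qed
  have line: "\<bar>line_hessian l S F t (x + \<mu> *\<^sub>R l) - line_hessian l S F t (x + \<nu> *\<^sub>R l)\<bar> \<le> max 0 N\<^sub>0 * k * \<bar>\<mu> - \<nu>\<bar> powr \<alpha>"
    if l: "norm l = 1" and k: "0 \<le> k" "?lhol l \<le> ennreal k" for l k t x \<mu> \<nu>
  proof -
    have "line_holder \<alpha> l k (F [])"
      unfolding line_holder_def
    proof (intro allI)
      fix t x \<mu> \<nu>
      show "\<bar>F [] t (x + \<mu> *\<^sub>R l) - F [] t (x + \<nu> *\<^sub>R l)\<bar> \<le> k * \<bar>\<mu> - \<nu>\<bar> powr \<alpha>"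
      proof (cases "t \<in> {0<..<T}")
        case True
        have "holder_seminorm \<alpha> (\<lambda>\<mu>::real. f t (x + \<mu> *\<^sub>R l)) \<le> ?lhol l"
          using True by (intro SUP_upper2[of "(t, x)"]) auto
        then have "holder_seminorm \<alpha> (\<lambda>\<mu>::real. f t (x + \<mu> *\<^sub>R l)) \<le> ennreal k" using k(2) by (rule order_trans)
        then show ?thesis using True by (simp add: holder_seminorm_le_iff[OF k(1)] Fin)
      qed (simp add: Fout k)
    qed
    then show ?thesis
      using hol[OF l] F k(1) unfolding holder_estimate_def line_holder_def by blast
  qed
  have full: "(SUP t\<in>{0..T}. holder_seminorm \<alpha> (D2 i j (u t))) \<le> ennreal N' * ennreal N\<^sub>0 * ?hol" for i j
  proof (rule SUP_least)
    fix t assume t: "t \<in> {0..T}"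
    obtain k where k: "0 \<le> k" "?hol = ennreal k"
      using hol_le by (rule below_ennreal)
    have "holder_seminorm \<alpha> (D2 i j (U [] t)) \<le> ennreal (max 0 N' * (max 0 N\<^sub>0 * k))"
    proof (rule directional_to_full_holder[OF assms(7) \<alpha> U])
      fix l x :: "real^'n" and \<mu> \<nu> :: real assume l: "norm l = 1"
      show "\<bar>quad (\<lambda>b c. U [b, c] t (x + \<mu> *\<^sub>R l)) l - quad (\<lambda>b c. U [b, c] t (x + \<nu> *\<^sub>R l)) l\<bar> \<le> max 0 N\<^sub>0 * k * \<bar>\<mu> - \<nu>\<bar> powr \<alpha>"
        using line[OF l k(1), of t x \<mu> \<nu>] lhol_le[OF l] by (simp add: line_hessian_def U_def k(2))
    qed (use k in simp)
    also have "\<dots> = ennreal N' * (ennreal N\<^sub>0 * ennreal k)"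
      using k by (simp only: ennreal_times_max mult_nonneg_nonneg max.cobounded1)
    finally show "holder_seminorm \<alpha> (D2 i j (u t)) \<le> ennreal N' * ennreal N\<^sub>0 * ?hol"
      unfolding k(2) u[OF t] by (simp only: mult.assoc)
  qed
  have dirhol: "(SUP (t, x)\<in>{0..T} \<times> UNIV. holder_seminorm \<alpha> (\<lambda>\<mu>::real. D2_dir l (u t) (x + \<mu> *\<^sub>R l))) \<le> ennreal N\<^sub>0 * ?lhol l"
    if l: "norm l = 1" for l
  proof (rule SUP_least, clarify)
    fix t and x :: "real^'n" assume t: "t \<in> {0..T}"
    have "?lhol l \<le> ennreal c" using lhol_le[OF l] hol_le by (rule order_trans)
    then obtain k where k: "0 \<le> k" "?lhol l = ennreal k"
      by (rule below_ennreal)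
    have "holder_seminorm \<alpha> (\<lambda>\<mu>::real. D2_dir l (u t) (x + \<mu> *\<^sub>R l)) \<le> ennreal (max 0 N\<^sub>0 * k)"
      using line[OF l k(1), of t x] k by (subst holder_seminorm_le_iff) (auto simp: dir[OF t])
    also have "\<dots> = ennreal N\<^sub>0 * ?lhol l" unfolding k(2) by (rule ennreal_times_max[OF k(1), symmetric])
    finally show "holder_seminorm \<alpha> (\<lambda>\<mu>::real. D2_dir l (u t) (x + \<mu> *\<^sub>R l)) \<le> ennreal N\<^sub>0 * ?lhol l" .
  qed
  have Lpest: "Lp_norm_pow T p (\<lambda>t. D2_dir l (u t)) \<le> ennreal N\<^sub>p * Lp_norm_pow T p f" if l: "norm l = 1" for l
  proof -
    have "Lp_norm_pow T p (\<lambda>t. D2_dir l (u t)) = Lp_norm_pow T p (line_hessian l S F)"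
      by (rule Lp_norm_pow_cong) (simp add: dir)
    also have "\<dots> \<le> ennreal N\<^sub>p * Lp_norm_pow T p (F [])"
      using Lp[OF l] F unfolding Lp_estimate_def by blast
    also have "Lp_norm_pow T p (F []) = Lp_norm_pow T p f"
      by (rule Lp_norm_pow_cong) (simp add: Fin)
    finally show ?thesis .
  qed

  show ?thesis
  proof (rule ex1I[of ?P u])
    show "?P u"
      using cont eqn c2 sup full dirhol Lpest by (auto simp: u_def)
    fix v assume v: "?P v"
    show "v = u"
    proof (rule extensionalityI[of _ "{0..T}"])
      show "v \<in> extensional {0..T}" using v by blast
      show "u \<in> extensional {0..T}" by (simp add: u_def)
      fix t assume t: "t \<in> {0..T}"
      let ?k = "max 0 N' * (max 0 N\<^sub>0 * c)"
      have bound: "\<bar>w t x\<bar> \<le> T * max 0 C"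
        if "(SUP (t, x)\<in>{0..T} \<times> UNIV. ennreal \<bar>w t x\<bar>) \<le> ennreal T * ?sup" "t \<in> {0..T}" for w :: "real \<Rightarrow> real^'n \<Rightarrow> real" and t x
      proof -
        have "ennreal \<bar>w t x\<bar> \<le> (SUP (t, x)\<in>{0..T} \<times> UNIV. ennreal \<bar>w t x\<bar>)"
          using that(2) by (intro SUP_upper2[of "(t, x)"]) auto
        also have "\<dots> \<le> ennreal T * ennreal C"
          using that(1) mult_left_mono[OF sup_le, of "ennreal T"] by (rule order_trans) simp
        also have "\<dots> \<le> ennreal (T * max 0 C)"
          using T by (cases "0 \<le> C") (auto simp: ennreal_mult ennreal_neg)
        finally show ?thesis using T by (simp add: ennreal_le_iff)
      qed
      have hbound: "holder_seminorm \<alpha> (D2 i j (w t)) \<le> ennreal ?k"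
        if "\<forall>i j. (SUP t\<in>{0..T}. holder_seminorm \<alpha> (D2 i j (w t))) \<le> ennreal N' * ennreal N\<^sub>0 * ?hol" "t \<in> {0..T}"
        for w :: "real \<Rightarrow> real^'n \<Rightarrow> real" and t i j
      proof -
        have "holder_seminorm \<alpha> (D2 i j (w t)) \<le> (SUP t\<in>{0..T}. holder_seminorm \<alpha> (D2 i j (w t)))"
          using that(2) by (rule SUP_upper)
        also have "\<dots> \<le> ennreal N' * ennreal N\<^sub>0 * ?hol" using that(1) by blast
        also have "\<dots> \<le> ennreal N' * ennreal N\<^sub>0 * ennreal c" using hol_le by (rule mult_left_mono) simp
        also have "\<dots> = ennreal ?k"
          using c(1) by (simp only: mult.assoc ennreal_times_max mult_nonneg_nonneg max.cobounded1)
        finally show ?thesis .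
      qed
      have ck: "C_k 2 (w t)" if "\<forall>t\<in>{0..T}. w t \<in> C_2_holder \<alpha>" "t \<in> {0..T}" for w :: "real \<Rightarrow> real^'n \<Rightarrow> real" and t
        using that unfolding C_2_holder_def by blast
      show "v t = u t"
      proof (rule ext)
        fix x
        show "v t x = u t x"
        proof (rule matrix_solution_unique[OF A psd assms(2) _ eqn, where k = ?k and C = "T * max 0 C"])
          show "is_time_integral T (\<lambda>s x. (\<Sum>i\<in>UNIV. \<Sum>j\<in>UNIV. a s $ i $ j * D2 i j (v s) x) + f s x) v"
            using v by blast
          show "C_k 2 (v t)" if "t \<in> {0..T}" for t using v by (intro ck that) blast
          show "C_k 2 (u t)" if "t \<in> {0..T}" for t by (intro ck c2 that)
          show "\<bar>v t x\<bar> \<le> T * max 0 C" if "t \<in> {0..T}" for t x using v by (intro bound that) blast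
          show "\<bar>u t x\<bar> \<le> T * max 0 C" if "t \<in> {0..T}" for t x by (intro bound sup that)
          show "holder_seminorm \<alpha> (D2 i j (v t)) \<le> ennreal ?k" if "t \<in> {0..T}" for i j t using v by (intro hbound that) blast
          show "holder_seminorm \<alpha> (D2 i j (u t)) \<le> ennreal ?k" if "t \<in> {0..T}" for i j t using full by (intro hbound that) blast
        qed (use c t in auto)
      qed
    qed
  qed
qed

end
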